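(* Let $\nu>0$ be fixed. For $\beta>0$ and an integer $N\ge1$ let $X_\beta$ be a $C_N^B$-valued, $\tau_{\nu,\beta}$-distributed random variable, and let $\tilde X_\beta:=\phi_\beta(X_\beta)$. Then the rescaled random variables $\tilde X_\beta$ converge in distribution for $\beta\to\infty$ to some probability measure $\mu$ on $\mathbb R^N$ with the half space $B_N=\{y\in\mathbb R^N:\ \langle y,r\rangle\ge0\}$ as support. This measure $\mu$ is given by $$\mu:=\frac1{\sqrt{2\pi}}\int_0^\infty \mathcal N\bigl(\sqrt s\,r,\ s\,A\Sigma A\bigr)\,s^{-3/2}\exp(-1/(2s))\,ds .$$ Moreover, $\mu$ has the Lebesgue density $$f(y):=D(N)\exp\Bigl(-\frac{N(N+\nu-1)}{2\|p_r(y)\|^2}\,y^{T}\Sigma^{-1}y\Bigr)\exp\Bigl(\frac{-N(N+\nu-1)}{2\|p_r(y)\|^2}\Bigr)\frac1{\|p_r(y)\|^{N+1}}$$ with $$D(N):=\frac{\sqrt2\,\sqrt{N!}\,(N(N+\nu-1))^{N/2}\,e^{N(N+\nu-1)}}{\pi^{N/2}}$$ for $y$ in the interior of $B_N$.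
   Context: $C_N^B:=\{x\in\mathbb R^N:\ x_1\ge x_2\ge\dots\ge x_N\ge0\}$ is the closed Weyl chamber of type $B_N$. For $\nu>0$, $\beta>0$, $\tau_{\nu,\beta}$ is the probability measure on $C_N^B$ with Lebesgue density $$f_{\nu,\beta}(y)=C_B(\nu,\beta,N)\,\frac1{(1+\|y\|^2)^{\beta N(N+\nu-1)+(N+1)/2}}\prod_{1\le i<j\le N}(y_i^2-y_j^2)^{2\beta}\prod_{i=1}^N y_i^{2\nu\beta},$$ with norming constant $$C_B(\nu,\beta,N)=\frac{N!\,2^N\,\Gamma(\beta N(N+\nu-1)+(N+1)/2)}{\sqrt\pi}\prod_{j=1}^N\frac{\Gamma(1+\beta)}{\Gamma(1+j\beta)\,\Gamma(\frac12+\beta(j+\nu-1))}.$$ Let $z_1^{(\nu-1)}\ge\dots\ge z_N^{(\nu-1)}$ be the ordered zeros of the Laguerre polynomial $L_N^{(\nu-1)}$ (the $L_n^{(\nu-1)}$ are orthogonal with respect to $e^{-x}x^{\nu-1}$ on $]0,\infty[$). The vector $r=(r_1,\dots,r_N)\in C_N^B$ is defined by $2(z_1^{(\nu-1)},\dots,z_N^{(\nu-1)})=(r_1^2,\dots,r_N^2)$. $\Sigma$ is the (regular) covariance matrix whose inverse $\Sigma^{-1}=(s_{i,j})_{i,j=1,\dots,N}$ is $$s_{i,i}=1+\frac{2\nu}{r_i^2}+2\sum_{l\ne i}(r_i-r_l)^{-2}+2\sum_{l\ne i}(r_i+r_l)^{-2},\qquad s_{i,j}=2(r_i+r_j)^{-2}-2(r_i-r_j)^{-2}\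 \ (i\ne j).$$ $p_r$ and $p_{r^\perp}$ are the orthogonal projections of $\mathbb R^N$ onto $\mathbb R\cdot r$ and onto its orthogonal complement $r^\perp$, respectively, and $A$ is the matrix of $p_{r^\perp}$ in the standard coordinates on $\mathbb R^N$. The rescaling maps are the linear maps $$\phi_\beta:\mathbb R^N\to\mathbb R^N,\qquad\phi_\beta(y)=\frac1{\sqrt\beta}\,p_r(y)+p_{r^\perp}(y).$$ $\mathcal N(m,S)$ denotes the (possibly singular) $N$-dimensional normal distribution with mean $m$ and covariance matrix $S$; the integral defining $\mu$ is a mixture of measures.
   Formalization: In the density f and in D(N), every N(N+ν−1) is replaced by 2N(N+ν−1)=‖r‖²; the printed density contradicts the stated mixture (e.g. N=1: mixture density 2√(ν/π) y⁻² e^{−ν/y²}, printed √(2ν/π) y⁻² e^{−ν/(2y²)}). *)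

theory Defs
  imports "HOL-Probability.Probability" "HOL-Computational_Algebra.Computational_Algebra"
begin

text \<open>
  The coordinates \<open>1, \<dots>, N\<close> of \<open>\<real>\<^sup>N\<close> are the elements of an arbitrary finite linearly ordered index
  type \<open>'n\<close>, so that \<open>N = CARD('n)\<close>.
\<close>

definition weyl_chamber_B :: "(real ^ 'n::{finite,linorder}) set" where
  "weyl_chamber_B = {x. (\<forall>i j. i \<le> j \<longrightarrow> x $ j \<le> x $ i) \<and> (\<forall>i. 0 \<le> x $ i)}"

definition tau_exponent :: "nat \<Rightarrow> real \<Rightarrow> real \<Rightarrow> real" where
  "tau_exponent N \<nu> \<beta> = \<beta> * real N * (real N + \<nu> - 1) + (real N + 1) / 2"

definition C_B :: "real \<Rightarrow> real \<Rightarrow> nat \<Rightarrow> real" where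
  "C_B \<nu> \<beta> N = fact N * 2 ^ N * Gamma (tau_exponent N \<nu> \<beta>) / sqrt pi *
     (\<Prod>j = 1..N. Gamma (1 + \<beta>) /
        (Gamma (1 + real j * \<beta>) * Gamma (1 / 2 + \<beta> * (real j + \<nu> - 1))))"

definition tau_density :: "real \<Rightarrow> real \<Rightarrow> real ^ 'n::{finite,linorder} \<Rightarrow> real" where
  "tau_density \<nu> \<beta> y =
     C_B \<nu> \<beta> CARD('n) * (1 / (1 + (norm y)\<^sup>2) powr tau_exponent CARD('n) \<nu> \<beta>) *
     (\<Prod>(i, j) \<in> {(i, j). i < j}. ((y $ i)\<^sup>2 - (y $ j)\<^sup>2) powr (2 * \<beta>)) *
     (\<Prod>i\<in>UNIV. (y $ i) powr (2 * \<nu> * \<beta>))"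

definition tau :: "real \<Rightarrow> real \<Rightarrow> (real ^ 'n::{finite,linorder}) measure" where
  "tau \<nu> \<beta> = density lborel (\<lambda>y. ennreal (tau_density \<nu> \<beta> y * indicator weyl_chamber_B y))"

text \<open>
  Laguerre polynomials in the standard normalisation (Szego, Orthogonal Polynomials, (5.1.6)),
  orthogonal with respect to \<open>exp (-x) * x powr \<alpha>\<close> on the positive half line if \<open>\<alpha> > -1\<close>.
\<close>

definition laguerre :: "nat \<Rightarrow> real \<Rightarrow> real poly" where
  "laguerre n \<alpha> = (\<Sum>k\<le>n. monom ((-1) ^ k * ((real n + \<alpha>) gchoose (n - k)) / fact k) k)"

text \<open>The real zeros of \<open>laguerre n \<alpha>\<close> in decreasing order; list positions start at \<open>0\<close>.\<close>

definition laguerre_zeros :: "nat \<Rightarrow> real \<Rightarrow> real list" where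
  "laguerre_zeros n \<alpha> = rev (sorted_list_of_multiset (proots (laguerre n \<alpha>)))"

definition r_vec :: "real \<Rightarrow> real ^ 'n::{finite,linorder}" where
  "r_vec \<nu> = (\<chi> i. sqrt (2 * (laguerre_zeros CARD('n) (\<nu> - 1) ! card {j. j < i})))"

definition Sigma_inv :: "real \<Rightarrow> real ^ 'n::{finite,linorder} ^ 'n::{finite,linorder}" where
  "Sigma_inv \<nu> = (let r = r_vec \<nu> in
     (\<chi> i j.
        if i = j then
          1 + 2 * \<nu> / (r $ i)\<^sup>2 + 2 * (\<Sum>l\<in>UNIV - {i}. 1 / (r $ i - r $ l)\<^sup>2)
            + 2 * (\<Sum>l\<in>UNIV - {i}. 1 / (r $ i + r $ l)\<^sup>2)
        else 2 / (r $ i + r $ j)\<^sup>2 - 2 / (r $ i - r $ j)\<^sup>2))"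

definition Sigma_cov :: "real \<Rightarrow> real ^ 'n::{finite,linorder} ^ 'n::{finite,linorder}" where
  "Sigma_cov \<nu> = matrix_inv (Sigma_inv \<nu>)"

definition proj_line :: "'a::euclidean_space \<Rightarrow> 'a \<Rightarrow> 'a" where
  "proj_line v y = (y \<bullet> v / (v \<bullet> v)) *\<^sub>R v"

definition proj_perp :: "'a::euclidean_space \<Rightarrow> 'a \<Rightarrow> 'a" where
  "proj_perp v y = y - proj_line v y"

definition A_mat :: "real \<Rightarrow> real ^ 'n::{finite,linorder} ^ 'n::{finite,linorder}" where
  "A_mat \<nu> = matrix (proj_perp (r_vec \<nu>))"

definition rescale :: "real \<Rightarrow> real \<Rightarrow> real ^ 'n::{finite,linorder} \<Rightarrow> real ^ 'n::{finite,linorder}" where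
  "rescale \<nu> \<beta> y = (1 / sqrt \<beta>) *\<^sub>R proj_line (r_vec \<nu>) y + proj_perp (r_vec \<nu>) y"

definition std_normal_vec :: "(real ^ 'n) measure" where
  "std_normal_vec = density lborel (\<lambda>x. ennreal (\<Prod>i\<in>UNIV. std_normal_density (x $ i)))"

text \<open>
  The possibly singular normal distribution with mean \<open>m\<close> and covariance matrix \<open>S\<close>: the law of
  \<open>m + B Z\<close> with \<open>Z\<close> standard normal and \<open>B B\<^sup>T = S\<close>. Such a \<open>B\<close> exists if and only if \<open>S\<close> is symmetric
  and positive semidefinite, and the law does not depend on its choice.
\<close>

definition normal_distribution :: "real ^ 'n \<Rightarrow> real ^ 'n ^ 'n \<Rightarrow> (real ^ 'n) measure" where
  "normal_distribution m S =
     (let B = (SOME B :: real ^ 'n ^ 'n. B ** transpose B = S)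
      in distr std_normal_vec borel (\<lambda>z. m + B *v z))"

definition converges_in_distribution ::
    "('i \<Rightarrow> 'a::topological_space measure) \<Rightarrow> 'a measure \<Rightarrow> 'i filter \<Rightarrow> bool" where
  "converges_in_distribution P Q F \<longleftrightarrow>
     (\<forall>f :: 'a \<Rightarrow> real. continuous_on UNIV f \<longrightarrow> bounded (range f) \<longrightarrow>
        ((\<lambda>i. \<integral>x. f x \<partial>P i) \<longlongrightarrow> (\<integral>x. f x \<partial>Q)) F)"

definition support_measure :: "'a::topological_space measure \<Rightarrow> 'a set" where
  "support_measure Q = {x. \<forall>U. open U \<longrightarrow> x \<in> U \<longrightarrow> emeasure Q U > 0}"

definition half_space_B :: "real \<Rightarrow> (real ^ 'n::{finite,linorder}) set" where
  "half_space_B \<nu> = {y. y \<bullet> r_vec \<nu> \<ge> 0}"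

text \<open>
  The constant below is \<open>\<parallel>r\<parallel>\<^sup>2 = 2 N (N + \<nu> - 1)\<close>, twice the sum of the zeros of the Laguerre polynomial.
  The source prints the density with \<open>N (N + \<nu> - 1)\<close> in its place at every occurrence, which is
  incompatible with the normalisation \<open>r\<^sub>i\<^sup>2 = 2 z\<^sub>i\<close> and with the mixture representation: for \<open>N = 1\<close>
  one has \<open>r = sqrt (2 \<nu>)\<close>, and the mixture is the law of \<open>r / \<bar>Z\<bar>\<close> with \<open>Z\<close> standard normal, whose
  density at \<open>y > 0\<close> is \<open>2 * sqrt (\<nu> / pi) * exp (- \<nu> / y\<^sup>2) / y\<^sup>2\<close>, whereas the printed
  density is \<open>sqrt (2 * \<nu> / pi) * exp (- \<nu> / (2 * y\<^sup>2)) / y\<^sup>2\<close>.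
\<close>

definition limit_const :: "nat \<Rightarrow> real \<Rightarrow> real" where
  "limit_const N \<nu> = 2 * (real N * (real N + \<nu> - 1))"

definition D_const :: "nat \<Rightarrow> real \<Rightarrow> real" where
  "D_const N \<nu> = sqrt 2 * sqrt (fact N) * limit_const N \<nu> powr (real N / 2) *
     exp (limit_const N \<nu>) / pi powr (real N / 2)"

definition limit_density :: "real \<Rightarrow> real ^ 'n::{finite,linorder} \<Rightarrow> real" where
  "limit_density \<nu> y =
     (let p = norm (proj_line (r_vec \<nu>) y); c = limit_const CARD('n) \<nu> in
        D_const CARD('n) \<nu> * exp (- (c / (2 * p\<^sup>2)) * (y \<bullet> (Sigma_inv \<nu> *v y))) *
        exp (- c / (2 * p\<^sup>2)) * (1 / p ^ (CARD('n) + 1)))"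

end

theory Submission
  imports Defs "HOL-Real_Asymp.Real_Asymp"
begin

text \<open>
  The logarithm \<open>G\<close> of the product in the density is a weighted sum of logarithms of linear forms. Its
  maximiser on the sphere satisfies Stieltjes' equilibrium equations, so it is the vector \<open>r\<close> of the
  Laguerre zeros, with \<open>\<nabla>G r = r\<close> and \<open>\<Sigma>\<^sup>-\<^sup>1 = I - D\<^sup>2G r\<close>; homogeneity of \<open>G\<close> gives \<open>\<Sigma>\<^sup>-\<^sup>1 r = 2 r\<close>.
  Writing \<open>z = \<surd>\<beta> a r + u\<close> with \<open>u \<bottom> r\<close> for the unscaled variable, concavity of the logarithm gives
  \<open>G z \<le> G r + \<parallel>r\<parallel>\<^sup>2 ln (\<surd>\<beta> a)\<close>, which bounds the rescaled densities, up to their normalising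
  constants, by a multivariate Cauchy density, while a second-order expansion at \<open>r\<close> gives their pointwise
  limit. By dominated convergence the normalising constants converge, and Stirling's formula identifies
  their limit. In the mixture, the substitution \<open>s = t\<^sup>2\<close> and the exchange of \<open>t\<close> with the component of the
  Gaussian variable along \<open>r\<close> produce the same function up to a constant; both measures have mass one.
\<close>

text \<open>The limit rests on a balance of exponents: \<open>energy\<close> has degree
  \<open>c = ||r||^2\<close>, and \<open>1 + ||y||^2\<close> carries the exponent
  \<open>\<beta> c / 2 + (N + 1) / 2\<close>. Along \<open>r\<close> the growth of the
  \<open>\<beta>\<close>-th power of \<open>energy\<close> is therefore cancelled exactly and only
  the fixed power \<open>(N + 1) / 2\<close> survives. This is why the component along
  \<open>r\<close> has size \<open>sqrt \<beta>\<close> and a heavy tail, while the orthogonal part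
  stays of order one. In the quadratic form of the limit the identity comes from the power of
  \<open>1 + ||y||^2\<close> and the remainder from the Hessian of \<open>G\<close>; since
  \<open>r\<close> is an eigenvector, the form splits without a cross term. The obstacle is the
  constants. Linear changes of variables and normal laws enter with unspecified factors, which
  comparisons of total mass settle later. Stirling's formula gives the normalising constant up to a
  factor \<open>exp (b \<beta>)\<close> whose rate \<open>b\<close> involves the value of
  \<open>energy\<close> at \<open>r\<close>; convergence of this constant to a positive number
  forces \<open>b = 0\<close>.\<close>

declare split_paired_All [simp del] split_paired_Ex [simp del]

section \<open>Lebesgue measure\<close>

lemma nn_integral_lborel_affine:
  fixes f :: "'a::euclidean_space \<Rightarrow> ennreal"
  assumes [measurable]: "f \<in> borel_measurable borel" and c: "c \<noteq> 0"
  shows "(\<integral>\<^sup>+x. f x \<partial>lborel) = ennreal (\<bar>c\<bar> ^ DIM('a)) * (\<integral>\<^sup>+x. f (t + c *\<^sub>R x) \<partial>lborel)"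
  by (subst lborel_affine[OF c, of t])
     (simp add: nn_integral_density nn_integral_distr nn_integral_cmult)

lemma nn_integral_lborel_translate:
  fixes f :: "'a::euclidean_space \<Rightarrow> ennreal"
  assumes "f \<in> borel_measurable borel"
  shows "(\<integral>\<^sup>+x. f (t + x) \<partial>lborel) = (\<integral>\<^sup>+x. f x \<partial>lborel)"
  using nn_integral_lborel_affine[OF assms, of 1 t] by simp

lemma nn_integral_lborel_reflect:
  fixes f :: "'a::euclidean_space \<Rightarrow> ennreal"
  assumes "f \<in> borel_measurable borel"
  shows "(\<integral>\<^sup>+x. f (t - x) \<partial>lborel) = (\<integral>\<^sup>+x. f x \<partial>lborel)"
  using nn_integral_lborel_affine[OF assms, of "-1" t] by simp

lemma nn_integral_lborel_swap:
  fixes f :: "'a::euclidean_space \<Rightarrow> 'b::euclidean_space \<Rightarrow> ennreal"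
  assumes "case_prod f \<in> borel_measurable borel"
  shows "(\<integral>\<^sup>+x. \<integral>\<^sup>+y. f x y \<partial>lborel \<partial>lborel) = (\<integral>\<^sup>+y. \<integral>\<^sup>+x. f x y \<partial>lborel \<partial>lborel)"
  using assms by (intro lborel_pair.Fubini'[symmetric]) (simp add: borel_prod[symmetric] measurable_cong_sets[OF sets_pair_measure_cong[OF sets_lborel sets_lborel]])

text \<open>The argument for uniqueness of Haar measure: pair \<open>h\<close> with a test function
  \<open>D\<close> of integral one; Fubini and translations move \<open>L\<close> from
  \<open>h\<close> to \<open>D\<close>. The factor \<open>k\<close> is the integral of
  \<open>D (L x)\<close> and stays implicit; later a comparison of total masses fixes it.\<close>

lemma exists_nn_integral_linear_scale:
  fixes L L' :: "'a::euclidean_space \<Rightarrow> 'a"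
  assumes L: "linear L" and L': "linear L'" and inv: "\<And>x. L' (L x) = x" "\<And>x. L (L' x) = x"
  obtains k where "\<And>h. h \<in> borel_measurable borel \<Longrightarrow>
    (\<integral>\<^sup>+x. h (L x) \<partial>lborel) = k * (\<integral>\<^sup>+x. h x \<partial>lborel)"
proof -
  have [measurable]: "L \<in> borel_measurable borel" "L' \<in> borel_measurable borel"
    using L L' by (auto intro!: borel_measurable_continuous_onI linear_continuous_on simp: linear_conv_bounded_linear)
  define D :: "'a \<Rightarrow> ennreal" where "D = indicator (box 0 One)"
  have [measurable]: "D \<in> borel_measurable borel" by (simp add: D_def)
  have D1: "(\<integral>\<^sup>+y. D y \<partial>lborel) = 1"
    by (simp add: D_def emeasure_lborel_box_eq)
  show thesis
  proof (rule that)
    fix h :: "'a \<Rightarrow> ennreal"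
    assume [measurable]: "h \<in> borel_measurable borel"
    have "(\<integral>\<^sup>+x. h (L x) \<partial>lborel) = (\<integral>\<^sup>+x. \<integral>\<^sup>+y. h (L x) * D y \<partial>lborel \<partial>lborel)"
      by (simp add: nn_integral_cmult D1)
    also have "\<dots> = (\<integral>\<^sup>+x. \<integral>\<^sup>+y. h (L x) * D (L x + y) \<partial>lborel \<partial>lborel)"
      by (intro nn_integral_cong nn_integral_lborel_translate[symmetric]) measurable
    also have "\<dots> = (\<integral>\<^sup>+y. \<integral>\<^sup>+x. h (L x) * D (L x + y) \<partial>lborel \<partial>lborel)"
      by (rule nn_integral_lborel_swap) (unfold borel_prod[symmetric], measurable)
    also have "\<dots> = (\<integral>\<^sup>+y. \<integral>\<^sup>+x. h (L x - y) * D (L x) \<partial>lborel \<partial>lborel)"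
    \<comment> \<open>Translating \<open>x\<close> by \<open>- L' y\<close> replaces
      \<open>L x\<close> by \<open>L x - y\<close>; this is where the inverse of \<open>L\<close>
      enters.\<close>
    proof (rule nn_integral_cong)
      fix y
      have "(\<integral>\<^sup>+x. h (L x) * D (L x + y) \<partial>lborel) = (\<integral>\<^sup>+x. h (L (- L' y + x)) * D (L (- L' y + x) + y) \<partial>lborel)"
        by (rule nn_integral_lborel_translate[symmetric]) measurable
      then show "(\<integral>\<^sup>+x. h (L x) * D (L x + y) \<partial>lborel) = (\<integral>\<^sup>+x. h (L x - y) * D (L x) \<partial>lborel)"
        by (simp add: linear_diff[OF L] inv)
    qed
    also have "\<dots> = (\<integral>\<^sup>+x. \<integral>\<^sup>+y. h (L x - y) * D (L x) \<partial>lborel \<partial>lborel)"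
      by (rule nn_integral_lborel_swap[symmetric]) (unfold borel_prod[symmetric], measurable)
    also have "\<dots> = (\<integral>\<^sup>+x. D (L x) * (\<integral>\<^sup>+y. h y \<partial>lborel) \<partial>lborel)"
      by (intro nn_integral_cong) (simp add: nn_integral_multc nn_integral_lborel_reflect mult.commute[of "D _"])
    also have "\<dots> = (\<integral>\<^sup>+x. D (L x) \<partial>lborel) * (\<integral>\<^sup>+y. h y \<partial>lborel)"
      by (simp add: nn_integral_multc)
    finally show "(\<integral>\<^sup>+x. h (L x) \<partial>lborel) = (\<integral>\<^sup>+x. D (L x) \<partial>lborel) * (\<integral>\<^sup>+x. h x \<partial>lborel)" .
  qed
qed

text \<open>Exchanging the component of \<open>x\<close> along \<open>r\<close> with an independent real variable is a product of
  three shears and a reflection, hence preserves Lebesgue measure. This replaces the orthogonal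
  decomposition of the space along \<open>r\<close>.\<close>

lemma nn_integral_exchange_component:
  fixes K :: "'a::euclidean_space \<Rightarrow> real \<Rightarrow> ennreal" and r :: 'a
  assumes K: "case_prod K \<in> borel_measurable borel" and r: "r \<noteq> 0"
  shows "(\<integral>\<^sup>+x. \<integral>\<^sup>+t. K x t \<partial>lborel \<partial>lborel) =
    (\<integral>\<^sup>+x. \<integral>\<^sup>+t. K (x + (t - x \<bullet> r / (r \<bullet> r)) *\<^sub>R r) (x \<bullet> r / (r \<bullet> r)) \<partial>lborel \<partial>lborel)"
proof -
  define a where "a x = x \<bullet> r / (r \<bullet> r)" for x
  have [measurable]: "a \<in> borel_measurable borel" unfolding a_def by measurable
  have a: "a (x + t *\<^sub>R r) = a x + t" for x t
    using r by (simp add: a_def inner_add_left add_divide_distrib)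
  have K2[measurable]: "(\<lambda>p. K (f p) (g p)) \<in> borel_measurable M"
    if "f \<in> borel_measurable M" "g \<in> borel_measurable M" for f g and M :: "'b measure"
    using measurable_compose[OF borel_measurable_Pair[OF that] K] by simp
  have "(\<integral>\<^sup>+x. \<integral>\<^sup>+t. K (x + (t - a x) *\<^sub>R r) (a x) \<partial>lborel \<partial>lborel) =
      (\<integral>\<^sup>+x. \<integral>\<^sup>+t. K (x + t *\<^sub>R r) (a x) \<partial>lborel \<partial>lborel)"
  proof (rule nn_integral_cong)
    fix x :: 'a
    show "(\<integral>\<^sup>+t. K (x + (t - a x) *\<^sub>R r) (a x) \<partial>lborel) = (\<integral>\<^sup>+t. K (x + t *\<^sub>R r) (a x) \<partial>lborel)"
      using nn_integral_lborel_translate[of "\<lambda>t. K (x + t *\<^sub>R r) (a x)" "- a x"]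
      by (simp add: algebra_simps)
  qed
  also have "\<dots> = (\<integral>\<^sup>+t. \<integral>\<^sup>+x. K (x + t *\<^sub>R r) (a x) \<partial>lborel \<partial>lborel)"
    by (rule nn_integral_lborel_swap) (unfold borel_prod[symmetric] case_prod_beta, measurable)
  also have "\<dots> = (\<integral>\<^sup>+t. \<integral>\<^sup>+x. K x (a x - t) \<partial>lborel \<partial>lborel)"
  proof (rule nn_integral_cong)
    fix t :: real
    have "a (t *\<^sub>R r + x) = a x + t" for x using a[of x t] by (simp add: add.commute)
    then show "(\<integral>\<^sup>+x. K (x + t *\<^sub>R r) (a x) \<partial>lborel) = (\<integral>\<^sup>+x. K x (a x - t) \<partial>lborel)"
      using nn_integral_lborel_translate[of "\<lambda>x. K x (a x - t)" "t *\<^sub>R r"]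
      by (simp add: add.commute)
  qed
  also have "\<dots> = (\<integral>\<^sup>+x. \<integral>\<^sup>+t. K x (a x - t) \<partial>lborel \<partial>lborel)"
    by (rule nn_integral_lborel_swap[symmetric]) (unfold borel_prod[symmetric] case_prod_beta, measurable)
  also have "\<dots> = (\<integral>\<^sup>+x. \<integral>\<^sup>+t. K x t \<partial>lborel \<partial>lborel)"
    by (intro nn_integral_cong nn_integral_lborel_reflect) measurable
  finally show ?thesis by (simp add: a_def)
qed

text \<open>Substitution on compact intervals followed by monotone convergence. It covers the open
  half lines of the mixture integral, where \<open>g\<close> or its derivative may be singular at an
  end point.\<close>

lemma nn_integral_substitution_exhaustion:
  fixes f :: "real \<Rightarrow> ennreal" and a b :: "nat \<Rightarrow> real"
  assumes [measurable]: "f \<in> borel_measurable borel"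
    and ab: "\<And>n. a n < b n" "decseq a" "incseq b"
    and der: "\<And>n x. x \<in> {a n..b n} \<Longrightarrow> (g has_real_derivative g' x) (at x)"
    and cont: "\<And>n. continuous_on {a n..b n} g'"
    and pos: "\<And>n x. x \<in> {a n..b n} \<Longrightarrow> 0 \<le> g' x"
    and inc: "decseq (\<lambda>n. g (a n))" "incseq (\<lambda>n. g (b n))"
    and A: "A = (\<Union>n. {a n..b n})" and B: "B = (\<Union>n. {g (a n)..g (b n)})"
  shows "(\<integral>\<^sup>+x. f x * indicator B x \<partial>lborel) = (\<integral>\<^sup>+x. f (g x) * ennreal (g' x) * indicator A x \<partial>lborel)"
proof -
  have incA: "incseq (\<lambda>n. {a n..b n})" and incB: "incseq (\<lambda>n. {g (a n)..g (b n)})"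
    using ab inc unfolding incseq_def decseq_def by (meson order_refl atLeastatMost_subset_iff)+
  have SUP: "(SUP n. indicator (C n) x) = (indicator (\<Union>n. C n) x :: ennreal)"
    if "incseq C" for C :: "nat \<Rightarrow> real set" and x
  proof (rule LIMSEQ_unique[OF LIMSEQ_SUP LIMSEQ_indicator_incseq[OF that]])
    show "incseq (\<lambda>n. indicator (C n) x :: ennreal)"
      using that unfolding incseq_def by (intro allI impI indicator_leI) blast
  qed
  \<comment> \<open>Nothing is assumed about \<open>g\<close> outside the intervals, so the cut-off
    is placed inside the argument of \<open>f\<close> as well.\<close>
  have mb: "(\<lambda>x. f (g x) * ennreal (g' x) * indicator {a n..b n} x) \<in> borel_measurable borel" for n
  proof -
    have g: "(\<lambda>x. indicator {a n..b n} x * g x) \<in> borel_measurable borel"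
      using borel_measurable_continuous_on_indicator[of "{a n..b n}" g]
        has_real_derivative_imp_continuous_on[of "{a n..b n}" g g', OF der] by simp
    have g': "(\<lambda>x. indicator {a n..b n} x * g' x) \<in> borel_measurable borel"
      using borel_measurable_continuous_on_indicator[of "{a n..b n}" g'] cont[of n] by simp
    have "(\<lambda>x. f (indicator {a n..b n} x * g x) * ennreal (indicator {a n..b n} x * g' x) * indicator {a n..b n} x)
       \<in> borel_measurable borel"
      using g g' by measurable
    also have "(\<lambda>x. f (indicator {a n..b n} x * g x) * ennreal (indicator {a n..b n} x * g' x) * indicator {a n..b n} x)
       = (\<lambda>x. f (g x) * ennreal (g' x) * indicator {a n..b n} x)"
      by (auto split: split_indicator)
    finally show ?thesis .
  qed
  have "(\<integral>\<^sup>+x. f x * indicator B x \<partial>lborel) = (\<integral>\<^sup>+x. (SUP n. f x * indicator {g (a n)..g (b n)} x) \<partial>lborel)"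
    unfolding B by (simp add: SUP_mult_left_ennreal[symmetric] SUP[OF incB])
  also have "\<dots> = (SUP n. \<integral>\<^sup>+x. f x * indicator {g (a n)..g (b n)} x \<partial>lborel)"
    using incB by (intro nn_integral_monotone_convergence_SUP)
      (auto simp: incseq_def le_fun_def subset_eq intro!: mult_left_mono indicator_leI)
  also have "\<dots> = (SUP n. \<integral>\<^sup>+x. f (g x) * ennreal (g' x) * indicator {a n..b n} x \<partial>lborel)"
    by (intro SUP_cong refl nn_integral_substitution_aux der cont pos ab) auto
  also have "\<dots> = (\<integral>\<^sup>+x. (SUP n. f (g x) * ennreal (g' x) * indicator {a n..b n} x) \<partial>lborel)"
    using incA mb by (intro nn_integral_monotone_convergence_SUP[symmetric])
      (auto simp: incseq_def le_fun_def subset_eq intro!: mult_left_mono indicator_leI)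
  also have "\<dots> = (\<integral>\<^sup>+x. f (g x) * ennreal (g' x) * indicator A x \<partial>lborel)"
    unfolding A by (simp add: SUP_mult_left_ennreal[symmetric] SUP[OF incA])
  finally show ?thesis .
qed

text \<open>A weight \<open>p\<close> of mass one on an auxiliary variable lets the exchange lemma
  turn the component along \<open>r\<close> into a free real variable. Scaling that variable is
  one-dimensional, and a second exchange restores the original integral. It gives the Jacobian of
  \<open>unscale\<close>.\<close>

lemma nn_integral_scale_component:
  fixes F :: "'a::euclidean_space \<Rightarrow> ennreal" and r :: 'a
  assumes [measurable]: "F \<in> borel_measurable borel" and r: "r \<noteq> 0" and t: "t > 0"
  shows "(\<integral>\<^sup>+x. F x \<partial>lborel) = ennreal t * (\<integral>\<^sup>+x. F (x + ((t - 1) * (x \<bullet> r / (r \<bullet> r))) *\<^sub>R r) \<partial>lborel)"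
proof -
  define a where "a x = x \<bullet> r / (r \<bullet> r)" for x
  have [measurable]: "a \<in> borel_measurable borel" unfolding a_def by measurable
  have a: "a (x + s *\<^sub>R r) = a x + s" for x s
    using r by (simp add: a_def inner_add_left add_divide_distrib)
  define p :: "real \<Rightarrow> ennreal" where "p = indicator {0..1}"
  have [measurable]: "p \<in> borel_measurable borel" by (simp add: p_def)
  have p1: "(\<integral>\<^sup>+s. p s \<partial>lborel) = 1" by (simp add: p_def)
  have "(\<integral>\<^sup>+x. F (x + ((t - 1) * a x) *\<^sub>R r) \<partial>lborel) = (\<integral>\<^sup>+x. \<integral>\<^sup>+s. F (x + ((t - 1) * a x) *\<^sub>R r) * p s \<partial>lborel \<partial>lborel)"
    by (simp add: nn_integral_cmult p1)
  also have "\<dots> = (\<integral>\<^sup>+x. \<integral>\<^sup>+s. F (x + (s - a x) *\<^sub>R r + ((t - 1) * a (x + (s - a x) *\<^sub>R r)) *\<^sub>R r) * p (a x) \<partial>lborel \<partial>lborel)"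
    unfolding a_def by (rule nn_integral_exchange_component[OF _ r]) (unfold borel_prod[symmetric] case_prod_beta, measurable)
  also have "\<dots> = (\<integral>\<^sup>+x. \<integral>\<^sup>+s. F (x + (t * s - a x) *\<^sub>R r) * p (a x) \<partial>lborel \<partial>lborel)"
  proof -
    have "x + (s - a x) *\<^sub>R r + ((t - 1) * a (x + (s - a x) *\<^sub>R r)) *\<^sub>R r = x + (t * s - a x) *\<^sub>R r" for x s
    proof -
      have "(s - a x) + (t - 1) * s = t * s - a x" by (simp add: left_diff_distrib)
      then show ?thesis by (simp add: a add.assoc flip: scaleR_add_left)
    qed
    then show ?thesis by (simp only:)
  qed
  finally have "ennreal t * (\<integral>\<^sup>+x. F (x + ((t - 1) * a x) *\<^sub>R r) \<partial>lborel) = (\<integral>\<^sup>+x. ennreal t * (\<integral>\<^sup>+s. F (x + (t * s - a x) *\<^sub>R r) * p (a x) \<partial>lborel) \<partial>lborel)"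
    by (simp add: nn_integral_cmult)
  also have "\<dots> = (\<integral>\<^sup>+x. \<integral>\<^sup>+s. F (x + (s - a x) *\<^sub>R r) * p (a x) \<partial>lborel \<partial>lborel)"
  proof (rule nn_integral_cong)
    fix x
    show "ennreal t * (\<integral>\<^sup>+s. F (x + (t * s - a x) *\<^sub>R r) * p (a x) \<partial>lborel) = (\<integral>\<^sup>+s. F (x + (s - a x) *\<^sub>R r) * p (a x) \<partial>lborel)"
      using t by (subst (2) nn_integral_real_affine[of _ t 0]) auto
  qed
  also have "\<dots> = (\<integral>\<^sup>+x. \<integral>\<^sup>+s. F x * p s \<partial>lborel \<partial>lborel)"
    unfolding a_def by (rule nn_integral_exchange_component[OF _ r, symmetric]) (unfold borel_prod[symmetric] case_prod_beta, measurable)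
  also have "\<dots> = (\<integral>\<^sup>+x. F x \<partial>lborel)"
    by (simp add: nn_integral_cmult p1)
  finally show ?thesis by (simp add: a_def)
qed

section \<open>Stirling's formula\<close>

text \<open>One bound for both signs, quadratic near \<open>0\<close> and linear at infinity, as
  Laplace's method needs. For \<open>w \<ge> 0\<close> the difference of the two sides has
  derivative \<open>(1 - 1 / (1 + x))^2 / 2\<close>; for \<open>w < 0\<close> already
  \<open>- w^2 / 2\<close> is an upper bound.\<close>

lemma ln_add_one_minus_self_le:
  fixes w :: real
  assumes "w > - 1"
  shows "ln (1 + w) - w \<le> - (w\<^sup>2 / (2 * (1 + \<bar>w\<bar>)))"
proof (cases "w \<ge> 0")
  case True
  define f where "f x = x / 2 + 1 / 2 - inverse (1 + x) / 2 - ln (1 + x)" for x :: real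
  have "f 0 \<le> f w"
  proof (rule DERIV_nonneg_imp_nondecreasing[OF True])
    fix x :: real assume x: "0 \<le> x" "x \<le> w"
    have "(f has_real_derivative (1 / 2 + inverse (1 + x) * inverse (1 + x) / 2 - inverse (1 + x))) (at x)"
      unfolding f_def using x by (auto intro!: derivative_eq_intros) (simp add: inverse_eq_divide)
    also have "1 / 2 + i * i / 2 - i = (1 - i)\<^sup>2 / 2" for i :: real
      by (simp add: power2_eq_square field_simps)
    finally have "(f has_real_derivative ((1 - inverse (1 + x))\<^sup>2 / 2)) (at x)" .
    then show "\<exists>y. (f has_real_derivative y) (at x) \<and> 0 \<le> y" by (meson zero_le_power2 divide_nonneg_pos zero_less_numeral)
  qed
  moreover have "w / 2 + 1 / 2 - inverse (1 + w) / 2 = w - w\<^sup>2 / (2 * (1 + w))"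
    using True by (simp add: field_simps power2_eq_square)
  ultimately show ?thesis using True by (simp add: f_def)
next
  case False
  define f where "f x = ln (1 + x) - x + x\<^sup>2 / 2" for x :: real
  have "f w \<le> f 0"
  proof (rule DERIV_nonneg_imp_nondecreasing[of w 0 f])
    show "w \<le> 0" using False by simp
    fix x :: real assume x: "w \<le> x" "x \<le> 0"
    have "(f has_real_derivative (x\<^sup>2 / (1 + x))) (at x)"
      unfolding f_def using x assms
      by (auto intro!: derivative_eq_intros simp: divide_simps power2_eq_square) (simp add: algebra_simps)
    then show "\<exists>y. (f has_real_derivative y) (at x) \<and> 0 \<le> y"
      using x assms by (auto intro!: exI[of _ "x\<^sup>2 / (1 + x)"])
  qed
  moreover have "w\<^sup>2 / (2 * (1 + \<bar>w\<bar>)) \<le> w\<^sup>2 / 2"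
    by (intro divide_left_mono) auto
  ultimately show ?thesis by (simp add: f_def)
qed

text \<open>Serves twice: for the integrand in Stirling's formula and for the expansion of
  \<open>energy\<close> at \<open>r\<close>.\<close>

lemma tendsto_scaled_ln_remainder:
  "((\<lambda>x::real. x * (ln (1 + h / sqrt x) - h / sqrt x)) \<longlongrightarrow> - (h\<^sup>2 / 2)) at_top"
proof (cases h "0::real" rule: linorder_cases)
  case less then show ?thesis by (real_asymp simp: power2_eq_square)
next
  case greater then show ?thesis by (real_asymp simp: power2_eq_square)
qed simp

text \<open>From \<open>(1 + \<bar>y\<bar>)^2 \<le> 2 (1 + y^2)\<close> the integrand is at most a
  multiple of \<open>(1 + \<bar>y\<bar>) powr - (2 p)\<close>, which has an elementary
  antiderivative, and \<open>2 p > 1\<close>.\<close>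

lemma integrable_one_plus_square_powr:
  fixes p :: real
  assumes p: "p > 1 / 2"
  shows "integrable lborel (\<lambda>y::real. (1 + y\<^sup>2) powr - p)"
proof -
  define f where "f y = (1 + y) powr - (2 * p)" for y :: real
  have [measurable]: "f \<in> borel_measurable borel" unfolding f_def by measurable
  have "(\<integral>\<^sup>+y. ennreal (f y) * indicator {0..} y \<partial>lborel) = 0 - (1 + 0) powr (1 - 2 * p) / (1 - 2 * p)"
  proof (rule nn_integral_FTC_atLeast)
    show "((\<lambda>y. (1 + y) powr (1 - 2 * p) / (1 - 2 * p)) has_real_derivative f y) (at y)" if "0 \<le> y" for y
    proof -
      have "((\<lambda>y. (1 + y) powr (1 - 2 * p)) has_real_derivative ((1 - 2 * p) * f y)) (at y)"
        unfolding f_def using that p by - ((rule derivative_eq_intros refl | simp)+)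
      from DERIV_cdivide[OF this, of "1 - 2 * p"] show ?thesis using p by simp
    qed
    show "((\<lambda>y. (1 + y) powr (1 - 2 * p) / (1 - 2 * p)) \<longlongrightarrow> 0) at_top"
      using p by real_asymp
  qed (auto simp: f_def)
  then have half: "(\<integral>\<^sup>+y. ennreal (f y) * indicator {0..} y \<partial>lborel) < \<infinity>" by simp
  have "(\<integral>\<^sup>+y. ennreal ((1 + y\<^sup>2) powr - p) \<partial>lborel)
      \<le> (\<integral>\<^sup>+y. ennreal (2 powr p) * (ennreal (f y) * indicator {0..} y + ennreal (f (- y)) * indicator {0..} (- y)) \<partial>lborel)"
  proof (rule nn_integral_mono)
    fix y :: real
    have "(1 + \<bar>y\<bar>)\<^sup>2 \<le> 2 * (1 + y\<^sup>2)" using sum_squares_ge_zero[of "\<bar>y\<bar> - 1" 0]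
      by (simp add: power2_eq_square algebra_simps)
    then have "(2 * (1 + y\<^sup>2)) powr - p \<le> ((1 + \<bar>y\<bar>)\<^sup>2) powr - p"
      using p by (intro powr_mono2') (auto intro!: zero_less_power)
    also have "((1 + \<bar>y\<bar>)\<^sup>2) powr - p = f \<bar>y\<bar>"
      by (simp add: f_def powr_powr flip: powr_numeral)
    also have "(2 * (1 + y\<^sup>2)) powr - p = 2 powr - p * (1 + y\<^sup>2) powr - p"
      by (rule powr_mult)
    finally have "2 powr p * (2 powr - p * (1 + y\<^sup>2) powr - p) \<le> 2 powr p * f \<bar>y\<bar>"
      by (rule mult_left_mono) simp
    then have "(1 + y\<^sup>2) powr - p \<le> 2 powr p * f \<bar>y\<bar>"
      by (simp add: mult.assoc[symmetric] powr_add[symmetric])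
    then have "ennreal ((1 + y\<^sup>2) powr - p) \<le> ennreal (2 powr p) * ennreal (f \<bar>y\<bar>)"
      by (simp add: ennreal_mult[symmetric] f_def ennreal_leI)
    also have "ennreal (f \<bar>y\<bar>) \<le> ennreal (f y) * indicator {0..} y + ennreal (f (- y)) * indicator {0..} (- y)"
      by (cases "y \<ge> 0") (auto simp: abs_if)
    finally show "ennreal ((1 + y\<^sup>2) powr - p) \<le> ennreal (2 powr p) * (ennreal (f y) * indicator {0..} y + ennreal (f (- y)) * indicator {0..} (- y))"
      by (simp add: mult_left_mono)
  qed
  also have "\<dots> = ennreal (2 powr p) * ((\<integral>\<^sup>+y. ennreal (f y) * indicator {0..} y \<partial>lborel)
      + (\<integral>\<^sup>+y. ennreal (f (- y)) * indicator {0..} (- y) \<partial>lborel))"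
    by (simp add: nn_integral_cmult nn_integral_add)
  also have "(\<integral>\<^sup>+y. ennreal (f (- y)) * indicator {0..} (- y) \<partial>lborel) = (\<integral>\<^sup>+y. ennreal (f y) * indicator {0..} y \<partial>lborel)"
    by (subst (2) nn_integral_real_affine[of _ "-1" 0]) auto
  finally show ?thesis using half
    by (subst integrable_iff_bounded) (auto simp: ennreal_mult_less_top intro: le_less_trans)
qed

text \<open>The dominating function for Stirling's formula; its exponent comes from
  \<open>v^2 / (1 + \<bar>v\<bar>) \<ge> \<bar>v\<bar> - 1\<close>.\<close>

lemma integrable_exp_minus_abs: "integrable lborel (\<lambda>v::real. exp (1 / 2 - \<bar>v\<bar> / 2))"
proof (rule Bochner_Integration.integrable_bound)
  show "integrable lborel (\<lambda>v::real. 8 * exp (1 / 2) * (1 + v\<^sup>2) powr - 1)"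
    by (intro integrable_mult_right integrable_one_plus_square_powr) simp
  have "exp (1 / 2 - \<bar>v\<bar> / 2) \<le> 8 * exp (1 / 2) * (1 + v\<^sup>2) powr - 1" for v :: real
  proof -
    have "1 + \<bar>v\<bar> / 2 + (\<bar>v\<bar> / 2)\<^sup>2 / 2 \<le> exp (\<bar>v\<bar> / 2)" by (rule exp_lower_Taylor_quadratic) simp
    moreover have "(1 + v\<^sup>2) / 8 \<le> 1 + \<bar>v\<bar> / 2 + (\<bar>v\<bar> / 2)\<^sup>2 / 2"
      by (simp add: power2_eq_square field_simps)
    ultimately have "(1 + v\<^sup>2) / 8 \<le> exp (\<bar>v\<bar> / 2)" by linarith
    then have "1 / exp (\<bar>v\<bar> / 2) \<le> 8 / (1 + v\<^sup>2)" by (simp add: field_simps add_pos_nonneg)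
    then have "exp (1 / 2) * (1 / exp (\<bar>v\<bar> / 2)) \<le> exp (1 / 2) * (8 / (1 + v\<^sup>2))" by (intro mult_left_mono) auto
    moreover have "exp (1 / 2 - \<bar>v\<bar> / 2) = exp (1 / 2) * (1 / exp (\<bar>v\<bar> / 2))"
      by (rule trans[OF exp_diff]) simp
    moreover have "(1 + v\<^sup>2) powr - 1 = 1 / (1 + v\<^sup>2)"
      by (subst powr_minus) (simp add: inverse_eq_divide add_nonneg_nonneg)
    ultimately show ?thesis by (simp add: mult.commute)
  qed
  then show "AE v in lborel. norm (exp (1 / 2 - \<bar>v\<bar> / 2)) \<le> norm (8 * exp (1 / 2) * (1 + (v::real)\<^sup>2) powr - 1)" by simp
qed simp

text \<open>Laplace's method for \<open>\<integral> t\<^sup>x e\<^sup>-\<^sup>t dt\<close> after the substitution \<open>t = x + v \<surd>x\<close>.\<close>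

theorem Gamma_Stirling:
  "((\<lambda>x::real. Gamma (x + 1) / (sqrt x * x powr x * exp (- x))) \<longlongrightarrow> sqrt (2 * pi)) at_top"
proof -
  \<comment> \<open>For \<open>t = x + v sqrt x > 0\<close> this is
    \<open>t powr x * exp (- t)\<close> divided by its maximum, the value at
    \<open>t = x\<close>.\<close>
  define k where "k x v = indicator {0<..} (x + sqrt x * v) * exp (x * (ln (1 + v / sqrt x) - v / sqrt x))"
    for x v :: real
  have km[measurable]: "k x \<in> borel_measurable borel" for x unfolding k_def by measurable
  have bound: "k x v \<le> exp (1 / 2 - \<bar>v\<bar> / 2)" if "x \<ge> 1" for x v
  proof (cases "x + sqrt x * v > 0")
    case True
    have sx: "sqrt x \<ge> 1" "sqrt x * sqrt x = x" using that by auto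
    then have "sqrt x * (sqrt x + v) > 0" using True by (simp add: algebra_simps)
    then have w: "v / sqrt x > -1" using sx by (simp add: zero_less_mult_iff pos_less_divide_eq)
    have "x * (ln (1 + v / sqrt x) - v / sqrt x) \<le> x * - ((v / sqrt x)\<^sup>2 / (2 * (1 + \<bar>v / sqrt x\<bar>)))"
      using that by (intro mult_left_mono ln_add_one_minus_self_le w) auto
    also have "\<dots> = - (v\<^sup>2 / (2 * (1 + \<bar>v\<bar> / sqrt x)))"
      using that by (simp add: power_divide)
    \<comment> \<open>Here \<open>x \<ge> 1\<close> removes \<open>x\<close> from the bound.\<close>
    also have "\<dots> \<le> - (v\<^sup>2 / (2 * (1 + \<bar>v\<bar>)))"
    proof -
      have "\<bar>v\<bar> / sqrt x \<le> \<bar>v\<bar> / 1" using sx by (intro divide_left_mono) auto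
      then have "v\<^sup>2 / (2 * (1 + \<bar>v\<bar>)) \<le> v\<^sup>2 / (2 * (1 + \<bar>v\<bar> / sqrt x))"
        using that by (intro divide_left_mono mult_pos_pos add_pos_nonneg) auto
      then show ?thesis by simp
    qed
    also have "\<dots> \<le> 1 / 2 - \<bar>v\<bar> / 2"
    proof -
      have "(\<bar>v\<bar> - 1) * (1 + \<bar>v\<bar>) \<le> v\<^sup>2" by (simp add: algebra_simps power2_eq_square)
      then have "\<bar>v\<bar> - 1 \<le> v\<^sup>2 / (1 + \<bar>v\<bar>)" by (subst pos_le_divide_eq) auto
      then show ?thesis by (simp add: field_simps)
    qed
    finally show ?thesis by (simp add: k_def indicator_def)
  qed (simp add: k_def)
  have k0: "k x v \<ge> 0" for x v by (simp add: k_def)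
  have lim: "((\<lambda>x. k x v) \<longlongrightarrow> exp (- (v\<^sup>2 / 2))) at_top" for v
  proof (rule Lim_transform_eventually)
    show "((\<lambda>x. exp (x * (ln (1 + v / sqrt x) - v / sqrt x))) \<longlongrightarrow> exp (- (v\<^sup>2 / 2))) at_top"
      by (intro tendsto_intros tendsto_scaled_ln_remainder)
    have "eventually (\<lambda>x::real. x + sqrt x * v > 0) at_top" by real_asymp
    then show "eventually (\<lambda>x. exp (x * (ln (1 + v / sqrt x) - v / sqrt x)) = k x v) at_top"
      by eventually_elim (simp add: k_def)
  qed
  have ev: "eventually (\<lambda>x. AE v in lborel. norm (k x v) \<le> exp (1 / 2 - \<bar>v\<bar> / 2)) at_top"
    using eventually_ge_at_top[of 1] by eventually_elim (simp add: k0 bound)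
  have "((\<lambda>x. \<integral>v. k x v \<partial>lborel) \<longlongrightarrow> (\<integral>v. exp (- (v\<^sup>2 / 2)) \<partial>lborel)) at_top"
    by (rule integral_dominated_convergence_at_top[OF _ _ integrable_exp_minus_abs _ ev]) (auto simp: lim)
  moreover have "(\<integral>v. exp (- (v\<^sup>2 / 2)) \<partial>lborel) = sqrt (2 * pi)"
  proof -
    have "(\<integral>v. std_normal_density v \<partial>lborel) = 1" by simp
    then show ?thesis unfolding std_normal_density_def by (simp add: field_simps)
  qed
  moreover have "eventually (\<lambda>x. (\<integral>v. k x v \<partial>lborel) = Gamma (x + 1) / (sqrt x * x powr x * exp (- x))) at_top"
    using eventually_ge_at_top[of 1]
  proof eventually_elim
    case (elim x)
    have int: "integrable lborel (k x)"
      by (rule Bochner_Integration.integrable_bound[OF integrable_exp_minus_abs]) (use bound[OF elim] k0 in auto)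
    have pos: "sqrt x * x powr x * exp (- x) > 0" using elim by simp
    have eq: "indicator {0..} (x + sqrt x * v) * (x + sqrt x * v) powr (x + 1 - 1) / exp (x + sqrt x * v)
        = x powr x * exp (- x) * k x v" for v
    proof (cases "x + sqrt x * v > 0")
      case True
      have x: "x + sqrt x * v = x * (1 + v / sqrt x)"
      proof -
        have "x * (1 + v / sqrt x) = x + x / sqrt x * v" by (simp add: distrib_left)
        then show ?thesis using elim by (simp add: real_div_sqrt)
      qed
      then have "1 + v / sqrt x > 0" using True elim by (simp add: zero_less_mult_iff)
      then have "(x + sqrt x * v) powr x = x powr x * exp (x * ln (1 + v / sqrt x))"
        unfolding x using elim by (simp add: powr_mult) (simp add: powr_def)
      moreover have "x * inverse (sqrt x) = sqrt x"
        using elim by (simp add: real_div_sqrt flip: divide_inverse)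
      ultimately show ?thesis using True elim
        by (simp add: k_def exp_add[symmetric] exp_diff[symmetric] exp_minus[symmetric] divide_inverse algebra_simps real_div_sqrt)
    next
      case False
      then show ?thesis by (cases "x + sqrt x * v = 0") (auto simp: k_def)
    qed
    have "ennreal (Gamma (x + 1)) = (\<integral>\<^sup>+t. ennreal (indicator {0..} t * t powr (x + 1 - 1) / exp t) \<partial>lborel)"
      using elim by (intro Gamma_conv_nn_integral_real) simp
    also have "\<dots> = sqrt x * (\<integral>\<^sup>+v. ennreal (indicator {0..} (x + sqrt x * v) * (x + sqrt x * v) powr (x + 1 - 1)
        / exp (x + sqrt x * v)) \<partial>lborel)"
      using elim by (subst nn_integral_real_affine[of _ "sqrt x" x]) auto
    also have "\<dots> = sqrt x * (\<integral>\<^sup>+v. ennreal (x powr x * exp (- x)) * ennreal (k x v) \<partial>lborel)"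
      unfolding eq by (simp add: ennreal_mult k0)
    also have "\<dots> = ennreal (sqrt x) * (ennreal (x powr x * exp (- x)) * ennreal (\<integral>v. k x v \<partial>lborel))"
      by (subst nn_integral_cmult) (auto simp: nn_integral_eq_integral[OF int] k0)
    also have "\<dots> = ennreal (sqrt x * x powr x * exp (- x) * (\<integral>v. k x v \<partial>lborel))"
      using elim by (simp add: ennreal_mult[symmetric] k0 mult.assoc)
    finally have "Gamma (x + 1) = sqrt x * x powr x * exp (- x) * (\<integral>v. k x v \<partial>lborel)"
      using elim by (subst (asm) ennreal_inj) (auto intro!: mult_nonneg_nonneg Bochner_Integration.integral_nonneg k0 less_imp_le[OF Gamma_real_pos])
    then show ?case using pos elim by (simp add: field_simps)
  qed
  ultimately show ?thesis by (auto dest: Lim_transform_eventually)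
qed

text \<open>Stirling's formula at \<open>a + x - 1\<close>. Replacing \<open>x\<close> by
  \<open>a + x - 1\<close> in the base of the power costs a factor tending to
  \<open>exp (a - 1)\<close>, which the shift in the exponential compensates.\<close>

corollary Gamma_Stirling_shift:
  "((\<lambda>x::real. Gamma (a + x) / (x powr (x + a - 1 / 2) * exp (- x))) \<longlongrightarrow> sqrt (2 * pi)) at_top"
proof -
  define g where "g y = sqrt y * y powr y * exp (- y)" for y :: real
  have "filterlim (\<lambda>x::real. a + x - 1) at_top at_top" by real_asymp
  from filterlim_compose[OF Gamma_Stirling this]
  have 1: "((\<lambda>x. Gamma (a + x) / g (a + x - 1)) \<longlongrightarrow> sqrt (2 * pi)) at_top"
    by (simp add: g_def)
  have ev: "eventually (\<lambda>x. a + x - 1 > 0) at_top" by real_asymp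
  have 2: "((\<lambda>x. g (a + x - 1) / (x powr (x + a - 1 / 2) * exp (- x))) \<longlongrightarrow> 1) at_top"
  proof (rule Lim_transform_eventually)
    have "((\<lambda>x. (a + x - 1 / 2) * ln (a + x - 1) - (x + a - 1 / 2) * ln x - (a - 1)) \<longlongrightarrow> 0) at_top"
      by real_asymp
    from tendsto_exp[OF this]
    show "((\<lambda>x. exp ((a + x - 1 / 2) * ln (a + x - 1) - (x + a - 1 / 2) * ln x - (a - 1))) \<longlongrightarrow> 1) at_top"
      by simp
    show "eventually (\<lambda>x. exp ((a + x - 1 / 2) * ln (a + x - 1) - (x + a - 1 / 2) * ln x - (a - 1))
      = g (a + x - 1) / (x powr (x + a - 1 / 2) * exp (- x))) at_top"
      using ev eventually_gt_at_top[of 0]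
    proof eventually_elim
      case (elim x)
      have "g y = exp ((y + 1 / 2) * ln y - y)" if "y > 0" for y
        unfolding g_def powr_half_sqrt[symmetric, OF less_imp_le[OF that]] using that
        by (simp add: powr_def exp_add[symmetric] distrib_right add.commute)
      from this[OF elim(1)] have "g (a + x - 1) = exp ((a + x - 1 / 2) * ln (a + x - 1) - (a + x - 1))"
        by simp
      moreover have "x powr (x + a - 1 / 2) * exp (- x) = exp ((x + a - 1 / 2) * ln x - x)"
        using elim by (simp add: powr_def exp_add[symmetric])
      moreover have "u * A - v * B - (a - 1) = u * A - (a + x - 1) - (v * B - x)" for u v A B :: real
        by simp
      ultimately show ?case by (simp only: exp_diff[symmetric])
    qed
  qed
  show ?thesis
  proof (rule Lim_transform_eventually)
    show "eventually (\<lambda>x. Gamma (a + x) / g (a + x - 1) * (g (a + x - 1) / (x powr (x + a - 1 / 2) * exp (- x)))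
      = Gamma (a + x) / (x powr (x + a - 1 / 2) * exp (- x))) at_top"
      using ev by eventually_elim (simp add: g_def)
  qed (use tendsto_mult[OF 1 2] in \<open>simp only: mult_1_right\<close>)
qed

corollary Gamma_Stirling_linear:
  fixes a b :: real
  assumes b: "b > 0"
  shows "((\<lambda>x. Gamma (a + b * x) / ((b * x) powr (b * x + a - 1 / 2) * exp (- (b * x)))) \<longlongrightarrow> sqrt (2 * pi)) at_top"
proof -
  have "filterlim (\<lambda>x. b * x) at_top at_top" using b by real_asymp
  from filterlim_compose[OF Gamma_Stirling_shift this, of a] show ?thesis by simp
qed

section \<open>Laguerre zeros as an equilibrium\<close>

lemma coeff_laguerre:
  "coeff (laguerre n \<alpha>) k = (if k \<le> n then (-1) ^ k * ((real n + \<alpha>) gchoose (n - k)) / fact k else 0)"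
  by (simp add: laguerre_def coeff_sum if_distrib cong: if_cong)

lemma coeff_laguerre_rec:
  assumes "k < n"
  shows "coeff (laguerre n (\<nu> - 1)) (Suc k) * (real (Suc k) * (real k + \<nu>)) = (real k - real n) * coeff (laguerre n (\<nu> - 1)) k"
proof -
  define m where "m = n - Suc k"
  have m: "n - k = Suc m" "real m = real n - real k - 1" using assms by (auto simp: m_def)
  define a where "a = real n + (\<nu> - 1)"
  have "a * (a gchoose m) = real m * (a gchoose m) + real (Suc m) * (a gchoose Suc m)"
    by (rule gbinomial_mult_1)
  then have "(a gchoose m) * (real k + \<nu>) = (real n - real k) * (a gchoose Suc m)"
    by (simp add: m(2) a_def algebra_simps)
  then have "(- 1) ^ Suc k / fact k * ((a gchoose m) * (real k + \<nu>)) = (- 1) ^ Suc k / fact k * ((real n - real k) * (a gchoose Suc m))"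
    by simp
  moreover have "coeff (laguerre n (\<nu> - 1)) (Suc k) * (real (Suc k) * (real k + \<nu>))
     = (- 1) ^ Suc k / fact k * ((a gchoose m) * (real k + \<nu>))"
    using assms by (simp add: coeff_laguerre a_def m_def del: of_nat_Suc)
  moreover have "(real k - real n) * coeff (laguerre n (\<nu> - 1)) k = (- 1) ^ Suc k / fact k * ((real n - real k) * (a gchoose Suc m))"
  proof -
    have "(u - v) * (s * g / f) = - s / f * ((v - u) * g)" for u v s g f :: real
      by (cases "f = 0") (simp_all add: field_simps)
    then show ?thesis using assms m(1) by (simp add: coeff_laguerre a_def)
  qed
  ultimately show ?thesis by simp
qed

text \<open>The coefficient recurrence is the Laguerre differential equation \<open>x p'' + (\<nu> - x) p' + n p = 0\<close>.\<close>

lemma laguerre_unique: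
  fixes p :: "real poly"
  assumes ode: "\<And>k. coeff p (Suc k) * (real (Suc k) * (real k + \<nu>)) = (real k - real n) * coeff p k"
    and deg: "degree p \<le> n"
  shows "p = smult (coeff p n * (- 1) ^ n * fact n) (laguerre n (\<nu> - 1))"
proof (rule poly_eqI)
  fix k
  show "coeff p k = coeff (smult (coeff p n * (- 1) ^ n * fact n) (laguerre n (\<nu> - 1))) k"
  proof (cases "k \<le> n")
    case True
    then show ?thesis
    \<comment> \<open>Downwards from \<open>n\<close>: for \<open>k < n\<close> the factor
      \<open>k - n\<close> is nonzero, so each coefficient is determined by the next higher one and
      the whole polynomial by its coefficient at \<open>n\<close>.\<close>
    proof (induction k rule: inc_induct)
      case base
      show ?case by (simp add: coeff_laguerre flip: power_add)
    next
      case (step k)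
      define C where "C = coeff p n * (- 1) ^ n * fact n"
      have "(real k - real n) * coeff p k = C * (coeff (laguerre n (\<nu> - 1)) (Suc k) * (real (Suc k) * (real k + \<nu>)))"
        using step.IH by (simp only: ode[of k, symmetric] C_def coeff_smult mult.assoc)
      also have "\<dots> = (real k - real n) * (C * coeff (laguerre n (\<nu> - 1)) k)"
        unfolding coeff_laguerre_rec[OF step(2)] by simp
      finally show ?case using step(2) by (simp add: C_def)
    qed
  next
    case False
    then show ?thesis using deg by (simp add: coeff_laguerre coeff_eq_0)
  qed
qed

text \<open>Stieltjes: at a point \<open>z i\<close> the equilibrium condition says that \<open>\<Prod>\<^sub>i (x - z i)\<close> satisfies the
  Laguerre differential equation, whose left-hand side has degree less than the number of the \<open>z i\<close>.\<close>

theorem proots_laguerre_equilibrium: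
  fixes z :: "'n::finite \<Rightarrow> real"
  assumes inj: "inj z"
    and eq: "\<And>i. z i = \<nu> + 2 * z i * (\<Sum>q\<in>UNIV - {i}. 1 / (z i - z q))"
  shows "proots (laguerre CARD('n) (\<nu> - 1)) = image_mset z (mset_set UNIV)"
proof -
  define n where "n = CARD('n)"
  define p where "p = (\<Prod>i\<in>UNIV. [: - z i, 1:])"
  define R where "R = [:0, 1:] * pderiv (pderiv p) + [:\<nu>, - 1:] * pderiv p + smult (real n) p"
  have degp: "degree p = n" unfolding p_def n_def
    by (subst degree_prod_eq_sum_degree) auto
  have "lead_coeff p = 1" unfolding p_def lead_coeff_prod by simp
  then have lc: "coeff p n = 1" using degp by simp
  have cR: "coeff R k = coeff p (Suc k) * (real (Suc k) * (real k + \<nu>)) - (real k - real n) * coeff p k" for k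
    by (cases k) (simp_all add: R_def coeff_pderiv coeff_pCons algebra_simps)
  \<comment> \<open>In degree \<open>n\<close> both terms vanish: the factor \<open>k - n\<close> is
    zero and \<open>p\<close> has no coefficient beyond \<open>n\<close>. This cancellation makes
    the degree drop.\<close>
  have "coeff R k = 0" if "k \<ge> n" for k
    using that degp by (cases "k = n") (simp_all add: cR coeff_eq_0)
  moreover have "n > 0" by (simp add: n_def)
  ultimately have degR: "degree R < n"
    by (meson degree_lessI linorder_not_le not_less)
  have root: "poly R (z i) = 0" for i
  proof -
    \<comment> \<open>With the root at \<open>z i\<close> split off, \<open>p'\<close> takes the
      value of \<open>q\<close> at \<open>z i\<close> and \<open>p''\<close> twice that of
      \<open>q'\<close>, whose logarithmic derivative is the equilibrium sum.\<close>
    define q where "q = (\<Prod>j\<in>UNIV - {i}. [: - z j, 1:])"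
    have p: "p = [: - z i, 1:] * q"
      unfolding p_def q_def by (rule prod.remove) auto
    have p1: "pderiv p = q + [: - z i, 1:] * pderiv q"
      unfolding p pderiv_mult by (simp add: pderiv_pCons)
    have p2: "pderiv (pderiv p) = pderiv q + pderiv q + [: - z i, 1:] * pderiv (pderiv q)"
      unfolding p1 by (simp only: pderiv_add pderiv_mult) (simp add: pderiv_pCons)
    have "poly (pderiv q) (z i) = (\<Sum>a\<in>UNIV - {i}. poly q (z i) * (1 / (z i - z a)))"
      unfolding q_def pderiv_prod poly_sum
    proof (rule sum.cong[OF refl])
      fix a assume a: "a \<in> UNIV - {i}"
      then have "z i - z a \<noteq> 0" using inj by (auto simp: inj_def)
      moreover have "poly (\<Prod>j\<in>UNIV - {i}. [:- z j, 1:]) (z i) = (z i - z a) * poly (\<Prod>j\<in>UNIV - {i} - {a}. [:- z j, 1:]) (z i)"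
        by (subst prod.remove[OF _ a]) (auto simp: left_diff_distrib)
      ultimately show "poly ((\<Prod>j\<in>UNIV - {i} - {a}. [:- z j, 1:]) * pderiv [:- z a, 1:]) (z i)
        = poly (\<Prod>j\<in>UNIV - {i}. [:- z j, 1:]) (z i) * (1 / (z i - z a))"
        by (simp add: pderiv_pCons)
    qed
    then have q': "poly (pderiv q) (z i) = poly q (z i) * (\<Sum>a\<in>UNIV - {i}. 1 / (z i - z a))"
      by (simp add: sum_distrib_left)
    have "poly R (z i) = poly q (z i) * (\<nu> + 2 * z i * (\<Sum>a\<in>UNIV - {i}. 1 / (z i - z a)) - z i)"
    proof -
      have "poly (pderiv (pderiv p)) (z i) = 2 * poly (pderiv q) (z i)" unfolding p2 by simp
      moreover have "poly (pderiv p) (z i) = poly q (z i)" unfolding p1 by simp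
      moreover have "poly p (z i) = 0" unfolding p by simp
      ultimately show ?thesis unfolding R_def by (simp add: q' algebra_simps)
    qed
    then show ?thesis using eq[of i] by simp
  qed
  have "R = 0"
  proof (rule poly_eqI_degree[where A = "range z"])
    show "card (range z) > degree R" "card (range z) > degree 0"
      using degR card_image[OF inj] by (auto simp: n_def)
  qed (use root in auto)
  then have "p = smult ((- 1) ^ n * fact n) (laguerre n (\<nu> - 1))"
    using laguerre_unique[of p \<nu> n] cR degp lc by simp
  then have "proots p = proots (laguerre n (\<nu> - 1))" by simp
  moreover have "proots p = image_mset z (mset_set UNIV)"
  proof -
    have "(\<Sum>i\<in>A. {#z i#}) = image_mset z (mset_set A)" if "finite A" for A
      using that by induction auto
    then show ?thesis unfolding p_def by (subst proots_prod) auto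
  qed
  ultimately show ?thesis by (simp add: n_def)
qed

text \<open>\<open>r_vec\<close> addresses the list of zeros by the number of smaller indices; that
  number is the position of \<open>i\<close>, counted from \<open>0\<close>.\<close>

lemma sorted_list_of_set_nth_card:
  fixes i :: "'n::{finite,linorder}"
  shows "sorted_list_of_set UNIV ! card {j. j < i} = i" "card {j. j < i} < CARD('n)"
proof -
  define xs where "xs = sorted_list_of_set (UNIV :: 'n set)"
  have xs: "set xs = UNIV" "sorted_wrt (<) xs" "distinct xs" "length xs = CARD('n)" by (simp_all add: xs_def)
  then obtain m where m: "m < length xs" "xs ! m = i" by (metis in_set_conv_nth iso_tuple_UNIV_I)
  have "{j. j < i} = (!) xs ` {..<m}"
  proof (intro set_eqI iffI)
    fix j assume "j \<in> {j. j < i}"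
    moreover obtain k where k: "k < length xs" "xs ! k = j" using xs(1) by (metis in_set_conv_nth iso_tuple_UNIV_I)
    ultimately have "k < m" using xs(2) m
      by (metis mem_Collect_eq not_less_iff_gr_or_eq order.asym sorted_wrt_nth_less)
    then show "j \<in> (!) xs ` {..<m}" using k by auto
  next
    fix j assume "j \<in> (!) xs ` {..<m}"
    then show "j \<in> {j. j < i}" using sorted_wrt_nth_less[OF xs(2)] m by auto
  qed
  moreover have "inj_on ((!) xs) {..<m}" using xs(3) m by (auto simp: inj_on_def nth_eq_iff_index_eq)
  ultimately have "card {j. j < i} = m" by (simp add: card_image)
  then show "sorted_list_of_set UNIV ! card {j. j < i} = i" "card {j. j < i} < CARD('n)"
    using m xs(4) by (auto simp: xs_def)
qed

text \<open>Any strictly decreasing equilibrium has to be the list of zeros, because its product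
  polynomial is a multiple of the Laguerre polynomial. That all zeros are real and simple is a
  by-product.\<close>

lemma laguerre_zeros_equilibrium:
  fixes z :: "'n::{finite,linorder} \<Rightarrow> real"
  assumes dec: "\<And>i j. i < j \<Longrightarrow> z j < z i"
    and eq: "\<And>i. z i = \<nu> + 2 * z i * (\<Sum>q\<in>UNIV - {i}. 1 / (z i - z q))"
  shows "laguerre_zeros CARD('n) (\<nu> - 1) ! card {j. j < i} = z i"
proof -
  have inj: "inj z" by (metis dec injI linorder_neqE order_less_irrefl)
  define l where "l = map z (sorted_list_of_set UNIV)"
  have "sorted (rev l)"
    unfolding l_def sorted_wrt_rev sorted_wrt_map
    by (rule sorted_wrt_mono_rel[of _ "(<)"]) (auto intro: less_imp_le dec)
  moreover have "mset (rev l) = image_mset z (mset_set UNIV)"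
    by (simp add: l_def mset_set_set[of "sorted_list_of_set UNIV", symmetric])
  ultimately have "sorted_list_of_multiset (image_mset z (mset_set UNIV)) = rev l"
    by (metis sorted_list_of_multiset_mset sorted_sort_id)
  then have "laguerre_zeros CARD('n) (\<nu> - 1) = l"
    unfolding laguerre_zeros_def proots_laguerre_equilibrium[OF inj eq] by simp
  then show ?thesis using sorted_list_of_set_nth_card[of i] by (simp add: l_def)
qed

section \<open>The product of powers of the roots and its critical point on the sphere\<close>

text \<open>One positive root of \<open>B\<^sub>N\<close> for every pair of indices, long roots off the diagonal.\<close>

definition root_B :: "'n \<times> 'n \<Rightarrow> real ^ 'n::{finite,linorder}" where
  "root_B k = (let (i, j) = k in
     if i < j then axis i 1 - axis j 1 else if j < i then axis i 1 + axis j 1 else axis i 1)"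

definition mult_B :: "real \<Rightarrow> 'n \<times> 'n \<Rightarrow> real" where
  "mult_B \<nu> k = (if fst k = snd k then 2 * \<nu> else 2)"

text \<open>This is \<open>exp G\<close>, and its \<open>\<beta>\<close>-th power is the product in
  the density. Unlike the logarithm it is continuous up to the walls of the chamber, where it
  vanishes, so it can be maximised over a compact set.\<close>

definition energy :: "real \<Rightarrow> real ^ 'n::{finite,linorder} \<Rightarrow> real" where
  "energy \<nu> y = (\<Prod>k\<in>UNIV. (y \<bullet> root_B k) powr mult_B \<nu> k)"

lemma inner_root_B:
  "y \<bullet> root_B (i, j) = (if i < j then y $ i - y $ j else if j < i then y $ i + y $ j else y $ i)"
  by (simp add: root_B_def inner_diff_right inner_add_right inner_axis)

lemma mult_B_pos: "\<nu> > 0 \<Longrightarrow> mult_B \<nu> k > 0"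
  by (simp add: mult_B_def)

lemma weyl_chamber_B_iff: "y \<in> weyl_chamber_B \<longleftrightarrow> (\<forall>k. 0 \<le> y \<bullet> root_B k)"
proof
  assume "y \<in> weyl_chamber_B"
  then show "\<forall>k. 0 \<le> y \<bullet> root_B k"
    by (auto simp: weyl_chamber_B_def inner_root_B)
next
  assume *: "\<forall>k. 0 \<le> y \<bullet> root_B k"
  have "0 \<le> y $ i" for i using *[rule_format, of "(i, i)"] by (simp add: inner_root_B)
  moreover have "y $ j \<le> y $ i" if "i \<le> j" for i j
    using *[rule_format, of "(i, j)"] that by (auto simp: inner_root_B split: if_splits)
  ultimately show "y \<in> weyl_chamber_B" by (simp add: weyl_chamber_B_def)
qed

lemma prod_pairs_split:
  fixes F :: "'n::{finite,linorder} \<times> 'n \<Rightarrow> 'b::comm_monoid_mult"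
  shows "(\<Prod>k\<in>UNIV. F k) = (\<Prod>(i, j) | i < j. F (i, j) * F (j, i)) * (\<Prod>i\<in>UNIV. F (i, i))"
proof -
  have U: "(UNIV :: ('n \<times> 'n) set) = {(i, j). i < j} \<union> ({(i, j). j < i} \<union> (\<lambda>i. (i, i)) ` UNIV)"
    by auto
  have "(\<Prod>k\<in>UNIV. F k) = prod F {(i, j). i < j} * (prod F {(i, j). j < i} * prod F ((\<lambda>i. (i, i)) ` UNIV))"
    unfolding U by (subst prod.union_disjoint; (subst prod.union_disjoint)?) auto
  moreover have "prod F ((\<lambda>i. (i, i)) ` UNIV) = (\<Prod>i\<in>UNIV. F (i, i))"
    by (subst prod.reindex) (auto simp: inj_on_def)
  moreover have "prod F {(i, j). j < i} = (\<Prod>(i, j) | i < j. F (j, i))"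
    by (rule prod.reindex_bij_witness[of _ prod.swap prod.swap]) auto
  ultimately show ?thesis
    by (simp add: prod.distrib[symmetric] case_prod_beta mult.assoc[symmetric])
qed

text \<open>Coordinate \<open>i\<close> occurs in its short root and, for every
  \<open>q \<noteq> i\<close>, in the two long roots of the pair. The order of \<open>i\<close> and
  \<open>q\<close> decides which of the two is the difference and with which sign \<open>i\<close>
  enters it.\<close>

lemma sum_root_B_component:
  fixes F :: "'n::{finite,linorder} \<times> 'n \<Rightarrow> real"
  shows "(\<Sum>k\<in>UNIV. F k * root_B k $ i) =
    F (i, i) + (\<Sum>q\<in>UNIV - {i}. if i < q then F (i, q) + F (q, i) else F (i, q) - F (q, i))"
proof -
  define c where "c p q j = (if j = p then 1 else 0) + (if j = q then (if p < q then - 1 else if q < p then 1 else 0) else 0 :: real)"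
    for p q j :: 'n
  have c: "root_B (p, q) $ i = c p q i" for p q
    by (auto simp: root_B_def c_def axis_def)
  have "(\<Sum>k\<in>UNIV. F k * root_B k $ i) = (\<Sum>p\<in>UNIV. \<Sum>q\<in>UNIV. F (p, q) * c p q i)"
    unfolding UNIV_Times_UNIV[symmetric] sum.cartesian_product by (simp add: case_prod_beta c[symmetric])
  also have "\<dots> = (\<Sum>p\<in>UNIV. \<Sum>q\<in>UNIV. (if p = i then F (i, q) else 0) +
      (if q = i then F (p, i) * (if p < i then - 1 else if i < p then 1 else 0) else 0))"
    by (intro sum.cong refl) (auto simp: c_def)
  also have "\<dots> = (\<Sum>p\<in>UNIV. \<Sum>q\<in>UNIV. (if p = i then F (i, q) else 0)) +
      (\<Sum>p\<in>UNIV. \<Sum>q\<in>UNIV. (if q = i then F (p, i) * (if p < i then - 1 else if i < p then 1 else 0) else 0))"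
    by (simp add: sum.distrib)
  also have "(\<Sum>p\<in>UNIV. \<Sum>q\<in>UNIV. (if p = i then F (i, q) else 0)) = (\<Sum>q\<in>UNIV. F (i, q))"
    by (subst sum.swap) simp
  also have "(\<Sum>p\<in>UNIV. \<Sum>q\<in>UNIV. (if q = i then F (p, i) * (if p < i then - 1 else if i < p then 1 else 0) else 0))
     = (\<Sum>q\<in>UNIV. F (q, i) * (if q < i then - 1 else if i < q then 1 else 0))"
    by simp
  also have "(\<Sum>q\<in>UNIV. F (i, q)) + (\<Sum>q\<in>UNIV. F (q, i) * (if q < i then - 1 else if i < q then 1 else 0))
    = (\<Sum>q\<in>UNIV. F (i, q) + F (q, i) * (if q < i then - 1 else if i < q then 1 else 0))"
    by (simp add: sum.distrib)
  also have "\<dots> = F (i, i) + (\<Sum>q\<in>UNIV - {i}. F (i, q) + F (q, i) * (if q < i then - 1 else if i < q then 1 else 0))"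
    by (subst sum.remove[of _ i]) auto
  also have "(\<Sum>q\<in>UNIV - {i}. F (i, q) + F (q, i) * (if q < i then - 1 else if i < q then 1 else 0))
     = (\<Sum>q\<in>UNIV - {i}. if i < q then F (i, q) + F (q, i) else F (i, q) - F (q, i))"
    by (intro sum.cong refl) auto
  finally show ?thesis .
qed

text \<open>The degree of homogeneity of \<open>energy\<close>: \<open>N (N - 1)\<close> long roots
  of weight \<open>2\<close> and \<open>N\<close> short ones of weight
  \<open>2 \<nu>\<close>.\<close>

lemma sum_mult_B: "(\<Sum>k\<in>UNIV. mult_B \<nu> (k :: 'n::{finite,linorder} \<times> 'n)) = limit_const CARD('n) \<nu>"
proof -
  have "(\<Sum>k\<in>UNIV. mult_B \<nu> (k :: 'n \<times> 'n)) = (\<Sum>p\<in>(UNIV::'n set). \<Sum>q\<in>(UNIV::'n set). 2 + (if q = p then 2 * \<nu> - 2 else 0))"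
    unfolding UNIV_Times_UNIV[symmetric] sum.cartesian_product
    by (intro sum.cong) (auto simp: mult_B_def)
  also have "\<dots> = limit_const CARD('n) \<nu>"
    by (simp add: sum.distrib limit_const_def algebra_simps)
  finally show ?thesis .
qed

lemma limit_const_pos: "\<nu> > 0 \<Longrightarrow> n > 0 \<Longrightarrow> limit_const n \<nu> > 0"
  by (simp add: limit_const_def)

lemma energy_nonneg: "energy \<nu> y \<ge> 0"
  by (simp add: energy_def prod_nonneg)

lemma energy_pos: "(\<And>k. y \<bullet> root_B k > 0) \<Longrightarrow> energy \<nu> y > 0"
  unfolding energy_def by (intro prod_pos ballI) (simp add: less_imp_neq[THEN not_sym])

lemma energy_pos_iff:
  assumes "y \<in> weyl_chamber_B"
  shows "energy \<nu> y > 0 \<longleftrightarrow> (\<forall>k. y \<bullet> root_B k > 0)"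
proof
  assume pos: "energy \<nu> y > 0"
  show "\<forall>k. y \<bullet> root_B k > 0"
  proof
    fix k
    have "energy \<nu> y = 0" if "y \<bullet> root_B k = 0"
      unfolding energy_def by (rule prod_zero) (use that in \<open>auto intro!: bexI[of _ k] simp del: split_paired_Ex\<close>)
    moreover have "y \<bullet> root_B k \<ge> 0" using assms unfolding weyl_chamber_B_iff by (rule spec)
    ultimately show "y \<bullet> root_B k > 0" using pos by force
  qed
qed (blast intro: energy_pos)

lemma energy_scale:
  fixes y :: "real ^ 'n::{finite,linorder}"
  assumes "t > 0"
  shows "energy \<nu> (t *\<^sub>R y) = t powr limit_const CARD('n) \<nu> * energy \<nu> y"
proof -
  have "energy \<nu> (t *\<^sub>R y) = (\<Prod>k\<in>UNIV. t powr mult_B \<nu> (k :: 'n \<times> 'n)) * energy \<nu> y"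
    unfolding energy_def prod.distrib[symmetric] using assms by (simp add: powr_mult)
  also have "(\<Prod>k\<in>UNIV. t powr mult_B \<nu> (k :: 'n \<times> 'n)) = t powr limit_const CARD('n) \<nu>"
    unfolding sum_mult_B[symmetric] using assms by (subst powr_sum) auto
  finally show ?thesis .
qed

lemma ln_energy:
  assumes "\<And>k. y \<bullet> root_B k > 0"
  shows "ln (energy \<nu> y) = (\<Sum>k\<in>UNIV. mult_B \<nu> k * ln (y \<bullet> root_B k))"
  unfolding energy_def using assms
  by (subst ln_prod) (auto simp: ln_powr less_imp_neq[THEN not_sym])

lemma continuous_on_energy: "\<nu> > 0 \<Longrightarrow> continuous_on weyl_chamber_B (energy \<nu>)"
  unfolding energy_def
  by (intro continuous_on_prod continuous_on_powr' continuous_intros)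
     (auto simp: weyl_chamber_B_iff mult_B_pos)

lemma closed_weyl_chamber_B: "closed (weyl_chamber_B :: (real, 'n::{finite,linorder}) vec set)"
proof -
  have eq: "(weyl_chamber_B :: (real, 'n) vec set) = (\<Inter>k. {y. 0 \<le> y \<bullet> root_B k})"
    by (auto simp: weyl_chamber_B_iff)
  show ?thesis unfolding eq by (intro closed_INT ballI closed_Collect_le continuous_intros)
qed

text \<open>A maximiser of \<open>energy\<close> on the unit sphere, scaled to the radius at which the Lagrange multiplier is \<open>1\<close>.\<close>

lemma exists_equilibrium:
  assumes \<nu>: "\<nu> > 0"
  obtains r :: "real ^ 'n::{finite,linorder}"
  where "\<And>k. r \<bullet> root_B k > 0"
    and "\<And>h. (\<Sum>k\<in>UNIV. mult_B \<nu> k * (h \<bullet> root_B k) / (r \<bullet> root_B k)) = h \<bullet> r"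
proof -
  define c where "c = limit_const CARD('n) \<nu>"
  have c: "c > 0" by (simp add: c_def limit_const_pos \<nu>)
  define S where "S = sphere 0 1 \<inter> (weyl_chamber_B :: (real, 'n) vec set)"
  have "compact S" by (simp add: S_def closed_weyl_chamber_B compact_Int_closed)
  \<comment> \<open>A point inside the chamber with coordinates \<open>N, ..., 1\<close>: it shows
    that the maximum of \<open>energy\<close> is positive, so the maximiser avoids the
    walls.\<close>
  define x :: "(real, 'n) vec" where "x = (\<chi> i. real (card {j. i \<le> j}))"
  have xk: "x \<bullet> root_B k > 0" for k
  proof -
    have "card {l. j \<le> l} < card {l. i \<le> l}" if "i < j" for i j :: 'n
      using that by (intro psubset_card_mono) (auto simp: psubset_eq set_eq_iff intro!: exI[of _ i])
    moreover have "card {l. i \<le> l} > 0" for i :: 'n by (auto simp: card_gt_0_iff)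
    ultimately show ?thesis by (cases k) (auto simp: inner_root_B x_def add_pos_pos)
  qed
  then have x0: "x \<noteq> 0" by (metis inner_zero_left less_irrefl)
  have unit: "(1 / norm z) *\<^sub>R z \<in> S" if "z \<noteq> 0" "\<And>k. z \<bullet> root_B k > 0" for z
    using that by (auto simp: S_def weyl_chamber_B_iff less_imp_le)
  have "S \<noteq> {}" using unit[OF x0 xk] by auto
  from continuous_attains_sup[OF \<open>compact S\<close> this continuous_on_subset[OF continuous_on_energy[OF \<nu>]]]
  obtain y where y: "y \<in> S" "\<And>z. z \<in> S \<Longrightarrow> energy \<nu> z \<le> energy \<nu> y" by (auto simp: S_def)
  have "energy \<nu> ((1 / norm x) *\<^sub>R x) > 0"
    using xk x0 by (intro energy_pos) simp
  then have "energy \<nu> y > 0" using y(2)[OF unit[OF x0 xk]] by simp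
  then have yk: "y \<bullet> root_B k > 0" for k using y(1) energy_pos_iff[of y \<nu>] unfolding S_def by blast
  define r where "r = sqrt c *\<^sub>R y"
  have rk: "r \<bullet> root_B k > 0" for k using yk c by (simp add: r_def)
  have rr: "r \<bullet> r = c" using y(1) c by (simp add: r_def S_def dot_square_norm)
  \<comment> \<open>Subtracting \<open>c / 2 * ln (z \<bullet> z)\<close> makes the function
    invariant under scaling. The maximum on the sphere becomes an unconstrained one, and ordinary
    derivatives along lines yield the critical equation.\<close>
  define L where "L z = (\<Sum>k\<in>UNIV. mult_B \<nu> k * ln (z \<bullet> root_B k)) - c / 2 * ln (z \<bullet> z)" for z :: "(real, 'n) vec"
  have max: "L z \<le> L r" if zk: "\<And>k. z \<bullet> root_B k > 0" for z
  proof -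
    have L: "L (t *\<^sub>R w) = ln (energy \<nu> w) + c * ln t - c / 2 * ln (t * t * (w \<bullet> w))"
      if "t > 0" "\<And>k. w \<bullet> root_B k > 0" for t w
    proof -
      have "ln (energy \<nu> (t *\<^sub>R w)) = c * ln t + ln (energy \<nu> w)"
        using that energy_pos[of w \<nu>] by (simp add: energy_scale ln_mult c_def ln_powr)
      moreover have "L (t *\<^sub>R w) = ln (energy \<nu> (t *\<^sub>R w)) - c / 2 * ln ((t *\<^sub>R w) \<bullet> (t *\<^sub>R w))"
        unfolding L_def by (subst ln_energy) (use that in simp_all)
      moreover have "(t *\<^sub>R w) \<bullet> (t *\<^sub>R w) = t * t * (w \<bullet> w)" by simp
      ultimately show ?thesis by (simp only:)
    qed
    have z0: "z \<noteq> 0" using zk by (metis inner_zero_left less_irrefl)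
    define u where "u = (1 / norm z) *\<^sub>R z"
    have u: "u \<in> S" "\<And>k. u \<bullet> root_B k > 0" "z = norm z *\<^sub>R u" "u \<bullet> u = 1"
      using unit[OF z0 zk] zk z0 by (auto simp: u_def dot_square_norm power2_eq_square)
    have "L z = ln (energy \<nu> u)"
      using L[of "norm z" u] u z0 by (simp add: ln_mult)
    moreover have "L r = ln (energy \<nu> y)"
      using L[of "sqrt c" y] yk c y(1) by (simp add: r_def S_def dot_square_norm ln_sqrt)
    moreover have "energy \<nu> u \<le> energy \<nu> y" using y(2) u(1) .
    ultimately show ?thesis using energy_pos[of u \<nu>] energy_pos[of y \<nu>] u(2) yk by simp
  qed
  have crit: "(\<Sum>k\<in>UNIV. mult_B \<nu> k * (h \<bullet> root_B k) / (r \<bullet> root_B k)) = h \<bullet> r" for h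
  proof -
    define f where "f t = L (r + t *\<^sub>R h)" for t
    have cont: "eventually (\<lambda>t. (r + t *\<^sub>R h) \<bullet> root_B k > 0) (nhds 0)" for k
    proof -
      have "((\<lambda>t. (r + t *\<^sub>R h) \<bullet> root_B k) \<longlongrightarrow> (r + 0 *\<^sub>R h) \<bullet> root_B k) (nhds 0)"
        by (intro tendsto_intros filterlim_ident)
      then show ?thesis by (rule order_tendstoD) (simp add: rk)
    qed
    have "eventually (\<lambda>t. \<forall>k. (r + t *\<^sub>R h) \<bullet> root_B k > 0) (nhds 0)"
      using cont by (intro eventually_all_finite)
    then obtain d where d: "d > 0" "\<And>t k. \<bar>t\<bar> < d \<Longrightarrow> (r + t *\<^sub>R h) \<bullet> root_B k > 0"
      unfolding eventually_nhds_metric by (auto simp: dist_real_def)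
    have "(f has_real_derivative ((\<Sum>k\<in>UNIV. mult_B \<nu> k * ((h \<bullet> root_B k) / (r \<bullet> root_B k))) - c / 2 * (2 * (h \<bullet> r) / (r \<bullet> r)))) (at 0)"
      unfolding f_def L_def using rk rr c
      by (auto intro!: derivative_eq_intros sum.cong simp: inner_add_left inner_add_right inner_commute algebra_simps)
    then have "(\<Sum>k\<in>UNIV. mult_B \<nu> k * ((h \<bullet> root_B k) / (r \<bullet> root_B k))) - c / 2 * (2 * (h \<bullet> r) / (r \<bullet> r)) = 0"
      by (rule DERIV_local_max[OF _ d(1)]) (auto simp: f_def intro!: max d(2))
    then show ?thesis using c by (simp add: rr)
  qed
  show thesis by (rule that[OF rk crit])
qed

text \<open>The equilibrium from compactness is identified with \<open>r_vec\<close>. In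
  \<open>z i = (r $ i)^2 / 2\<close> the two long roots of a pair contribute \<open>2 / (r $ i - r $
  q) + 2 / (r $ i + r $ q) = 2 * r $ i / (z i - z q)\<close>, so the critical equation in direction
  \<open>i\<close> is the equilibrium condition for \<open>z\<close>, and this determines the
  Laguerre zeros.\<close>

lemma
  assumes \<nu>: "\<nu> > 0"
  shows r_vec_root_pos: "(r_vec \<nu> :: real ^ 'n::{finite,linorder}) \<bullet> root_B k > 0"
    and r_vec_critical: "(\<Sum>k\<in>UNIV. mult_B \<nu> k * (h \<bullet> root_B k) / (r_vec \<nu> \<bullet> root_B k)) = h \<bullet> (r_vec \<nu> :: real ^ 'n::{finite,linorder})"
proof -
  obtain r :: "real ^ 'n::{finite,linorder}" where pos: "\<And>k. r \<bullet> root_B k > 0"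
    and crit: "\<And>h. (\<Sum>k\<in>UNIV. mult_B \<nu> k * (h \<bullet> root_B k) / (r \<bullet> root_B k)) = h \<bullet> r"
    by (rule exists_equilibrium[OF \<nu>]) (rule that; assumption)
  have ri: "r $ i > 0" for i using pos[of "(i, i)"] by (simp add: inner_root_B)
  have dec: "r $ j < r $ i" if "i < j" for i j using pos[of "(i, j)"] that by (simp add: inner_root_B)
  define z where "z i = (r $ i)\<^sup>2 / 2" for i
  have zdec: "z j < z i" if "i < j" for i j
    using dec[OF that] ri[of j] by (auto simp: z_def intro!: power_strict_mono divide_strict_right_mono)
  have eq: "z i = \<nu> + 2 * z i * (\<Sum>q\<in>UNIV - {i}. 1 / (z i - z q))" for i
  proof -
    define F where "F k = mult_B \<nu> k / (r \<bullet> root_B k)" for k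
    have "r $ i = (\<Sum>k\<in>UNIV. F k * root_B k $ i)"
      using crit[of "axis i 1"] by (simp add: F_def inner_axis')
    also have "\<dots> = F (i, i) + (\<Sum>q\<in>UNIV - {i}. if i < q then F (i, q) + F (q, i) else F (i, q) - F (q, i))"
      by (rule sum_root_B_component)
    also have "F (i, i) = 2 * \<nu> / r $ i" by (simp add: F_def mult_B_def inner_root_B)
    also have "(\<Sum>q\<in>UNIV - {i}. if i < q then F (i, q) + F (q, i) else F (i, q) - F (q, i))
       = (\<Sum>q\<in>UNIV - {i}. 2 * r $ i * (1 / (z i - z q)))"
    proof (rule sum.cong[OF refl])
      fix q assume q: "q \<in> UNIV - {i}"
      have ne: "r $ i - r $ q \<noteq> 0" "r $ i + r $ q \<noteq> 0"
        using dec[of i q] dec[of q i] q ri[of i] ri[of q] by (auto simp: neq_iff)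
      have "z i - z q = (r $ i - r $ q) * (r $ i + r $ q) / 2"
        by (simp add: z_def power2_eq_square field_simps)
      moreover have "2 / (r $ i - r $ q) + 2 / (r $ i + r $ q) = 2 * r $ i * (1 / ((r $ i - r $ q) * (r $ i + r $ q) / 2))"
        using ne by (simp add: divide_simps)
      moreover have "(if i < q then F (i, q) + F (q, i) else F (i, q) - F (q, i)) = 2 / (r $ i - r $ q) + 2 / (r $ i + r $ q)"
      proof (cases "i < q")
        case True
        then show ?thesis by (auto simp: F_def mult_B_def inner_root_B add.commute)
      next
        case False
        with q have "q < i" by auto
        moreover have "2 / (r $ q - r $ i) = - (2 / (r $ i - r $ q))"
          by (metis minus_diff_eq minus_divide_right)
        ultimately show ?thesis by (auto simp: F_def mult_B_def inner_root_B)
      qed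
      ultimately show "(if i < q then F (i, q) + F (q, i) else F (i, q) - F (q, i)) = 2 * r $ i * (1 / (z i - z q))"
        by (simp only:)
    qed
    finally have "r $ i = 2 * \<nu> / r $ i + 2 * r $ i * (\<Sum>q\<in>UNIV - {i}. 1 / (z i - z q))"
      by (simp add: sum_distrib_left)
    then have "r $ i * r $ i = r $ i * (2 * \<nu> / r $ i + 2 * r $ i * (\<Sum>q\<in>UNIV - {i}. 1 / (z i - z q)))"
      by simp
    also have "\<dots> = 2 * (\<nu> + 2 * z i * (\<Sum>q\<in>UNIV - {i}. 1 / (z i - z q)))"
      using ri[of i] by (simp add: z_def power2_eq_square algebra_simps)
    finally show ?thesis by (simp add: z_def power2_eq_square)
  qed
  have "r_vec \<nu> = r"
  proof (rule vec_eq_iff[THEN iffD2], rule allI)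
    fix i
    show "r_vec \<nu> $ i = r $ i"
    proof -
      have "2 * (laguerre_zeros CARD('n) (\<nu> - 1) ! card {j. j < i}) = (r $ i)\<^sup>2"
        using laguerre_zeros_equilibrium[OF zdec eq, of i] by (simp add: z_def)
      then show ?thesis using ri[of i] by (simp add: r_vec_def)
    qed
  qed
  then show "(r_vec \<nu> :: real ^ 'n::{finite,linorder}) \<bullet> root_B k > 0"
    and "(\<Sum>k\<in>UNIV. mult_B \<nu> k * (h \<bullet> root_B k) / (r_vec \<nu> \<bullet> root_B k)) = h \<bullet> (r_vec \<nu> :: real ^ 'n::{finite,linorder})"
    using pos crit by simp_all
qed

section \<open>Norm of \<open>r\<close>, the inverse covariance matrix and the behaviour of the
  energy near \<open>r\<close>\<close>

lemma r_vec_root_nonzero: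
  assumes "\<nu> > 0" shows "r_vec \<nu> \<bullet> root_B k \<noteq> 0"
  using r_vec_root_pos[OF assms, of k] by simp

text \<open>Euler's identity: in the critical equation at \<open>h = r\<close> every quotient is
  \<open>1\<close>.\<close>

lemma inner_r_vec:
  assumes \<nu>: "\<nu> > 0"
  shows "(r_vec \<nu> :: real ^ 'n::{finite,linorder}) \<bullet> r_vec \<nu> = limit_const CARD('n) \<nu>"
proof -
  have "(r_vec \<nu> :: (real, 'n) vec) \<bullet> r_vec \<nu> = (\<Sum>k\<in>UNIV. mult_B \<nu> (k :: 'n \<times> 'n))"
    unfolding r_vec_critical[OF \<nu>, symmetric]
    by (intro sum.cong refl) (simp add: r_vec_root_nonzero[OF \<nu>])
  then show ?thesis by (simp add: sum_mult_B)
qed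

lemma r_vec_nonzero:
  assumes "\<nu> > 0" shows "r_vec \<nu> \<noteq> (0 :: real ^ 'n::{finite,linorder})"
  using inner_r_vec[OF assms, where ?'n = 'n] limit_const_pos[OF assms, of "CARD('n)"] by auto

text \<open>The matrix is the identity plus weighted rank-one forms of the roots, the latter being
  minus the Hessian of \<open>G\<close> at \<open>r\<close>. Symmetry, positivity and the
  eigenvector \<open>r\<close> are read off from this form rather than from the entries.\<close>

lemma inner_Sigma_inv:
  fixes u v :: "real ^ 'n::{finite,linorder}"
  assumes \<nu>: "\<nu> > 0"
  shows "v \<bullet> (Sigma_inv \<nu> *v u) = v \<bullet> u +
    (\<Sum>k\<in>UNIV. mult_B \<nu> k * (u \<bullet> root_B k) * (v \<bullet> root_B k) / (r_vec \<nu> \<bullet> root_B k)\<^sup>2)"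
proof -
  define r where "r = (r_vec \<nu> :: (real, 'n) vec)"
  define F where "F k = mult_B \<nu> k * (u \<bullet> root_B k) / (r \<bullet> root_B k)\<^sup>2" for k
  have comp: "(Sigma_inv \<nu> *v u) $ i = u $ i + (\<Sum>k\<in>UNIV. F k * root_B k $ i)" for i
  proof -
    define m where "m l = 1 / (r $ i - r $ l)\<^sup>2" for l
    define p where "p l = 1 / (r $ i + r $ l)\<^sup>2" for l
    have "(Sigma_inv \<nu> *v u) $ i = Sigma_inv \<nu> $ i $ i * u $ i + (\<Sum>l\<in>UNIV - {i}. Sigma_inv \<nu> $ i $ l * u $ l)"
      unfolding matrix_vector_mult_def by (simp add: sum.remove[of _ i])
    also have "Sigma_inv \<nu> $ i $ i = 1 + 2 * \<nu> / (r $ i)\<^sup>2 + 2 * (\<Sum>l\<in>UNIV - {i}. m l) + 2 * (\<Sum>l\<in>UNIV - {i}. p l)"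
      by (simp add: Sigma_inv_def Let_def r_def m_def p_def)
    also have "(\<Sum>l\<in>UNIV - {i}. Sigma_inv \<nu> $ i $ l * u $ l) = (\<Sum>l\<in>UNIV - {i}. 2 * p l * u $ l - 2 * m l * u $ l)"
      by (intro sum.cong) (auto simp: Sigma_inv_def Let_def r_def m_def p_def left_diff_distrib)
    also have "(1 + 2 * \<nu> / (r $ i)\<^sup>2 + 2 * (\<Sum>l\<in>UNIV - {i}. m l) + 2 * (\<Sum>l\<in>UNIV - {i}. p l)) * u $ i + (\<Sum>l\<in>UNIV - {i}. 2 * p l * u $ l - 2 * m l * u $ l)
      = u $ i + (2 * \<nu> * u $ i / (r $ i)\<^sup>2 + (\<Sum>l\<in>UNIV - {i}. 2 * (u $ i - u $ l) * m l + 2 * (u $ i + u $ l) * p l))"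
      by (simp add: sum_distrib_left sum_distrib_right sum.distrib sum_subtractf distrib_right left_diff_distrib algebra_simps)
    also have "2 * \<nu> * u $ i / (r $ i)\<^sup>2 = F (i, i)"
      by (simp add: F_def mult_B_def inner_root_B)
    also have "(\<Sum>l\<in>UNIV - {i}. 2 * (u $ i - u $ l) * m l + 2 * (u $ i + u $ l) * p l)
      = (\<Sum>q\<in>UNIV - {i}. if i < q then F (i, q) + F (q, i) else F (i, q) - F (q, i))"
    proof (rule sum.cong[OF refl])
      fix q assume "q \<in> UNIV - {i}"
      then consider "i < q" | "q < i" by fastforce
      then show "2 * (u $ i - u $ q) * m q + 2 * (u $ i + u $ q) * p q = (if i < q then F (i, q) + F (q, i) else F (i, q) - F (q, i))"
      proof cases
        case 1
        then show ?thesis by (auto simp: F_def m_def p_def mult_B_def inner_root_B add.commute)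
      next
        case 2
        have "2 * (u $ q - u $ i) / (r $ q - r $ i)\<^sup>2 = - (2 * (u $ i - u $ q) / (r $ i - r $ q)\<^sup>2)"
          unfolding power2_commute[of "r $ q"] minus_divide_left by simp
        then show ?thesis using 2 by (auto simp: F_def m_def p_def mult_B_def inner_root_B)
      qed
    qed
    finally show ?thesis by (simp only: sum_root_B_component)
  qed
  have "v \<bullet> (Sigma_inv \<nu> *v u) = (\<Sum>i\<in>UNIV. v $ i * u $ i + (\<Sum>k\<in>UNIV. F k * (v $ i * root_B k $ i)))"
    unfolding inner_vec_def by (simp add: comp distrib_left sum_distrib_left mult_ac)
  also have "\<dots> = v \<bullet> u + (\<Sum>k\<in>UNIV. F k * (v \<bullet> root_B k))"
    by (simp add: sum.distrib inner_vec_def sum_distrib_left) (rule sum.swap)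
  finally show ?thesis by (simp add: F_def r_def)
qed

lemma Sigma_inv_r_vec:
  assumes \<nu>: "\<nu> > 0"
  shows "Sigma_inv \<nu> *v r_vec \<nu> = 2 *\<^sub>R (r_vec \<nu> :: real ^ 'n::{finite,linorder})"
proof (rule vector_eq_ldot[THEN iffD1, rule_format])
  fix v :: "(real, 'n) vec"
  have "(\<Sum>k\<in>UNIV. mult_B \<nu> k * (r_vec \<nu> \<bullet> root_B k) * (v \<bullet> root_B k) / (r_vec \<nu> \<bullet> root_B k)\<^sup>2)
     = (\<Sum>k\<in>UNIV. mult_B \<nu> k * (v \<bullet> root_B k) / (r_vec \<nu> \<bullet> root_B k))"
    by (intro sum.cong refl)
      (simp add: power2_eq_square r_vec_root_nonzero[OF \<nu>])
  then show "v \<bullet> (Sigma_inv \<nu> *v r_vec \<nu>) = v \<bullet> (2 *\<^sub>R r_vec \<nu>)"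
    by (simp add: inner_Sigma_inv[OF \<nu>] r_vec_critical[OF \<nu>])
qed

lemma inner_Sigma_inv_commute:
  assumes "\<nu> > 0"
  shows "v \<bullet> (Sigma_inv \<nu> *v u) = u \<bullet> (Sigma_inv \<nu> *v (v :: real ^ 'n::{finite,linorder}))"
  unfolding inner_Sigma_inv[OF assms] by (simp only: inner_commute[of v u] mult_ac)

lemma inner_Sigma_inv_ge:
  assumes \<nu>: "\<nu> > 0"
  shows "u \<bullet> (Sigma_inv \<nu> *v u) \<ge> u \<bullet> (u :: real ^ 'n::{finite,linorder})"
  unfolding inner_Sigma_inv[OF \<nu>]
proof -
  have "0 \<le> (\<Sum>k\<in>UNIV. mult_B \<nu> k * (u \<bullet> root_B k) * (u \<bullet> root_B k) / (r_vec \<nu> \<bullet> root_B k)\<^sup>2)"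
  proof (intro sum_nonneg divide_nonneg_nonneg zero_le_power2)
    show "0 \<le> mult_B \<nu> k * (u \<bullet> root_B k) * (u \<bullet> root_B k)" for k
      unfolding mult.assoc by (intro mult_nonneg_nonneg zero_le_square less_imp_le[OF mult_B_pos[OF \<nu>]])
  qed
  then show "u \<bullet> u \<le> u \<bullet> u + (\<Sum>k\<in>UNIV. mult_B \<nu> k * (u \<bullet> root_B k) * (u \<bullet> root_B k) / (r_vec \<nu> \<bullet> root_B k)\<^sup>2)"
    by simp
qed

text \<open>Apply \<open>ln x \<le> x - 1\<close> to the ratio of each root value at
  \<open>z\<close> to that at \<open>t r\<close>. By the critical equation the linear terms add up
  to \<open>(z \<bullet> r) / t - c\<close>, and \<open>t\<close> is the coefficient of
  \<open>r\<close> in \<open>z\<close>, so this is zero.\<close>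

lemma energy_le:
  fixes z :: "real ^ 'n::{finite,linorder}"
  assumes \<nu>: "\<nu> > 0" and z: "z \<in> weyl_chamber_B"
    and t: "t = z \<bullet> r_vec \<nu> / (r_vec \<nu> \<bullet> (r_vec \<nu> :: real ^ 'n::{finite,linorder}))" "t > 0"
  shows "energy \<nu> z \<le> t powr limit_const CARD('n) \<nu> * energy \<nu> (r_vec \<nu> :: real ^ 'n::{finite,linorder})"
proof (cases "energy \<nu> z = 0")
  case True
  then show ?thesis using energy_nonneg[of \<nu> "r_vec \<nu> :: (real, 'n) vec"] by simp
next
  case False
  define r where "r = (r_vec \<nu> :: (real, 'n) vec)"
  define c where "c = limit_const CARD('n) \<nu>"
  have rk: "r \<bullet> root_B k > 0" for k using r_vec_root_pos[OF \<nu>] by (simp add: r_def)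
  have zk: "z \<bullet> root_B k > 0" for k
    using False energy_nonneg[of \<nu> z] energy_pos_iff[OF z, of \<nu>] by (metis less_le)
  have rr: "r \<bullet> r = c" "c > 0" using inner_r_vec[OF \<nu>] limit_const_pos[OF \<nu>] by (simp_all add: r_def c_def)
  have "ln (energy \<nu> z) = (\<Sum>k\<in>UNIV. mult_B \<nu> k * ln (z \<bullet> root_B k))"
    by (rule ln_energy[OF zk])
  also have "\<dots> \<le> (\<Sum>k\<in>UNIV. mult_B \<nu> k * (ln (r \<bullet> root_B k) + ln t + ((z \<bullet> root_B k) / (t * (r \<bullet> root_B k)) - 1)))"
  proof (intro sum_mono mult_left_mono)
    fix k
    have "ln ((z \<bullet> root_B k) / (t * (r \<bullet> root_B k))) \<le> (z \<bullet> root_B k) / (t * (r \<bullet> root_B k)) - 1"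
      using zk[of k] rk[of k] t(2) by (intro ln_le_minus_one) simp
    then show "ln (z \<bullet> root_B k) \<le> ln (r \<bullet> root_B k) + ln t + ((z \<bullet> root_B k) / (t * (r \<bullet> root_B k)) - 1)"
      using zk[of k] rk[of k] t(2) by (simp add: ln_div ln_mult)
  qed (simp add: less_imp_le[OF mult_B_pos[OF \<nu>]])
  also have "\<dots> = ln (energy \<nu> r) + c * ln t + ((z \<bullet> r) / t - c)"
  proof -
    have "(\<Sum>k\<in>UNIV. mult_B \<nu> k * ((z \<bullet> root_B k) / (t * (r \<bullet> root_B k)))) = (z \<bullet> r) / t"
      unfolding r_def r_vec_critical[OF \<nu>, of z, symmetric] by (simp add: sum_divide_distrib mult.commute[of t])
    moreover have "(\<Sum>k\<in>UNIV. mult_B \<nu> k * ln (r \<bullet> root_B k)) = ln (energy \<nu> r)"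
      by (rule ln_energy[OF rk, symmetric])
    moreover have "(\<Sum>k\<in>UNIV. mult_B \<nu> (k :: 'n \<times> 'n)) = c" by (simp add: sum_mult_B c_def)
    moreover have "(\<Sum>k\<in>UNIV. mult_B \<nu> k * (ln (r \<bullet> root_B k) + ln t + ((z \<bullet> root_B k) / (t * (r \<bullet> root_B k)) - 1)))
       = (\<Sum>k\<in>UNIV. mult_B \<nu> k * ln (r \<bullet> root_B k)) + (\<Sum>k\<in>UNIV. mult_B \<nu> (k :: 'n \<times> 'n)) * ln t
         + ((\<Sum>k\<in>UNIV. mult_B \<nu> k * ((z \<bullet> root_B k) / (t * (r \<bullet> root_B k)))) - (\<Sum>k\<in>UNIV. mult_B \<nu> (k :: 'n \<times> 'n)))"
      by (simp only: distrib_left right_diff_distrib sum.distrib sum_subtractf sum_distrib_right mult_1_right)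
    ultimately show ?thesis by simp
  qed
  also have "(z \<bullet> r) / t = c" using t rr by (simp add: r_def[symmetric] field_simps)
  finally have "ln (energy \<nu> z) \<le> ln (t powr c * energy \<nu> r)"
    using t(2) energy_pos[OF rk, of \<nu>] by (simp add: ln_mult ln_powr)
  then show ?thesis using t(2) energy_pos[OF rk, of \<nu>] energy_pos[OF zk, of \<nu>]
    by (simp add: r_def c_def)
qed

text \<open>By the critical equation \<open>z \<bullet> r\<close> is a combination of the root
  values of \<open>z\<close> with positive coefficients, so inside the chamber it is positive. This
  is what confines the limit to the half space.\<close>

lemma energy_eq_0:
  fixes z :: "real ^ 'n::{finite,linorder}"
  assumes \<nu>: "\<nu> > 0" and z: "z \<in> weyl_chamber_B" and t: "z \<bullet> r_vec \<nu> \<le> 0"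
  shows "energy \<nu> z = 0"
proof (rule ccontr)
  assume "energy \<nu> z \<noteq> 0"
  then have zk: "z \<bullet> root_B k > 0" for k
    using energy_nonneg[of \<nu> z] energy_pos_iff[OF z, of \<nu>] by (metis less_le)
  have "(\<Sum>k\<in>UNIV. mult_B \<nu> k * (z \<bullet> root_B k) / (r_vec \<nu> \<bullet> root_B k)) > 0"
    by (intro sum_pos divide_pos_pos mult_pos_pos zk mult_B_pos[OF \<nu>] r_vec_root_pos[OF \<nu>]) auto
  then show False using t r_vec_critical[OF \<nu>, of z] by simp
qed

text \<open>Expand \<open>\<beta> (G (r + h / sqrt \<beta>) - G r)\<close>. By the critical equation
  the first-order term is \<open>sqrt \<beta> (h \<bullet> r)\<close>, which would diverge but is
  zero for \<open>h\<close> orthogonal to \<open>r\<close>; the second-order term is the Hessian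
  form, and \<open>Sigma_inv\<close> minus the identity is minus the Hessian.\<close>

lemma energy_powr_tendsto:
  fixes h :: "real ^ 'n::{finite,linorder}"
  assumes \<nu>: "\<nu> > 0" and h: "h \<bullet> r_vec \<nu> = 0"
  shows "eventually (\<lambda>\<beta>. \<forall>k. (r_vec \<nu> + (1 / sqrt \<beta>) *\<^sub>R h) \<bullet> root_B k > 0) at_top"
    and "((\<lambda>\<beta>. (energy \<nu> (r_vec \<nu> + (1 / sqrt \<beta>) *\<^sub>R h) / energy \<nu> (r_vec \<nu> :: real ^ 'n::{finite,linorder})) powr \<beta>) \<longlongrightarrow>
      exp (- ((h \<bullet> (Sigma_inv \<nu> *v h) - h \<bullet> h) / 2))) at_top"
proof -
  define r where "r = (r_vec \<nu> :: (real, 'n) vec)"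
  have rk: "r \<bullet> root_B k > 0" for k using r_vec_root_pos[OF \<nu>] by (simp add: r_def)
  define x where "x k = (h \<bullet> root_B k) / (r \<bullet> root_B k)" for k
  have eq: "(r + (1 / sqrt \<beta>) *\<^sub>R h) \<bullet> root_B k = (r \<bullet> root_B k) * (1 + x k / sqrt \<beta>)" for \<beta> k
    using rk[of k] by (simp add: x_def inner_add_left field_simps)
  have "eventually (\<lambda>\<beta>::real. 1 + x k / sqrt \<beta> > 0) at_top" for k by real_asymp
  then have ev: "eventually (\<lambda>\<beta>::real. \<forall>k. 1 + x k / sqrt \<beta> > 0) at_top"
    by (intro eventually_all_finite)
  then have ev2: "eventually (\<lambda>\<beta>. \<forall>k. (r + (1 / sqrt \<beta>) *\<^sub>R h) \<bullet> root_B k > 0) at_top"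
    unfolding eq using rk by (auto simp: zero_less_mult_iff elim!: eventually_mono)
  then show "eventually (\<lambda>\<beta>. \<forall>k. (r_vec \<nu> + (1 / sqrt \<beta>) *\<^sub>R h) \<bullet> root_B k > 0) at_top"
    by (simp add: r_def)
  have sx: "(\<Sum>k\<in>UNIV. mult_B \<nu> k * x k) = 0"
    using r_vec_critical[OF \<nu>, of h] h by (simp add: x_def r_def)
  have "((\<lambda>\<beta>. exp (\<Sum>k\<in>UNIV. mult_B \<nu> k * (\<beta> * (ln (1 + x k / sqrt \<beta>) - x k / sqrt \<beta>)))) \<longlongrightarrow>
      exp (\<Sum>k\<in>UNIV. mult_B \<nu> k * - ((x k)\<^sup>2 / 2))) at_top"
    by (intro tendsto_intros tendsto_scaled_ln_remainder)
  also have "(\<Sum>k\<in>UNIV. mult_B \<nu> k * - ((x k)\<^sup>2 / 2)) = - ((h \<bullet> (Sigma_inv \<nu> *v h) - h \<bullet> h) / 2)"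
    by (simp add: inner_Sigma_inv[OF \<nu>] r_def[symmetric] x_def sum_negf sum_divide_distrib power_divide power2_eq_square mult.assoc)
  finally show "((\<lambda>\<beta>. (energy \<nu> (r_vec \<nu> + (1 / sqrt \<beta>) *\<^sub>R h) / energy \<nu> (r_vec \<nu> :: (real, 'n) vec)) powr \<beta>) \<longlongrightarrow>
      exp (- ((h \<bullet> (Sigma_inv \<nu> *v h) - h \<bullet> h) / 2))) at_top"
  proof (rule Lim_transform_eventually)
    show "eventually (\<lambda>\<beta>. exp (\<Sum>k\<in>UNIV. mult_B \<nu> k * (\<beta> * (ln (1 + x k / sqrt \<beta>) - x k / sqrt \<beta>))) =
       (energy \<nu> (r_vec \<nu> + (1 / sqrt \<beta>) *\<^sub>R h) / energy \<nu> (r_vec \<nu> :: (real, 'n) vec)) powr \<beta>) at_top"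
      using ev ev2
    proof eventually_elim
      case (elim \<beta>)
      have "ln (energy \<nu> (r + (1 / sqrt \<beta>) *\<^sub>R h) / energy \<nu> r) =
          (\<Sum>k\<in>UNIV. mult_B \<nu> k * ln ((r + (1 / sqrt \<beta>) *\<^sub>R h) \<bullet> root_B k)) - (\<Sum>k\<in>UNIV. mult_B \<nu> k * ln (r \<bullet> root_B k))"
        using elim rk energy_pos[of r \<nu>] energy_pos[of "r + (1 / sqrt \<beta>) *\<^sub>R h" \<nu>]
        by (simp add: ln_div ln_energy)
      also have "\<dots> = (\<Sum>k\<in>UNIV. mult_B \<nu> k * ln (1 + x k / sqrt \<beta>))"
      proof -
        have "ln ((r \<bullet> root_B k) * (1 + x k / sqrt \<beta>)) = ln (r \<bullet> root_B k) + ln (1 + x k / sqrt \<beta>)" for k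
          using elim(1)[rule_format, of k] rk[of k] by (simp add: ln_mult)
        then show ?thesis unfolding eq by (simp add: distrib_left sum.distrib)
      qed
      \<comment> \<open>The subtracted sum is zero by \<open>sx\<close>; it supplies the linear term
        of each logarithm.\<close>
      also have "\<dots> = (\<Sum>k\<in>UNIV. mult_B \<nu> k * ln (1 + x k / sqrt \<beta>)) - (\<Sum>k\<in>UNIV. mult_B \<nu> k * x k) / sqrt \<beta>"
        by (simp add: sx)
      also have "\<dots> = (\<Sum>k\<in>UNIV. mult_B \<nu> k * (ln (1 + x k / sqrt \<beta>) - x k / sqrt \<beta>))"
        by (simp add: sum_divide_distrib sum_subtractf right_diff_distrib)
      finally have "\<beta> * ln (energy \<nu> (r + (1 / sqrt \<beta>) *\<^sub>R h) / energy \<nu> r)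
         = (\<Sum>k\<in>UNIV. mult_B \<nu> k * (\<beta> * (ln (1 + x k / sqrt \<beta>) - x k / sqrt \<beta>)))"
        by (simp only: sum_distrib_left mult.left_commute)
      moreover have "energy \<nu> (r + (1 / sqrt \<beta>) *\<^sub>R h) / energy \<nu> r > 0"
        using elim rk by (intro divide_pos_pos energy_pos) auto
      ultimately show ?case by (auto simp: powr_def r_def)
    qed
  qed
qed

lemma tau_exponent_eq: "tau_exponent n \<nu> \<beta> = \<beta> * limit_const n \<nu> / 2 + (real n + 1) / 2"
  by (simp add: tau_exponent_def limit_const_def)

lemma tau_density_eq:
  fixes y :: "real ^ 'n::{finite,linorder}"
  assumes y: "y \<in> weyl_chamber_B"
  shows "tau_density \<nu> \<beta> y = C_B \<nu> \<beta> CARD('n) *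
    (1 / (1 + (norm y)\<^sup>2) powr (\<beta> * limit_const CARD('n) \<nu> / 2 + (real CARD('n) + 1) / 2)) * energy \<nu> y powr \<beta>"
proof -
  have "energy \<nu> y powr \<beta> = (\<Prod>k\<in>UNIV. (y \<bullet> root_B k) powr (mult_B \<nu> k * \<beta>))"
    unfolding energy_def by (subst prod_powr_distrib) (simp_all add: powr_powr)
  also have "\<dots> = (\<Prod>(i, j) | i < j. (y \<bullet> root_B (i, j)) powr (mult_B \<nu> (i, j) * \<beta>) * (y \<bullet> root_B (j, i)) powr (mult_B \<nu> (j, i) * \<beta>))
     * (\<Prod>i\<in>UNIV. (y \<bullet> root_B (i, i)) powr (mult_B \<nu> (i, i) * \<beta>))"
    by (rule prod_pairs_split)
  also have "(\<Prod>(i, j) | i < j. (y \<bullet> root_B (i, j)) powr (mult_B \<nu> (i, j) * \<beta>) * (y \<bullet> root_B (j, i)) powr (mult_B \<nu> (j, i) * \<beta>))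
     = (\<Prod>(i, j) | i < j. ((y $ i)\<^sup>2 - (y $ j)\<^sup>2) powr (2 * \<beta>))"
  proof (rule prod.cong[OF refl], clarsimp)
    fix i j :: 'n assume ij: "i < j"
    have "(y $ i)\<^sup>2 - (y $ j)\<^sup>2 = (y $ i - y $ j) * (y $ j + y $ i)" by (simp add: power2_eq_square algebra_simps)
    then show "(y \<bullet> root_B (i, j)) powr (mult_B \<nu> (i, j) * \<beta>) * (y \<bullet> root_B (j, i)) powr (mult_B \<nu> (j, i) * \<beta>)
      = ((y $ i)\<^sup>2 - (y $ j)\<^sup>2) powr (2 * \<beta>)"
      using ij by (auto simp: inner_root_B mult_B_def powr_mult)
  qed
  also have "(\<Prod>i\<in>UNIV. (y \<bullet> root_B (i, i)) powr (mult_B \<nu> (i, i) * \<beta>)) = (\<Prod>i\<in>UNIV. (y $ i) powr (2 * \<nu> * \<beta>))"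
    by (simp add: inner_root_B mult_B_def)
  finally show ?thesis
    unfolding tau_density_def tau_exponent_eq by (simp only: mult_ac)
qed

section \<open>The mixture of normal distributions\<close>

lemma nn_integral_gauss_half:
  "(\<integral>\<^sup>+t. ennreal (2 * exp (- t\<^sup>2 / 2)) * indicator {..<0} t \<partial>lborel) = ennreal (sqrt (2 * pi))"
proof -
  define e where "e t = ennreal (exp (- t\<^sup>2 / 2))" for t :: real
  have [measurable]: "e \<in> borel_measurable borel" unfolding e_def by measurable
  have "(\<integral>\<^sup>+t. e t * indicator {..<0} t \<partial>lborel) = (\<integral>\<^sup>+t. e t * indicator {0<..} t \<partial>lborel)"
    by (subst nn_integral_real_affine[of _ "-1" 0]) (auto simp: e_def indicator_def)
  moreover have "ennreal (2 * exp (- t\<^sup>2 / 2)) * indicator {..<0} t = e t * indicator {..<0} t + e t * indicator {..<0} t" for t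
    by (simp add: e_def ennreal_plus[symmetric] distrib_right[symmetric] del: ennreal_plus)
  ultimately have "(\<integral>\<^sup>+t. ennreal (2 * exp (- t\<^sup>2 / 2)) * indicator {..<0} t \<partial>lborel)
      = (\<integral>\<^sup>+t. e t * indicator {..<0} t + e t * indicator {0<..} t \<partial>lborel)"
    by (simp add: nn_integral_add)
  also have "\<dots> = (\<integral>\<^sup>+t. e t \<partial>lborel)"
    using AE_lborel_singleton[of "0::real"] by (intro nn_integral_cong_AE) (auto elim!: eventually_mono simp: indicator_def)
  also have "\<dots> = (\<integral>\<^sup>+t. ennreal (sqrt (2 * pi)) * ennreal (std_normal_density t) \<partial>lborel)"
    by (intro nn_integral_cong) (simp add: e_def std_normal_density_def ennreal_mult[symmetric])
  also have "\<dots> = ennreal (sqrt (2 * pi)) * 1"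
    by (subst nn_integral_cmult) (auto simp: nn_integral_eq_integral)
  finally show ?thesis by simp
qed

text \<open>Substitute \<open>s = 1 / t^2\<close> on the negative half line, where this map is
  increasing; the weight becomes \<open>2 * exp (- t^2 / 2)\<close>, a Gaussian integral.\<close>

lemma nn_integral_mixture_weight:
  "(\<integral>\<^sup>+s. ennreal (s powr (- 3 / 2) * exp (- 1 / (2 * s))) * indicator {0<..} s \<partial>lborel) = ennreal (sqrt (2 * pi))"
proof -
  define W where "W s = ennreal (s powr (- 3 / 2) * exp (- 1 / (2 * s)))" for s :: real
  have W: "W \<in> borel_measurable borel" unfolding W_def by measurable
  define g where "g t = 1 / t\<^sup>2" for t :: real
  define g' where "g' t = - 2 / t ^ 3" for t :: real
  define a where "a k = - real (k + 2)" for k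
  define b where "b k = - (1 / real (k + 1))" for k
  have b0: "b k < 0" for k by (simp add: b_def)
  have a0: "a k < 0" for k by (simp add: a_def)
  have ab: "decseq a" "incseq b"
    by (auto simp: decseq_def incseq_def a_def b_def intro!: divide_left_mono)
  have gm: "g x \<le> g y" if "x \<le> y" "y < 0" for x y
  proof -
    have "y\<^sup>2 \<le> x\<^sup>2" using that by (simp add: abs_le_square_iff[symmetric])
    then show ?thesis using that unfolding g_def by (intro divide_left_mono) (auto intro!: mult_pos_pos)
  qed
  have A: "{..<0} = (\<Union>k. {a k..b k})"
  proof (intro set_eqI iffI)
    fix t :: real assume t: "t \<in> {..<0}"
    obtain k where k: "1 / (- t) < real k" using reals_Archimedean2 by blast
    obtain l where l: "- t < real l" using reals_Archimedean2 by blast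
    define m where "m = max k l"
    have m: "real k \<le> real m" "real l \<le> real m" by (auto simp: m_def)
    have "1 / (- t) * (- t) < real k * (- t)" using k t by (intro mult_strict_right_mono) auto
    then have "1 < real k * (- t)" using t by simp
    also have "\<dots> \<le> real (m + 1) * (- t)" using t m by (intro mult_right_mono) auto
    finally have "t \<le> b m" using t by (simp add: b_def field_simps)
    moreover have "a m \<le> t" using l m by (simp add: a_def)
    ultimately show "t \<in> (\<Union>k. {a k..b k})" by auto
  qed (use b0 in \<open>auto intro: le_less_trans\<close>)
  have "(\<integral>\<^sup>+s. W s * indicator {0<..} s \<partial>lborel) = (\<integral>\<^sup>+t. W (g t) * ennreal (g' t) * indicator {..<0} t \<partial>lborel)"
  proof (rule nn_integral_substitution_exhaustion[where a = a and b = b, OF W])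
    show "a k < b k" for k
      by (rule less_le_trans[of _ "- 1"]) (auto simp: a_def b_def)
    show "decseq a" "incseq b" by (fact ab)+
    fix t :: real and k assume t: "t \<in> {a k..b k}"
    then have t0: "t < 0" using b0[of k] by simp
    show "(g has_real_derivative g' t) (at t)"
      unfolding g_def g'_def using t0
      by (auto intro!: derivative_eq_intros simp: power2_eq_square power3_eq_cube)
    show "0 \<le> g' t" using t0 by (simp add: g'_def divide_nonpos_neg)
  next
    show "continuous_on {a k..b k} g'" for k
      unfolding g'_def using b0[of k] by (intro continuous_intros) auto
    show "decseq (\<lambda>k. g (a k))" "incseq (\<lambda>k. g (b k))"
      using ab a0 b0 by (auto simp: decseq_def incseq_def intro!: gm)
    show "{..<0} = (\<Union>k. {a k..b k})" by (rule A)
    show "{0<..} = (\<Union>k. {g (a k)..g (b k)})"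
    proof (intro set_eqI iffI)
      fix s :: real assume s: "s \<in> {0<..}"
      define t where "t = - (1 / sqrt s)"
      have "t \<in> {..<0}" using s by (simp add: t_def)
      then obtain k where k: "a k \<le> t" "t \<le> b k" unfolding A by auto
      have gt: "g t = s" using s by (simp add: g_def t_def power_divide)
      have "g (a k) \<le> s" "s \<le> g (b k)" using gm[OF k(1)] gm[OF k(2) b0] \<open>t \<in> {..<0}\<close> gt by auto
      then show "s \<in> (\<Union>k. {g (a k)..g (b k)})" by auto
    next
      fix s assume "s \<in> (\<Union>k. {g (a k)..g (b k)})"
      then obtain k where "g (a k) \<le> s" by auto
      moreover have "0 < g (a k)" by (simp add: g_def a_def)
      ultimately show "s \<in> {0<..}" by simp
    qed
  qed
  also have "\<dots> = (\<integral>\<^sup>+t. ennreal (2 * exp (- t\<^sup>2 / 2)) * indicator {..<0} t \<partial>lborel)"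
  proof (rule nn_integral_cong)
    fix t :: real
    show "W (g t) * ennreal (g' t) * indicator {..<0} t = ennreal (2 * exp (- t\<^sup>2 / 2)) * indicator {..<0} t"
    proof (cases "t < 0")
      case True
      have "(g t) powr (- 3 / 2) = ((- t) powr - 2) powr (- 3 / 2)"
        using True by (simp add: g_def powr_minus_divide)
      also have "\<dots> = (- t) ^ 3" using True by (simp add: powr_powr)
      finally have "(g t) powr (- 3 / 2) * g' t = 2"
        using True by (simp add: g'_def)
      then have "g t powr (- 3 / 2) * exp (- 1 / (2 * g t)) * g' t = 2 * exp (- t\<^sup>2 / 2)"
        by (simp add: g_def mult.commute mult.left_commute)
      moreover have "0 \<le> g' t" using True by (simp add: g'_def divide_nonpos_neg)
      ultimately show ?thesis
        using True by (simp add: W_def ennreal_mult[symmetric])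
    qed simp
  qed
  also have "\<dots> = ennreal (sqrt (2 * pi))" by (rule nn_integral_gauss_half)
  finally show ?thesis by (simp add: W_def)
qed

text \<open>\<open>limit_density\<close> up to a constant, in the coordinates of
  \<open>x = a r + u\<close> with \<open>u\<close> orthogonal to \<open>r\<close>, and extended by
  zero outside the open half space. Both the limit of the densities and the mixture are brought to
  this form.\<close>

definition limit_shape :: "real \<Rightarrow> real ^ 'n::{finite,linorder} \<Rightarrow> real" where
  "limit_shape \<nu> x = (let a = x \<bullet> r_vec \<nu> / limit_const CARD('n) \<nu>; u = proj_perp (r_vec \<nu>) x in
     if a > 0 then exp (- (1 + u \<bullet> (Sigma_inv \<nu> *v u)) / (2 * a\<^sup>2)) / a ^ (CARD('n) + 1) else 0)"

lemma measurable_matrix_vector_mult [measurable]: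
  fixes B :: "real ^ 'n ^ 'm"
  assumes "g \<in> borel_measurable M"
  shows "(\<lambda>p. B *v g p) \<in> borel_measurable M"
proof -
  have "(\<lambda>x. B *v x) \<in> borel_measurable borel"
    by (intro borel_measurable_continuous_onI linear_continuous_on)
       (simp add: linear_conv_bounded_linear[symmetric] matrix_vector_mul_linear)
  from measurable_compose[OF assms this] show ?thesis .
qed

lemma measurable_proj_perp [measurable]:
  fixes g :: "'b \<Rightarrow> 'a::euclidean_space"
  assumes [measurable]: "g \<in> borel_measurable M"
  shows "(\<lambda>p. proj_perp v (g p)) \<in> borel_measurable M"
  unfolding proj_perp_def proj_line_def by measurable

lemma measurable_limit_shape [measurable]: "limit_shape \<nu> \<in> borel_measurable borel"
  unfolding limit_shape_def Let_def by measurable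

lemma nn_integral_lborel_vec_prod:
  assumes [measurable]: "f \<in> borel_measurable borel"
  shows "(\<integral>\<^sup>+x. (\<Prod>i\<in>UNIV. f ((x :: real ^ 'n) $ i)) \<partial>lborel) = (\<integral>\<^sup>+x. f x \<partial>lborel) ^ CARD('n)"
proof -
  have bij: "bij_betw (\<lambda>i. axis i (1::real) :: real ^ 'n) UNIV Basis"
    by (auto simp: bij_betw_def inj_on_def axis_eq_axis Basis_vec_def)
  have "(\<integral>\<^sup>+x. (\<Prod>i\<in>UNIV. f ((x :: real ^ 'n) $ i)) \<partial>lborel) = (\<integral>\<^sup>+x. (\<Prod>b\<in>Basis. f ((x :: real ^ 'n) \<bullet> b)) \<partial>lborel)"
    by (simp add: prod.reindex_bij_betw[OF bij, symmetric] inner_axis)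
  also have "\<dots> = (\<integral>\<^sup>+x. f x \<partial>lborel) ^ CARD('n)"
    by (subst nn_integral_lborel_prod) auto
  finally show ?thesis .
qed

lemma std_normal_vec_eq:
  "(std_normal_vec :: (real ^ 'n) measure) =
    density lborel (\<lambda>z. ennreal ((1 / sqrt (2 * pi)) ^ CARD('n) * exp (- (z \<bullet> z) / 2)))"
proof -
  have "(\<Prod>i\<in>UNIV. std_normal_density (z $ i)) = (1 / sqrt (2 * pi)) ^ CARD('n) * exp (- (z \<bullet> z) / 2)" for z :: "real ^ 'n"
  proof -
    have "(\<Prod>i\<in>UNIV. std_normal_density (z $ i)) = (\<Prod>i\<in>UNIV. 1 / sqrt (2 * pi) * exp (- (z $ i * z $ i) / 2))"
      by (simp add: std_normal_density_def power2_eq_square)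
    also have "\<dots> = (1 / sqrt (2 * pi)) ^ CARD('n) * exp (\<Sum>i\<in>UNIV. - (z $ i * z $ i) / 2)"
      by (simp only: prod.distrib prod_constant exp_sum[OF finite, symmetric])
    finally show ?thesis
      by (simp add: inner_vec_def sum_negf sum_divide_distrib)
  qed
  then show ?thesis unfolding std_normal_vec_def by simp
qed

lemma sets_std_normal_vec [simp, measurable_cong]: "sets std_normal_vec = sets borel"
  by (simp add: std_normal_vec_def)

lemma emeasure_std_normal_vec: "emeasure (std_normal_vec :: (real ^ 'n) measure) UNIV = 1"
proof -
  have "emeasure (std_normal_vec :: (real ^ 'n) measure) UNIV
      = (\<integral>\<^sup>+x. (\<Prod>i\<in>UNIV. ennreal (std_normal_density ((x :: real ^ 'n) $ i))) \<partial>lborel)"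
    unfolding std_normal_vec_def
    by (subst emeasure_density) (auto simp: prod_ennreal intro!: borel_measurable_prod)
  also have "\<dots> = (\<integral>\<^sup>+x. ennreal (std_normal_density x) \<partial>lborel) ^ CARD('n)"
    by (rule nn_integral_lborel_vec_prod) measurable
  also have "(\<integral>\<^sup>+x. ennreal (std_normal_density x) \<partial>lborel) = 1"
    by (subst nn_integral_eq_integral) auto
  finally show ?thesis by simp
qed

text \<open>Gram-Schmidt for the form \<open>Q\<close>: fewer than \<open>N\<close> vectors
  \<open>Q b\<close> leave some \<open>v \<noteq> 0\<close> orthogonal to all of them, and
  \<open>v\<close> scaled to \<open>Q\<close>-length one extends the system. The columns of
  \<open>C\<close> are the resulting basis.\<close>

lemma exists_congruent_identity:
  fixes Q :: "real ^ 'n ^ 'n"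
  assumes sym: "\<And>u v. v \<bullet> (Q *v u) = u \<bullet> (Q *v v)" and pos: "\<And>u. u \<noteq> 0 \<Longrightarrow> u \<bullet> (Q *v u) > 0"
  obtains C :: "real ^ 'n ^ 'n" where "transpose C ** Q ** C = mat 1"
proof -
  have "\<exists>B. finite B \<and> card B = k \<and> (\<forall>b\<in>B. b \<bullet> (Q *v b) = 1) \<and> (\<forall>b\<in>B. \<forall>b'\<in>B. b \<noteq> b' \<longrightarrow> b \<bullet> (Q *v b') = 0)"
    if "k \<le> CARD('n)" for k
    using that
  proof (induction k)
    case 0
    show ?case by (intro exI[of _ "{}"]) auto
  next
    case (Suc k)
    then obtain B where B: "finite B" "card B = k" "\<And>b. b \<in> B \<Longrightarrow> b \<bullet> (Q *v b) = 1"
      "\<And>b b'. b \<in> B \<Longrightarrow> b' \<in> B \<Longrightarrow> b \<noteq> b' \<Longrightarrow> b \<bullet> (Q *v b') = 0" by auto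
    have "dim ((\<lambda>b. Q *v b) ` B) \<le> card ((\<lambda>b. Q *v b) ` B)"
      using B(1) by (intro dim_le_card') auto
    also have "\<dots> \<le> k" using card_image_le[OF B(1)] B(2) by auto
    also have "\<dots> < DIM(real ^ 'n)" using Suc.prems by simp
    finally obtain v where v: "v \<noteq> 0" "\<And>b. b \<in> B \<Longrightarrow> v \<bullet> (Q *v b) = 0"
      using orthogonal_to_subspace_exists[of "(\<lambda>b. Q *v b) ` B"]
      by (metis imageI orthogonal_def span_base)
    define q where "q = v \<bullet> (Q *v v)"
    have q: "q > 0" using pos[OF v(1)] by (simp add: q_def)
    define w where "w = (1 / sqrt q) *\<^sub>R v"
    have w1: "w \<bullet> (Q *v w) = 1"
      using q by (simp add: w_def matrix_vector_mult_scaleR q_def[symmetric])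
    have w0: "w \<bullet> (Q *v b) = 0" "b \<bullet> (Q *v w) = 0" if "b \<in> B" for b
      using v(2)[OF that] sym[of b w] by (simp_all add: w_def)
    have "w \<notin> B" using w0 w1 by force
    then show ?case
      using B w0 w1 by (intro exI[of _ "insert w B"]) auto
  qed
  from this[OF order.refl] obtain B where B: "finite B" "card B = CARD('n)" "\<And>b. b \<in> B \<Longrightarrow> b \<bullet> (Q *v b) = 1"
      "\<And>b b'. b \<in> B \<Longrightarrow> b' \<in> B \<Longrightarrow> b \<noteq> b' \<Longrightarrow> b \<bullet> (Q *v b') = 0" by auto
  then obtain f :: "'n \<Rightarrow> real ^ 'n" where f: "bij_betw f UNIV B"
    using finite_same_card_bij[of "UNIV :: 'n set" B] by auto
  define C :: "real ^ 'n ^ 'n" where "C = (\<chi> i j. f j $ i)"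
  have C: "C *v axis j 1 = f j" for j
    by (simp add: vec_eq_iff C_def matrix_vector_mult_basis column_def)
  have "(transpose C ** Q ** C) $ i $ j = mat 1 $ i $ j" for i j
  proof -
    have "(transpose C ** Q ** C) $ i $ j = axis i 1 \<bullet> ((transpose C ** Q ** C) *v axis j 1)"
      by (simp add: inner_axis' matrix_vector_mult_basis column_def)
    also have "\<dots> = (C *v axis i 1) \<bullet> (Q *v (C *v axis j 1))"
      by (simp add: matrix_vector_mul_assoc[symmetric] transpose_matrix_vector)
        (metis dot_lmul_matrix inner_commute)
    also have "\<dots> = (if i = j then 1 else 0)"
      using B(3)[of "f i"] B(4)[of "f i" "f j"] f by (auto simp: C bij_betw_def inj_on_def)
    finally show ?thesis by (simp add: mat_def)
  qed
  then show thesis by (intro that[of C]) (simp add: vec_eq_iff)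
qed

text \<open>Distribute the exponent evenly: each coordinate receives
  \<open>p = (N + 1) / (2 N) > 1 / 2\<close>, and
  \<open>1 + y \<bullet> y \<ge> 1 + (y $ i)^2\<close> leaves a product of integrable functions of
  one variable.\<close>

lemma integrable_multivariate_Cauchy:
  "integrable lborel (\<lambda>y :: real ^ 'n. (1 + y \<bullet> y) powr - ((real CARD('n) + 1) / 2))"
proof -
  define n where "n = CARD('n)"
  have n: "n > 0" by (simp add: n_def)
  define p where "p = (real n + 1) / (2 * real n)"
  have p: "p > 1 / 2" using n by (simp add: p_def field_simps)
  have np: "(real n + 1) / 2 = p * real n" using n by (simp add: p_def)
  have bound: "(1 + y \<bullet> y) powr - (p * real n) \<le> (\<Prod>i\<in>UNIV. (1 + (y $ i)\<^sup>2) powr - p)" for y :: "real ^ 'n"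
  proof -
    have "(1 + y \<bullet> y) powr - (p * real n) = (\<Prod>i\<in>(UNIV :: 'n set). (1 + y \<bullet> y) powr - p)"
      by (simp add: n_def[symmetric] powr_power add_nonneg_eq_0_iff mult.commute)
    also have "\<dots> \<le> (\<Prod>i\<in>UNIV. (1 + (y $ i)\<^sup>2) powr - p)"
    proof (rule prod_mono)
      fix i
      have "(y $ i)\<^sup>2 \<le> y \<bullet> y"
        unfolding inner_vec_def inner_real_def power2_eq_square by (rule member_le_sum) auto
      then show "0 \<le> (1 + y \<bullet> y) powr - p \<and> (1 + y \<bullet> y) powr - p \<le> (1 + (y $ i)\<^sup>2) powr - p"
        using p by (auto intro!: powr_mono2' add_pos_nonneg)
    qed
    finally show ?thesis .
  qed
  have "(\<integral>\<^sup>+y. ennreal ((1 + (y :: real ^ 'n) \<bullet> y) powr - (p * real n)) \<partial>lborel) \<le> (\<integral>\<^sup>+y. (\<Prod>i\<in>UNIV. ennreal ((1 + ((y :: real ^ 'n) $ i)\<^sup>2) powr - p)) \<partial>lborel)"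
    by (intro nn_integral_mono, subst prod_ennreal) (auto intro: ennreal_leI bound)
  also have "\<dots> = (\<integral>\<^sup>+y. ennreal ((1 + y\<^sup>2) powr - p) \<partial>lborel) ^ n"
    unfolding n_def by (rule nn_integral_lborel_vec_prod) measurable
  also have "(\<integral>\<^sup>+y. ennreal ((1 + y\<^sup>2) powr - p) \<partial>lborel) = ennreal (\<integral>y. (1 + y\<^sup>2) powr - p \<partial>lborel)"
    by (rule nn_integral_eq_integral[OF integrable_one_plus_square_powr[OF p]]) simp
  finally have "(\<integral>\<^sup>+y. ennreal ((1 + (y :: real ^ 'n) \<bullet> y) powr - (p * real n)) \<partial>lborel) < \<infinity>"
    by (simp add: ennreal_power less_le_trans le_less_trans)
  then show ?thesis
    unfolding n_def[symmetric] np by (intro integrableI_nonneg) auto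
qed

text \<open>Trades a growing exponent for a fixed one in the domination: with \<open>k / m\<close>
  for \<open>k\<close> it gives
  \<open>(1 + w) powr - k \<le> (1 + k / m * w) powr - m\<close>.\<close>

lemma Bernoulli_powr:
  fixes w k :: real
  assumes "0 \<le> w" "1 \<le> k"
  shows "1 + k * w \<le> (1 + w) powr k"
proof -
  define f where "f x = k * ln (1 + x) - ln (1 + k * x)" for x
  have "f 0 \<le> f w"
  proof (rule DERIV_nonneg_imp_nondecreasing[of 0 w f])
    fix x assume x: "0 \<le> x" "x \<le> w"
    then have pos: "1 + x > 0" "1 + k * x > 0" using assms by (auto intro: add_pos_nonneg)
    have "(f has_real_derivative (k * (1 / (1 + x)) - 1 / (1 + k * x) * k)) (at x)"
      unfolding f_def using pos by (auto intro!: derivative_eq_intros)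
    moreover have "1 / (1 + k * x) \<le> 1 / (1 + x)"
      using pos x assms by (intro divide_left_mono) (auto simp: mult_le_cancel_right1)
    then have "k * (1 / (1 + k * x)) \<le> k * (1 / (1 + x))" using assms by (intro mult_left_mono) auto
    then have "0 \<le> k * (1 / (1 + x)) - 1 / (1 + k * x) * k" by (simp add: mult.commute)
    ultimately show "\<exists>y. (f has_real_derivative y) (at x) \<and> 0 \<le> y" by blast
  qed (use assms in auto)
  then have le: "ln (1 + k * w) \<le> k * ln (1 + w)" by (simp add: f_def)
  have "1 + k * w > 0" using assms by (auto intro: add_pos_nonneg)
  then have "1 + k * w = exp (ln (1 + k * w))" by simp
  also have "\<dots> \<le> exp (k * ln (1 + w))" using le by simp
  also have "\<dots> = (1 + w) powr k" using assms by (simp add: powr_def)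
  finally show ?thesis .
qed

text \<open>The inverse of \<open>rescale\<close>, written as a correction along \<open>r\<close> so
  that \<open>nn_integral_scale_component\<close> applies verbatim.\<close>

definition unscale :: "real \<Rightarrow> real \<Rightarrow> real ^ 'n::{finite,linorder} \<Rightarrow> real ^ 'n::{finite,linorder}" where
  "unscale \<nu> \<beta> y = y + ((sqrt \<beta> - 1) * (y \<bullet> r_vec \<nu> / (r_vec \<nu> \<bullet> (r_vec \<nu> :: real ^ 'n::{finite,linorder})))) *\<^sub>R r_vec \<nu>"

text \<open>Collects the factors that do not depend on \<open>y\<close>. The power of
  \<open>c\<close> and the value of \<open>energy\<close> at \<open>r\<close> are split off so that
  the remaining \<open>pre_shape\<close> converges; the type argument carries the dimension.\<close>

definition norm_const :: "'n::{finite,linorder} itself \<Rightarrow> real \<Rightarrow> real \<Rightarrow> real" where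
  "norm_const _ \<nu> \<beta> = C_B \<nu> \<beta> CARD('n) * \<beta> powr (- (real CARD('n) / 2)) *
     limit_const CARD('n) \<nu> powr (- (\<beta> * limit_const CARD('n) \<nu> / 2)) * energy \<nu> (r_vec \<nu> :: real ^ 'n::{finite,linorder}) powr \<beta>"

text \<open>The density of the rescaled variable without \<open>norm_const\<close>. The powers of
  \<open>\<beta>\<close> and \<open>c\<close> balance \<open>1 + z \<bullet> z\<close>, which grows
  like \<open>c * \<beta> * a^2\<close> when \<open>y\<close> has component
  \<open>a r\<close>.\<close>

definition pre_shape :: "real \<Rightarrow> real \<Rightarrow> real ^ 'n::{finite,linorder} \<Rightarrow> real" where
  "pre_shape \<nu> \<beta> y = (let z = unscale \<nu> \<beta> y; c = limit_const CARD('n) \<nu>; m = (real CARD('n) + 1) / 2 in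
     \<beta> powr m * c powr (\<beta> * c / 2) * (1 + z \<bullet> z) powr - (\<beta> * c / 2 + m) *
     (energy \<nu> z / energy \<nu> (r_vec \<nu> :: real ^ 'n::{finite,linorder})) powr \<beta> * indicator weyl_chamber_B z)"

lemma energy_r_pos: "\<nu> > 0 \<Longrightarrow> energy \<nu> (r_vec \<nu> :: real ^ 'n::{finite,linorder}) > 0"
  by (rule energy_pos) (rule r_vec_root_pos)

section \<open>Projections, the quadratic form and the singular normal laws\<close>

context
  fixes \<nu> :: real and r :: "real ^ 'n::{finite,linorder}" and Q :: "real ^ 'n::{finite,linorder} ^ 'n::{finite,linorder}" and c m :: real
  assumes \<nu>: "\<nu> > 0"
  defines "r \<equiv> r_vec \<nu>" and "Q \<equiv> Sigma_inv \<nu>" and "c \<equiv> limit_const CARD('n) \<nu>" and "m \<equiv> (real CARD('n) + 1) / 2"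
begin

private lemma rr: "r \<bullet> r = c" and c_pos: "c > 0" and r0: "r \<noteq> 0"
  using inner_r_vec[OF \<nu>, where ?'n = 'n] limit_const_pos[OF \<nu>, of "CARD('n)"] r_vec_nonzero[OF \<nu>, where ?'n = 'n]
  by (simp_all add: r_def c_def)

private lemma m_pos: "m > 0"
  by (simp add: m_def)

private lemma Q_r: "Q *v r = 2 *\<^sub>R r"
  by (simp add: Q_def r_def Sigma_inv_r_vec[OF \<nu>])

private lemma Q_sym: "v \<bullet> (Q *v u) = u \<bullet> (Q *v v)"
  unfolding Q_def by (rule inner_Sigma_inv_commute[OF \<nu>])

private lemma r_Q: "r \<bullet> (Q *v x) = 2 * (x \<bullet> r)"
  using Q_sym[of r x] by (simp add: Q_r)

private lemma proj_perp_r: "proj_perp r r = 0" "proj_perp r x \<bullet> r = 0" "proj_perp r (x + t *\<^sub>R r) = proj_perp r x"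
  "proj_perp r (t *\<^sub>R x) = t *\<^sub>R proj_perp r x" "proj_perp r (proj_perp r x) = proj_perp r x"
proof -
  have *: "r \<bullet> r \<noteq> 0" using r0 by simp
  show "proj_perp r r = 0" "proj_perp r x \<bullet> r = 0"
    using * by (simp_all add: proj_perp_def proj_line_def inner_diff_left)
  then show "proj_perp r (proj_perp r x) = proj_perp r x" by (simp add: proj_perp_def[of r "proj_perp r x"] proj_line_def)
  show "proj_perp r (x + t *\<^sub>R r) = proj_perp r x"
    using * by (simp add: proj_perp_def proj_line_def inner_add_left add_divide_distrib scaleR_add_left)
  show "proj_perp r (t *\<^sub>R x) = t *\<^sub>R proj_perp r x"
    by (simp add: proj_perp_def proj_line_def scaleR_diff_right)
qed

lemma linear_proj_perp: "linear (proj_perp r)"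
  by (rule linearI) (simp_all add: proj_perp_def proj_line_def inner_add_left add_divide_distrib scaleR_add_left scaleR_diff_right)

private lemma split_r: "x = (x \<bullet> r / c) *\<^sub>R r + proj_perp r x"
  by (simp add: proj_perp_def proj_line_def rr)

text \<open>No cross term, since \<open>r\<close> is an eigenvector of the symmetric matrix
  \<open>Q\<close>; the eigenvalue \<open>2\<close> and \<open>r \<bullet> r = c\<close> give the
  first coefficient.\<close>

lemma quadratic_split:
  "x \<bullet> (Q *v x) = 2 * c * (x \<bullet> r / c)\<^sup>2 + proj_perp r x \<bullet> (Q *v proj_perp r x)"
proof -
  define u where "u = proj_perp r x"
  define a where "a = x \<bullet> r / c"
  have x: "x = a *\<^sub>R r + u" using split_r[of x] by (simp add: a_def u_def)
  have u: "u \<bullet> r = 0" "r \<bullet> u = 0" by (simp_all add: u_def proj_perp_r inner_commute[of r])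
  have "Q *v x = (2 * a) *\<^sub>R r + Q *v u"
    unfolding x by (simp add: matrix_vector_right_distrib matrix_vector_mult_scaleR Q_r)
  moreover have "r \<bullet> (Q *v u) = 0" by (simp add: r_Q u)
  ultimately have "x \<bullet> (Q *v x) = 2 * c * a\<^sup>2 + u \<bullet> (Q *v u)"
    unfolding x by (simp add: inner_add_left inner_add_right u rr power2_eq_square)
  then show ?thesis by (simp add: a_def u_def)
qed

lemma proj_perp_Q: "proj_perp r (Q *v x) = Q *v proj_perp r x"
proof -
  have "(Q *v x) \<bullet> r = 2 * (x \<bullet> r)" using r_Q[of x] by (simp only: inner_commute[of r])
  then show ?thesis
    unfolding proj_perp_def proj_line_def
    by (simp add: matrix_vector_mult_diff_distrib matrix_vector_mult_scaleR Q_r)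
qed

lemma A_mat_mult: "A_mat \<nu> *v x = proj_perp r x"
  unfolding A_mat_def r_def[symmetric] by (simp add: matrix_works linear_proj_perp)

lemma transpose_A_mat: "transpose (A_mat \<nu>) = (A_mat \<nu> :: real ^ 'n::{finite,linorder} ^ 'n::{finite,linorder})"
proof -
  have sym: "proj_perp r x \<bullet> y = x \<bullet> proj_perp r y" for x y
    by (simp add: proj_perp_def proj_line_def inner_diff_left inner_diff_right inner_commute)
  have "transpose (A_mat \<nu>) *v x = A_mat \<nu> *v x" for x :: "(real, 'n) vec"
    by (rule vector_eq_rdot[THEN iffD1], rule allI) (simp only: transpose_matrix_vector dot_lmul_matrix A_mat_mult sym)
  then show ?thesis by (simp add: matrix_eq)
qed

text \<open>If \<open>C\<close> is a \<open>Q\<close>-orthonormal basis then \<open>C C^T\<close>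
  inverts \<open>Q\<close>. So the matrix chosen by \<open>matrix_inv\<close> is a true inverse, and
  it comes with a square root.\<close>

lemma Sigma_cov_decomp:
  obtains C :: "real ^ 'n::{finite,linorder} ^ 'n::{finite,linorder}" where "Sigma_cov \<nu> = C ** transpose C" "Sigma_cov \<nu> ** Q = mat 1" "Q ** Sigma_cov \<nu> = mat 1"
proof -
  have pos: "u \<bullet> (Q *v u) > 0" if "u \<noteq> 0" for u
  proof -
    have "0 < u \<bullet> u" using that by simp
    also have "\<dots> \<le> u \<bullet> (Q *v u)" unfolding Q_def by (rule inner_Sigma_inv_ge[OF \<nu>])
    finally show ?thesis .
  qed
  obtain C :: "real ^ 'n::{finite,linorder} ^ 'n::{finite,linorder}" where "transpose C ** Q ** C = mat 1"
    by (rule exists_congruent_identity[OF Q_sym pos])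
  then have "transpose C ** (Q ** C) = mat 1" by (simp only: matrix_mul_assoc)
  then have "(Q ** C) ** transpose C = mat 1" by (rule matrix_left_right_inverse1)
  then have 1: "Q ** (C ** transpose C) = mat 1" by (simp only: matrix_mul_assoc)
  then have 2: "(C ** transpose C) ** Q = mat 1" by (rule matrix_left_right_inverse1)
  have "Sigma_cov \<nu> = C ** transpose C"
  proof -
    have "Q ** Sigma_cov \<nu> = mat 1"
      unfolding Sigma_cov_def Q_def[symmetric] matrix_inv_def by (rule someI2_ex) (use 1 2 in auto)
    then have "C ** transpose C ** Q ** Sigma_cov \<nu> = C ** transpose C"
      by (simp add: matrix_mul_assoc[symmetric])
    then show ?thesis by (simp add: 2)
  qed
  then show thesis using that 1 2 by simp
qed

definition gauss_kernel :: "real \<Rightarrow> (real, 'n) vec \<Rightarrow> ennreal" where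
  "gauss_kernel s x = ennreal (exp (- (x \<bullet> (Q *v x)) / (2 * s)))"

lemma measurable_gauss_kernel [measurable]:
  assumes [measurable]: "f \<in> borel_measurable M" "g \<in> borel_measurable M"
  shows "(\<lambda>p. gauss_kernel (f p) (g p)) \<in> borel_measurable M"
  unfolding gauss_kernel_def by measurable

text \<open>If \<open>B B\<^sup>T = s A \<Sigma> A\<close> then \<open>B\<close> kills a unit vector \<open>w\<close>, and \<open>L z = B z + q (w \<bullet> z) r\<close> with \<open>q\<^sup>2 = s / (2 c)\<close>
  satisfies \<open>L L\<^sup>T = s \<Sigma>\<close> and \<open>p\<^sub>\<bottom> L = B\<close>: the singular normal law is a projection of a regular one.\<close>

lemma normal_distribution_perp:
  assumes s: "s > 0"
  obtains K where
    "\<And>E m. E \<in> sets borel \<Longrightarrow> emeasure (normal_distribution m (s *\<^sub>R (A_mat \<nu> ** Sigma_cov \<nu> ** A_mat \<nu>))) E =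
      K * (\<integral>\<^sup>+x. indicator E (m + proj_perp r x) * gauss_kernel s x \<partial>lborel)"
    and "K * (\<integral>\<^sup>+x. gauss_kernel s x \<partial>lborel) = 1"
proof -
  define S where "S = s *\<^sub>R (A_mat \<nu> ** Sigma_cov \<nu> ** (A_mat \<nu> :: real ^ 'n::{finite,linorder} ^ 'n::{finite,linorder}))"
  obtain C :: "real ^ 'n::{finite,linorder} ^ 'n::{finite,linorder}"
    where C: "Sigma_cov \<nu> = C ** transpose C" "Sigma_cov \<nu> ** Q = mat 1" "Q ** Sigma_cov \<nu> = mat 1"
    by (rule Sigma_cov_decomp)
  \<comment> \<open>Only a witness that the choice in \<open>normal_distribution\<close> has a
    solution; the argument below works for whichever \<open>B\<close> is chosen.\<close>
  define B0 where "B0 = sqrt s *\<^sub>R (A_mat \<nu> ** C)"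
  have "transpose B0 = sqrt s *\<^sub>R (transpose C ** A_mat \<nu>)"
  proof -
    have "transpose (t *\<^sub>R M) = t *\<^sub>R transpose M" for t and M :: "real ^ 'n::{finite,linorder} ^ 'n::{finite,linorder}"
      by (simp add: transpose_def vec_eq_iff)
    then show ?thesis by (simp add: B0_def matrix_transpose_mul transpose_A_mat)
  qed
  then have "B0 *v (transpose B0 *v x) = S *v x" for x
    using s unfolding B0_def S_def C(1)
    by (simp add: scaleR_matrix_vector_assoc[symmetric] matrix_vector_mult_scaleR matrix_vector_mul_assoc[symmetric])
  then have "B0 ** transpose B0 = S" unfolding matrix_eq matrix_vector_mul_assoc[symmetric] by blast
  then have ex: "\<exists>B :: ((real, 'n) vec, 'n) vec. B ** transpose B = S" by blast
  define B where "B = (SOME B :: ((real, 'n) vec, 'n) vec. B ** transpose B = S)"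
  have BB: "B ** transpose B = S" unfolding B_def by (rule someI_ex[OF ex])
  have BT: "(transpose B *v y) \<bullet> z = y \<bullet> (B *v z)" for y z
    by (simp add: transpose_matrix_vector dot_lmul_matrix)
  have Sy: "B *v (transpose B *v y) = s *\<^sub>R proj_perp r (Sigma_cov \<nu> *v proj_perp r y)" for y
    unfolding matrix_vector_mul_assoc BB S_def
    by (simp add: scaleR_matrix_vector_assoc[symmetric] matrix_vector_mul_assoc[symmetric] A_mat_mult)
  \<comment> \<open>\<open>A_mat\<close> kills \<open>r\<close>, so the range of \<open>B\<close> is
    orthogonal to \<open>r\<close>. Hence \<open>B\<close> is not onto, and as a square matrix it
    has a kernel, from which \<open>w\<close> is taken.\<close>
  have "(transpose B *v r) \<bullet> (transpose B *v r) = 0"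
    unfolding BT Sy by (simp add: proj_perp_r linear_0[OF linear_proj_perp])
  then have BTr: "transpose B *v r = 0" by (simp only: inner_eq_zero_iff)
  have rB: "r \<bullet> (B *v z) = 0" for z unfolding BT[symmetric] BTr by simp
  have "\<not> surj ((*v) B)"
  proof
    assume "surj ((*v) B)"
    then obtain z where "B *v z = r" by (metis surjD)
    then show False using rB[of z] rr c_pos by simp
  qed
  then have "\<not> inj ((*v) B)" using linear_injective_imp_surjective[OF matrix_vector_mul_linear] by blast
  then obtain w0 where w0: "B *v w0 = 0" "w0 \<noteq> 0"
    using linear_injective_0[OF matrix_vector_mul_linear, of B] by blast
  define w where "w = (1 / norm w0) *\<^sub>R w0"
  have w: "B *v w = 0" "w \<bullet> w = 1"
    using w0 by (simp_all add: w_def matrix_vector_mult_scaleR dot_square_norm power2_eq_square)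
  define q where "q = sqrt (s / (2 * c))"
  have q: "q * q = s / (2 * c)" using s c_pos by (simp add: q_def)
  define L where "L z = B *v z + (q * (w \<bullet> z)) *\<^sub>R r" for z
  \<comment> \<open>The guess is \<open>L^T Q / s\<close>, the inverse of \<open>L\<close> once
    \<open>L L^T = s Sigma_cov\<close>. It also turns \<open>z \<bullet> z\<close> into the form
    \<open>Q\<close> at \<open>L z\<close>, that is, the standard normal density into
    \<open>gauss_kernel\<close>.\<close>
  define L' where "L' x = (1 / s) *\<^sub>R (transpose B *v (Q *v x) + (q * (r \<bullet> (Q *v x))) *\<^sub>R w)" for x
  have linL: "linear L" "linear L'"
    by (rule linearI; simp add: L_def L'_def matrix_vector_right_distrib matrix_vector_mult_scaleR inner_add_right scaleR_add_left scaleR_add_right algebra_simps)+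
  note transpose_matrix_vector [simp del]
  have LL': "L (L' x) = x" for x
  proof -
    have wB: "w \<bullet> (transpose B *v y) = 0" for y using BT[of y w] w by (simp add: inner_commute)
    have "B *v (transpose B *v (Q *v x)) = s *\<^sub>R proj_perp r x"
      unfolding Sy proj_perp_Q by (simp add: matrix_vector_mul_assoc C(2) proj_perp_r)
    then have "L (L' x) = (1 / s) *\<^sub>R (s *\<^sub>R proj_perp r x + (q * q * (r \<bullet> (Q *v x))) *\<^sub>R r)"
      by (simp add: L_def L'_def matrix_vector_right_distrib matrix_vector_mult_scaleR w wB inner_add_right scaleR_add_right)
    also have "\<dots> = (x \<bullet> r / c) *\<^sub>R r + proj_perp r x"
      using s c_pos by (simp add: q r_Q scaleR_add_right add.commute)
    also have "\<dots> = x" by (rule split_r[symmetric])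
    finally show ?thesis .
  qed
  then have "L \<circ> L' = id" by auto
  then have "L' \<circ> L = id" using linear_inverse_left[OF linL(2) linL(1)] by simp
  then have L'L: "L' (L z) = z" for z by (metis comp_apply id_apply)
  have norm_L: "z \<bullet> z = L z \<bullet> (Q *v L z) / s" for z
  proof -
    have "z \<bullet> z = L' (L z) \<bullet> z" by (simp add: L'L)
    also have "\<dots> = ((Q *v L z) \<bullet> (B *v z) + q * (r \<bullet> (Q *v L z)) * (w \<bullet> z)) / s"
      by (simp add: L'_def inner_add_left BT)
    also have "\<dots> = L z \<bullet> (Q *v L z) / s"
    proof -
      have "L z \<bullet> y = y \<bullet> (B *v z) + q * (r \<bullet> y) * (w \<bullet> z)" for y
        by (simp add: L_def inner_add_left inner_commute[of "B *v z"])
      then show ?thesis by (simp only:)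
    qed
    finally show ?thesis .
  qed
  have perp_L: "proj_perp r (L z) = B *v z" for z
  proof -
    have "(B *v z) \<bullet> r = 0" using rB[of z] by (simp only: inner_commute[of r])
    then have "proj_perp r (B *v z) = B *v z" by (simp add: proj_perp_def proj_line_def)
    then show ?thesis by (simp add: L_def proj_perp_r)
  qed
  obtain k where k: "\<And>h. h \<in> borel_measurable borel \<Longrightarrow> (\<integral>\<^sup>+x. h (L x) \<partial>lborel) = k * (\<integral>\<^sup>+x. h x \<partial>lborel)"
    using exists_nn_integral_linear_scale[OF linL L'L LL'] by blast
  define N0 where "N0 = ennreal ((1 / sqrt (2 * pi)) ^ CARD('n))"
  have main: "emeasure (normal_distribution m S) E =
      k * N0 * (\<integral>\<^sup>+x. indicator E (m + proj_perp r x) * gauss_kernel s x \<partial>lborel)"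
    if [measurable]: "E \<in> sets borel" for E m
  proof -
    have [measurable]: "(\<lambda>z. m + B *v z) -` E \<in> sets borel"
      by (rule measurable_sets_borel[of _ borel]) measurable
    have "emeasure (normal_distribution m S) E = emeasure std_normal_vec ((\<lambda>z. m + B *v z) -` E \<inter> space std_normal_vec)"
      unfolding normal_distribution_def B_def[symmetric] Let_def by (subst emeasure_distr) auto
    also have "\<dots> = (\<integral>\<^sup>+z. N0 * ennreal (exp (- (z \<bullet> z) / 2)) * indicator ((\<lambda>z. m + B *v z) -` E) z \<partial>lborel)"
      unfolding std_normal_vec_eq
      by (subst emeasure_density) (auto simp: N0_def ennreal_mult space_density)
    also have "\<dots> = (\<integral>\<^sup>+z. N0 * (indicator E (m + proj_perp r (L z)) * gauss_kernel s (L z)) \<partial>lborel)"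
      by (intro nn_integral_cong) (simp add: perp_L norm_L gauss_kernel_def mult_ac indicator_def)
    also have "\<dots> = k * (\<integral>\<^sup>+x. N0 * (indicator E (m + proj_perp r x) * gauss_kernel s x) \<partial>lborel)"
      by (rule k) measurable
    also have "\<dots> = k * N0 * (\<integral>\<^sup>+x. indicator E (m + proj_perp r x) * gauss_kernel s x \<partial>lborel)"
      by (subst nn_integral_cmult) (auto simp: mult.assoc)
    finally show ?thesis .
  qed
  show thesis
  proof (rule that[OF main[unfolded S_def]])
    have "emeasure (normal_distribution 0 S) UNIV = 1"
    proof -
        have "space std_normal_vec = (UNIV :: (real, 'n) vec set)" by (simp add: std_normal_vec_def)
      then show ?thesis
        unfolding normal_distribution_def B_def[symmetric] Let_def by (subst emeasure_distr) (auto simp: emeasure_std_normal_vec)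
    qed
    then show "k * N0 * (\<integral>\<^sup>+x. gauss_kernel s x \<partial>lborel) = 1"
      using main[of UNIV 0] by simp
  qed
qed

lemma gauss_kernel_scale:
  assumes t: "t > 0"
  shows "(\<integral>\<^sup>+x. gauss_kernel (t\<^sup>2) x \<partial>lborel) = ennreal (t ^ CARD('n)) * (\<integral>\<^sup>+x. gauss_kernel 1 x \<partial>lborel)"
proof -
  have "(\<integral>\<^sup>+x. gauss_kernel (t\<^sup>2) x \<partial>lborel) = ennreal (t ^ CARD('n)) * (\<integral>\<^sup>+x. gauss_kernel (t\<^sup>2) (0 + t *\<^sub>R x) \<partial>lborel)"
    using t by (subst nn_integral_lborel_affine[of _ t 0]) auto
  moreover have "gauss_kernel (t\<^sup>2) (0 + t *\<^sub>R x) = gauss_kernel 1 x" for x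
    using t by (simp add: gauss_kernel_def matrix_vector_mult_scaleR power2_eq_square)
  ultimately show ?thesis by (simp only:)
qed

text \<open>The constant of each single law depends on its scale. Since every law has mass one,
  scaling of the Gaussian integral shows that it is a power of \<open>t\<close> times a common
  \<open>K\<close>, which can be taken out of the mixture integral.\<close>

lemma normal_distribution_perp_uniform:
  obtains K where
    "\<And>t E. t > 0 \<Longrightarrow> E \<in> sets borel \<Longrightarrow>
      emeasure (normal_distribution (t *\<^sub>R r) (t\<^sup>2 *\<^sub>R (A_mat \<nu> ** Sigma_cov \<nu> ** A_mat \<nu>))) E =
      K * (ennreal (1 / t ^ CARD('n)) * (\<integral>\<^sup>+x. indicator E (t *\<^sub>R r + proj_perp r x) * gauss_kernel (t\<^sup>2) x \<partial>lborel))"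
    and "\<And>t. t > 0 \<Longrightarrow> emeasure (normal_distribution (t *\<^sub>R r) (t\<^sup>2 *\<^sub>R (A_mat \<nu> ** Sigma_cov \<nu> ** A_mat \<nu>))) UNIV = 1"
proof -
  define J where "J = (\<integral>\<^sup>+x. gauss_kernel 1 x \<partial>lborel)"
  obtain K where K: "K * J = 1"
    using normal_distribution_perp[of 1] unfolding J_def by (metis zero_less_one)
  show thesis
  proof (rule that[of K])
    fix t :: real assume t: "t > 0"
    then have "t\<^sup>2 > 0" by simp
    then obtain K' where K': "\<And>E m. E \<in> sets borel \<Longrightarrow> emeasure (normal_distribution m (t\<^sup>2 *\<^sub>R (A_mat \<nu> ** Sigma_cov \<nu> ** A_mat \<nu>))) E =
        K' * (\<integral>\<^sup>+x. indicator E (m + proj_perp r x) * gauss_kernel (t\<^sup>2) x \<partial>lborel)"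
      "K' * (\<integral>\<^sup>+x. gauss_kernel (t\<^sup>2) x \<partial>lborel) = 1"
      by (rule normal_distribution_perp) blast
    show "emeasure (normal_distribution (t *\<^sub>R r) (t\<^sup>2 *\<^sub>R (A_mat \<nu> ** Sigma_cov \<nu> ** A_mat \<nu>))) UNIV = 1"
      using K'(1)[of UNIV "t *\<^sub>R r"] K'(2) by simp
    have "K' = K * ennreal (1 / t ^ CARD('n))"
    proof -
      have 1: "K' * (ennreal (t ^ CARD('n)) * J) = 1"
        using K'(2) unfolding gauss_kernel_scale[OF t] J_def .
      have 2: "ennreal (1 / t ^ CARD('n)) * ennreal (t ^ CARD('n)) = 1"
        using t by (simp add: ennreal_mult[symmetric])
      have "K * ennreal (1 / t ^ CARD('n)) = (K * ennreal (1 / t ^ CARD('n))) * (K' * (ennreal (t ^ CARD('n)) * J))"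
        by (simp add: 1)
      also have "\<dots> = K' * (K * J) * (ennreal (1 / t ^ CARD('n)) * ennreal (t ^ CARD('n)))"
        by (simp only: mult_ac)
      also have "\<dots> = K'" by (simp only: 2 K mult_1_right)
      finally show ?thesis by simp
    qed
    then show "emeasure (normal_distribution (t *\<^sub>R r) (t\<^sup>2 *\<^sub>R (A_mat \<nu> ** Sigma_cov \<nu> ** A_mat \<nu>))) E =
      K * (ennreal (1 / t ^ CARD('n)) * (\<integral>\<^sup>+x. indicator E (t *\<^sub>R r + proj_perp r x) * gauss_kernel (t\<^sup>2) x \<partial>lborel))"
      if "E \<in> sets borel" for E
      using K'(1)[OF that, of "t *\<^sub>R r"] by (simp add: mult.assoc)
  qed
qed

lemma mixture_eq_limit_shape:
  obtains K where
    "\<And>E. E \<in> sets borel \<Longrightarrow>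
      (\<integral>\<^sup>+s\<in>{0<..}. (emeasure (normal_distribution (sqrt s *\<^sub>R r) (s *\<^sub>R (A_mat \<nu> ** Sigma_cov \<nu> ** A_mat \<nu>))) E *
          ennreal (s powr (- 3 / 2) * exp (- 1 / (2 * s)))) \<partial>lborel) =
      K * (\<integral>\<^sup>+x. ennreal (limit_shape \<nu> x) * indicator E x \<partial>lborel)"
proof -
  define n where "n = CARD('n)"
  obtain K where K: "\<And>t E. t > 0 \<Longrightarrow> E \<in> sets borel \<Longrightarrow>
      emeasure (normal_distribution (t *\<^sub>R r) (t\<^sup>2 *\<^sub>R (A_mat \<nu> ** Sigma_cov \<nu> ** A_mat \<nu>))) E =
      K * (ennreal (1 / t ^ n) * (\<integral>\<^sup>+x. indicator E (t *\<^sub>R r + proj_perp r x) * gauss_kernel (t\<^sup>2) x \<partial>lborel))"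
    unfolding n_def by (rule normal_distribution_perp_uniform) blast
  define G where "G = (\<integral>\<^sup>+t. ennreal (exp (- c * t\<^sup>2)) \<partial>lborel)"
  have G: "(\<integral>\<^sup>+t. ennreal (exp (- c * t\<^sup>2 / a\<^sup>2)) \<partial>lborel) = ennreal a * G" if "a > 0" for a :: real
    using that unfolding G_def
    by (subst nn_integral_real_affine[of _ a 0]) (auto simp: power_mult_distrib)
  show thesis
  proof (rule that[of "K * (2 * G)"])
    fix E :: "(real, 'n) vec set" assume [measurable]: "E \<in> sets borel"
    define W where "W s = ennreal (s powr (- 3 / 2) * exp (- 1 / (2 * s)))" for s :: real
    define F where "F s = K * (ennreal (1 / sqrt s ^ n) * (\<integral>\<^sup>+x. indicator E (sqrt s *\<^sub>R r + proj_perp r x) * gauss_kernel s x \<partial>lborel)) * W s" for s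
    \<comment> \<open>The power \<open>n + 2\<close> is made of \<open>t^n\<close> from the
      normalisation of the Gaussian, \<open>t^3\<close> from the weight at \<open>s = t^2\<close>,
      and \<open>t\<close> gained back from the Jacobian \<open>2 t\<close>.\<close>
    define H where "H x t = indicator {0<..} t * indicator E (t *\<^sub>R r + proj_perp r x) *
      ennreal (2 / t ^ (n + 2) * exp (- 1 / (2 * t\<^sup>2)) * exp (- (x \<bullet> (Q *v x)) / (2 * t\<^sup>2)))" for x and t :: real
    have [measurable]: "(\<lambda>s. \<integral>\<^sup>+x. indicator E (sqrt s *\<^sub>R r + proj_perp r x) * gauss_kernel s x \<partial>lborel) \<in> borel_measurable borel"
      by (rule lborel.borel_measurable_nn_integral) measurable
    have F[measurable]: "F \<in> borel_measurable borel" unfolding F_def W_def by measurable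
    have Hm: "case_prod H \<in> borel_measurable borel"
      unfolding H_def borel_prod[symmetric] by measurable
    have "(\<integral>\<^sup>+s\<in>{0<..}. (emeasure (normal_distribution (sqrt s *\<^sub>R r) (s *\<^sub>R (A_mat \<nu> ** Sigma_cov \<nu> ** A_mat \<nu>))) E * W s) \<partial>lborel)
        = (\<integral>\<^sup>+s. F s * indicator {0<..} s \<partial>lborel)"
    proof (rule nn_integral_cong)
      fix s :: real
      show "emeasure (normal_distribution (sqrt s *\<^sub>R r) (s *\<^sub>R (A_mat \<nu> ** Sigma_cov \<nu> ** A_mat \<nu>))) E * W s * indicator {0<..} s = F s * indicator {0<..} s"
        using K[of "sqrt s" E] by (cases "s > 0") (auto simp: F_def)
    qed
    also have "\<dots> = (\<integral>\<^sup>+t. F (t\<^sup>2) * ennreal (2 * t) * indicator {0<..} t \<partial>lborel)"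
    proof (rule nn_integral_substitution_exhaustion[where a = "\<lambda>n. 1 / real (n + 1)" and b = "\<lambda>n. real (n + 2)", OF F])
      have pos: "0 < t" if "1 / (1 + real k) \<le> t" for t k
        by (rule less_le_trans[OF _ that]) simp
      have pos2: "0 < t" if "(1 / (1 + real k))\<^sup>2 \<le> t" for t k
        by (rule less_le_trans[OF _ that]) simp
      have A: "{0<..} = (\<Union>n. {1 / real (n + 1)..real (n + 2)})"
      proof (intro set_eqI iffI)
        fix t :: real assume t: "t \<in> {0<..}"
        obtain k where k: "1 / t < real k" using reals_Archimedean2 by blast
        obtain l where l: "t < real l" using reals_Archimedean2 by blast
        have "1 / real (max k l + 1) \<le> t" "t \<le> real (max k l + 2)"
          using t k l by (auto simp: field_simps max_def intro: order_trans[of _ "t * real k"] split: if_splits)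
            (smt (verit) mult_left_mono of_nat_mono)+
        then show "t \<in> (\<Union>n. {1 / real (n + 1)..real (n + 2)})" by auto
      qed (auto dest: pos)
      show "{0<..} = (\<Union>n. {1 / real (n + 1)..real (n + 2)})" by (rule A)
      show "{0<..} = (\<Union>n. {(1 / real (n + 1))\<^sup>2..(real (n + 2))\<^sup>2})"
      proof (intro set_eqI iffI)
        fix t :: real assume t: "t \<in> {0<..}"
        then have "sqrt t \<in> {0<..}" by simp
        then have "sqrt t \<in> (\<Union>n. {1 / real (n + 1)..real (n + 2)})" unfolding A .
        then obtain k where k: "1 / real (k + 1) \<le> sqrt t" "sqrt t \<le> real (k + 2)" by auto
        then have "(1 / real (k + 1))\<^sup>2 \<le> (sqrt t)\<^sup>2" "(sqrt t)\<^sup>2 \<le> (real (k + 2))\<^sup>2"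
          using t by (auto intro!: power_mono simp del: real_sqrt_pow2 of_nat_add)
        then show "t \<in> (\<Union>n. {(1 / real (n + 1))\<^sup>2..(real (n + 2))\<^sup>2})" using t by auto
      qed (auto dest: pos2 simp del: power_divide)
      show "((\<lambda>t. t\<^sup>2) has_real_derivative 2 * x) (at x)" for x :: real
        by (auto intro!: derivative_eq_intros)
      show "1 / real (k + 1) < real (k + 2)" for k
        by (rule le_less_trans[of _ 1]) auto
      show "decseq (\<lambda>k. 1 / real (k + 1))" "decseq (\<lambda>k. (1 / real (k + 1))\<^sup>2)"
        by (auto simp: decseq_def intro!: divide_left_mono power_mono)
      show "incseq (\<lambda>k. real (k + 2))" "incseq (\<lambda>k. (real (k + 2))\<^sup>2)"
        by (auto simp: incseq_def intro!: power_mono)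
      show "0 \<le> 2 * x" if "x \<in> {1 / real (k + 1)..real (k + 2)}" for x k
        using that pos[of k x] by simp
    qed (auto intro!: continuous_intros)
    also have "\<dots> = (\<integral>\<^sup>+t. K * (\<integral>\<^sup>+x. H x t \<partial>lborel) \<partial>lborel)"
    proof (rule nn_integral_cong)
      fix t :: real
      show "F (t\<^sup>2) * ennreal (2 * t) * indicator {0<..} t = K * (\<integral>\<^sup>+x. H x t \<partial>lborel)"
      proof (cases "t > 0")
        case True
        have pw: "(t\<^sup>2) powr (- 3 / 2) = 1 / t ^ 3"
        proof -
          have "(t\<^sup>2) powr (- 3 / 2) = t powr - 3"
            using True by (simp add: powr_powr flip: powr_numeral)
          then show ?thesis using True by (simp add: powr_minus_divide)
        qed
        have "F (t\<^sup>2) * ennreal (2 * t) = K * ((\<integral>\<^sup>+x. indicator E (t *\<^sub>R r + proj_perp r x) * gauss_kernel (t\<^sup>2) x \<partial>lborel) *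
            (ennreal (1 / t ^ n) * ennreal (1 / t ^ 3 * exp (- 1 / (2 * t\<^sup>2))) * ennreal (2 * t)))"
          using True unfolding F_def W_def pw by (simp add: mult_ac)
        also have "ennreal (1 / t ^ n) * ennreal (1 / t ^ 3 * exp (- 1 / (2 * t\<^sup>2))) * ennreal (2 * t) = ennreal (2 / t ^ (n + 2) * exp (- 1 / (2 * t\<^sup>2)))"
        proof -
          have "1 / t ^ n * (1 / t ^ 3 * e) * (2 * t) = 2 / t ^ (n + 2) * e" for e
            using True by (simp add: power_add power2_eq_square power3_eq_cube mult_ac)
          then show ?thesis using True by (simp add: ennreal_mult[symmetric])
        qed
        also have "(\<integral>\<^sup>+x. indicator E (t *\<^sub>R r + proj_perp r x) * gauss_kernel (t\<^sup>2) x \<partial>lborel) * ennreal (2 / t ^ (n + 2) * exp (- 1 / (2 * t\<^sup>2)))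
          = (\<integral>\<^sup>+x. indicator E (t *\<^sub>R r + proj_perp r x) * gauss_kernel (t\<^sup>2) x * ennreal (2 / t ^ (n + 2) * exp (- 1 / (2 * t\<^sup>2))) \<partial>lborel)"
          by (rule nn_integral_multc[symmetric]) measurable
        also have "\<dots> = (\<integral>\<^sup>+x. H x t \<partial>lborel)"
          using True by (intro nn_integral_cong) (simp add: H_def gauss_kernel_def ennreal_mult[symmetric] mult_ac)
        finally show ?thesis using True by simp
      qed (simp add: H_def)
    qed
    also have "\<dots> = K * (\<integral>\<^sup>+t. \<integral>\<^sup>+x. H x t \<partial>lborel \<partial>lborel)"
      using Hm by (intro nn_integral_cmult lborel.borel_measurable_nn_integral) (simp add: borel_prod[symmetric] H_def)
    also have "(\<integral>\<^sup>+t. \<integral>\<^sup>+x. H x t \<partial>lborel \<partial>lborel) = (\<integral>\<^sup>+x. \<integral>\<^sup>+t. H x t \<partial>lborel \<partial>lborel)"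
      by (rule nn_integral_lborel_swap[OF Hm, symmetric])
    also have "\<dots> = (\<integral>\<^sup>+x. \<integral>\<^sup>+t. H (x + (t - x \<bullet> r / (r \<bullet> r)) *\<^sub>R r) (x \<bullet> r / (r \<bullet> r)) \<partial>lborel \<partial>lborel)"
      by (rule nn_integral_exchange_component[OF Hm r0])
    \<comment> \<open>After the exchange the scale of the Gaussian is the component \<open>a\<close>
      of \<open>x\<close>, and \<open>t\<close> is a free Gaussian variable of width proportional to
      \<open>a\<close>. Integrating it out yields \<open>a * G\<close>, which lowers the power of
      \<open>1 / a\<close> from \<open>n + 2\<close> to \<open>n + 1\<close>.\<close>
    also have "\<dots> = (\<integral>\<^sup>+x. 2 * G * (ennreal (limit_shape \<nu> x) * indicator E x) \<partial>lborel)"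
    proof (rule nn_integral_cong)
      fix x :: "(real, 'n) vec"
      define a where "a = x \<bullet> r / c"
      define u where "u = proj_perp r x"
      have x: "a *\<^sub>R r + u = x" using split_r[of x] by (simp add: a_def u_def)
      show "(\<integral>\<^sup>+t. H (x + (t - x \<bullet> r / (r \<bullet> r)) *\<^sub>R r) (x \<bullet> r / (r \<bullet> r)) \<partial>lborel) = 2 * G * (ennreal (limit_shape \<nu> x) * indicator E x)"
      proof (cases "a > 0")
        case True
        have q: "(x + (t - a) *\<^sub>R r) \<bullet> (Q *v (x + (t - a) *\<^sub>R r)) = 2 * c * t\<^sup>2 + u \<bullet> (Q *v u)" for t
          using quadratic_split[of "x + (t - a) *\<^sub>R r"] c_pos
          by (simp add: proj_perp_r inner_add_left rr add_divide_distrib a_def[symmetric] u_def)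
        have L: "limit_shape \<nu> x = exp (- (1 + u \<bullet> (Q *v u)) / (2 * a\<^sup>2)) / a ^ (n + 1)"
          using True by (simp add: limit_shape_def Let_def a_def u_def r_def c_def Q_def n_def)
        have "H (x + (t - a) *\<^sub>R r) a = indicator E x * ennreal (2 / a * limit_shape \<nu> x) * ennreal (exp (- c * t\<^sup>2 / a\<^sup>2))" for t
        proof -
          have "2 / a ^ (n + 2) * exp (- 1 / (2 * a\<^sup>2)) * exp (- (2 * c * t\<^sup>2 + u \<bullet> (Q *v u)) / (2 * a\<^sup>2))
             = 2 / a * limit_shape \<nu> x * exp (- c * t\<^sup>2 / a\<^sup>2)"
          proof -
            have "- 1 / (2 * a\<^sup>2) + - (2 * c * t\<^sup>2 + u \<bullet> (Q *v u)) / (2 * a\<^sup>2) = - (1 + u \<bullet> (Q *v u)) / (2 * a\<^sup>2) + - c * t\<^sup>2 / a\<^sup>2"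
              using True by (simp add: field_simps)
            then show ?thesis using True by (simp add: L exp_add[symmetric])
          qed
          then show ?thesis
            using True x by (simp add: H_def q proj_perp_r u_def[symmetric] L ennreal_mult[symmetric] mult.assoc)
        qed
        then have "(\<integral>\<^sup>+t. H (x + (t - x \<bullet> r / (r \<bullet> r)) *\<^sub>R r) (x \<bullet> r / (r \<bullet> r)) \<partial>lborel) = indicator E x * ennreal (2 / a * limit_shape \<nu> x) * (ennreal a * G)"
          unfolding rr a_def[symmetric] G[OF True, symmetric] by (simp add: nn_integral_cmult)
        also have "\<dots> = G * indicator E x * (ennreal (2 / a * limit_shape \<nu> x) * ennreal a)" by (simp only: mult_ac)
        also have "ennreal (2 / a * limit_shape \<nu> x) * ennreal a = ennreal (2 * limit_shape \<nu> x)"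
          using True by (simp add: ennreal_mult[symmetric] L)
        also have "\<dots> = 2 * ennreal (limit_shape \<nu> x)"
        proof -
          have "limit_shape \<nu> x \<ge> 0" using True by (simp add: L)
          then show ?thesis by (simp add: ennreal_mult)
        qed
        finally show ?thesis by (simp only: mult_ac)
      next
        case False
        then have "limit_shape \<nu> x = 0" by (simp add: limit_shape_def Let_def a_def r_def c_def)
        then show ?thesis using False by (simp add: H_def rr a_def)
      qed
    qed
    also have "\<dots> = 2 * G * (\<integral>\<^sup>+x. ennreal (limit_shape \<nu> x) * indicator E x \<partial>lborel)"
      by (rule nn_integral_cmult) measurable
    finally show "(\<integral>\<^sup>+s\<in>{0<..}. (emeasure (normal_distribution (sqrt s *\<^sub>R r) (s *\<^sub>R (A_mat \<nu> ** Sigma_cov \<nu> ** A_mat \<nu>))) E *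
          ennreal (s powr (- 3 / 2) * exp (- 1 / (2 * s)))) \<partial>lborel)
       = K * (2 * G) * (\<integral>\<^sup>+x. ennreal (limit_shape \<nu> x) * indicator E x \<partial>lborel)"
      by (simp add: W_def mult.assoc)
  qed
qed

subsection \<open>The rescaled density\<close>

lemma rescale_unscale:
  assumes b: "\<beta> > 0"
  shows "rescale \<nu> \<beta> (unscale \<nu> \<beta> y) = (y :: real ^ 'n::{finite,linorder})"
proof -
  define a where "a = y \<bullet> r / c"
  have "unscale \<nu> \<beta> y \<bullet> r / (r \<bullet> r) = sqrt \<beta> * a"
    using c_pos by (simp add: unscale_def r_def[symmetric] rr a_def inner_add_left field_simps)
  then have "proj_line r (unscale \<nu> \<beta> y) = (sqrt \<beta> * a) *\<^sub>R r" by (simp add: proj_line_def)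
  moreover have "unscale \<nu> \<beta> y = y + ((sqrt \<beta> - 1) * a) *\<^sub>R r" by (simp add: unscale_def r_def[symmetric] rr a_def)
  ultimately show ?thesis
    using b by (simp add: rescale_def proj_perp_def r_def[symmetric] scaleR_left_diff_distrib left_diff_distrib)
qed

lemma unscale_split:
  fixes y :: "real ^ 'n::{finite,linorder}"
  assumes b: "\<beta> > 0"
  defines "z \<equiv> unscale \<nu> \<beta> y" and "a \<equiv> y \<bullet> r / c" and "u \<equiv> proj_perp r y"
  shows "z = (sqrt \<beta> * a) *\<^sub>R r + u" "u \<bullet> r = 0" "z \<bullet> r / (r \<bullet> r) = sqrt \<beta> * a"
    "z \<bullet> z = c * \<beta> * a\<^sup>2 + u \<bullet> u" "y \<bullet> y = c * a\<^sup>2 + u \<bullet> u"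
proof -
  have y: "y = a *\<^sub>R r + u" by (simp add: a_def u_def proj_perp_def proj_line_def rr)
  show ur: "u \<bullet> r = 0" using c_pos by (simp add: u_def proj_perp_def proj_line_def inner_diff_left rr)
  then have ru: "r \<bullet> u = 0" by (simp add: inner_commute)
  have "z = y + ((sqrt \<beta> - 1) * a) *\<^sub>R r" by (simp add: z_def unscale_def r_def[symmetric] rr a_def)
  then show z: "z = (sqrt \<beta> * a) *\<^sub>R r + u" by (subst (asm) y) (simp add: left_diff_distrib scaleR_left_diff_distrib)
  show "z \<bullet> r / (r \<bullet> r) = sqrt \<beta> * a" using c_pos by (simp add: z inner_add_left ur rr)
  show "z \<bullet> z = c * \<beta> * a\<^sup>2 + u \<bullet> u" using b
    by (simp add: z inner_add_left inner_add_right ur ru rr power2_eq_square mult_ac)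
  show "y \<bullet> y = c * a\<^sup>2 + u \<bullet> u"
    by (subst (1 2) y) (simp add: inner_add_left inner_add_right ur ru rr power2_eq_square mult_ac)
qed

lemma pre_shape_nonneg: "0 \<le> pre_shape \<nu> \<beta> (y :: real ^ 'n::{finite,linorder})"
  by (simp add: pre_shape_def Let_def)

lemma pre_shape_eq_0:
  assumes b: "\<beta> > 0" and y: "y \<bullet> r \<le> 0"
  shows "pre_shape \<nu> \<beta> y = 0"
proof (cases "unscale \<nu> \<beta> y \<in> weyl_chamber_B")
  case True
  have "unscale \<nu> \<beta> y \<bullet> r / c \<le> 0"
    using unscale_split(3)[OF b, of y] y c_pos b by (simp add: rr mult_le_0_iff divide_le_0_iff)
  then have "unscale \<nu> \<beta> y \<bullet> r_vec \<nu> \<le> 0" using c_pos by (simp add: r_def divide_le_0_iff)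
  from energy_eq_0[OF \<nu> True this] show ?thesis by (simp add: pre_shape_def Let_def)
qed (simp add: pre_shape_def Let_def)

text \<open>With \<open>P = c \<beta> a^2\<close> and \<open>S = 1 + z \<bullet> z\<close>, the
  bound on \<open>energy\<close> leaves \<open>(S / \<beta>) powr - m * (S / P) powr - k\<close>.
  The first factor is at most \<open>(c a^2) powr - m\<close>. For the second,
  \<open>\<beta> \<ge> 2 m / c\<close> means \<open>k / m \<ge> 1\<close>, so Bernoulli's inequality
  applies, and \<open>\<beta>\<close> cancels in \<open>k / m * (1 + u \<bullet> u) / P\<close>. The
  product is comparable to a Cauchy density in \<open>y\<close>.\<close>

lemma pre_shape_le:
  fixes y :: "real ^ 'n::{finite,linorder}"
  assumes b: "\<beta> > 0" "\<beta> \<ge> 2 * m / c"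
  shows "pre_shape \<nu> \<beta> y \<le> min 1 (c / (2 * m)) powr - m * (1 + y \<bullet> y) powr - m"
proof (cases "y \<bullet> r > 0 \<and> unscale \<nu> \<beta> y \<in> weyl_chamber_B")
  case False
  then have "pre_shape \<nu> \<beta> y = 0"
    using pre_shape_eq_0[OF b(1), of y] by (auto simp: pre_shape_def Let_def)
  then show ?thesis by simp
next
  case True
  define z where "z = unscale \<nu> \<beta> y"
  define a where "a = y \<bullet> r / c"
  define u where "u = proj_perp r y"
  note split = unscale_split[OF b(1), of y, folded z_def a_def u_def]
  have a: "a > 0" using True c_pos by (simp add: a_def)
  have zc: "z \<in> weyl_chamber_B" using True by (simp add: z_def)
  define k where "k = \<beta> * c / 2"
  define P where "P = c * \<beta> * a\<^sup>2"
  define S where "S = 1 + P + u \<bullet> u"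
  have P: "P > 0" using a b c_pos by (simp add: P_def)
  have S: "S > 0" using P by (auto simp: S_def intro!: add_pos_nonneg)
  have "energy \<nu> z \<le> (sqrt \<beta> * a) powr c * energy \<nu> r"
    unfolding r_def c_def
    by (rule energy_le[OF \<nu> zc]) (use split(3) a b in \<open>simp_all add: r_def\<close>)
  then have "energy \<nu> z / energy \<nu> r \<le> (sqrt \<beta> * a) powr c"
    using energy_r_pos[OF \<nu>, where ?'n = 'n] by (simp add: r_def divide_le_eq)
  then have "(energy \<nu> z / energy \<nu> r) powr \<beta> \<le> ((sqrt \<beta> * a) powr c) powr \<beta>"
    using b energy_nonneg[of \<nu> z] energy_nonneg[of \<nu> r] by (intro powr_mono2) auto
  also have "\<dots> = ((sqrt \<beta> * a) powr 2) powr k"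
    by (simp add: powr_powr k_def mult_ac)
  also have "(sqrt \<beta> * a) powr 2 = \<beta> * a\<^sup>2" using a b by (simp add: power_mult_distrib)
  finally have E: "(energy \<nu> z / energy \<nu> r) powr \<beta> \<le> (\<beta> * a\<^sup>2) powr k" .
  have "pre_shape \<nu> \<beta> y = \<beta> powr m * c powr k * S powr - (k + m) * (energy \<nu> z / energy \<nu> r) powr \<beta>"
    using zc by (simp add: pre_shape_def Let_def z_def[symmetric] c_def[symmetric] m_def[symmetric] r_def[symmetric] k_def[symmetric] split(4) S_def P_def add.assoc)
  also have "\<dots> \<le> \<beta> powr m * c powr k * S powr - (k + m) * (\<beta> * a\<^sup>2) powr k"
    using E by (intro mult_left_mono) auto
  also have "\<dots> = (S / \<beta>) powr - m * (S / P) powr - k"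
  proof -
    have "P powr k = c powr k * (\<beta> * a\<^sup>2) powr k"
      using b c_pos by (simp add: P_def powr_mult mult.assoc)
    moreover have "S powr - (k + m) = S powr - k * S powr - m" using S by (simp add: powr_add[symmetric])
    moreover have "(S / P) powr - k = S powr - k * P powr k" "(S / \<beta>) powr - m = S powr - m * \<beta> powr m"
      using S P b by (simp_all add: powr_divide powr_minus field_simps)
    ultimately show ?thesis by (simp only: mult_ac)
  qed
  also have "\<dots> \<le> (c * a\<^sup>2) powr - m * (1 + (1 + u \<bullet> u) / (2 * m * a\<^sup>2)) powr - m"
  proof (intro mult_mono)
    have "c * a\<^sup>2 \<le> S / \<beta>" using b by (simp add: S_def P_def pos_le_divide_eq mult_ac)
    then show "(S / \<beta>) powr - m \<le> (c * a\<^sup>2) powr - m"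
      using m_pos c_pos a by (intro powr_mono2') auto
    define w where "w = (1 + u \<bullet> u) / P"
    have w: "w \<ge> 0" using P by (simp add: w_def)
    have SP: "S / P = 1 + w" using P by (simp add: S_def w_def field_simps)
    have km: "k / m \<ge> 1" using b m_pos c_pos by (simp add: k_def field_simps)
    have "1 + (1 + u \<bullet> u) / (2 * m * a\<^sup>2) = 1 + k / m * w"
      using b c_pos m_pos a by (simp add: w_def P_def k_def)
    also have "\<dots> \<le> (1 + w) powr (k / m)" by (rule Bernoulli_powr[OF w km])
    finally have "((1 + w) powr (k / m)) powr - m \<le> (1 + (1 + u \<bullet> u) / (2 * m * a\<^sup>2)) powr - m"
      using m_pos a by (intro powr_mono2') (auto intro!: add_pos_nonneg divide_nonneg_nonneg)
    then show "(S / P) powr - k \<le> (1 + (1 + u \<bullet> u) / (2 * m * a\<^sup>2)) powr - m"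
      using m_pos by (simp add: powr_powr SP)
  qed auto
  also have "\<dots> = (c * a\<^sup>2 * (1 + (1 + u \<bullet> u) / (2 * m * a\<^sup>2))) powr - m"
    using a c_pos m_pos by (simp add: powr_mult)
  also have "c * a\<^sup>2 * (1 + (1 + u \<bullet> u) / (2 * m * a\<^sup>2)) = c * a\<^sup>2 + c / (2 * m) * (1 + u \<bullet> u)"
    using a m_pos by (simp add: field_simps)
  also have "(c * a\<^sup>2 + c / (2 * m) * (1 + u \<bullet> u)) powr - m \<le> (min 1 (c / (2 * m)) * (1 + y \<bullet> y)) powr - m"
  proof (rule powr_mono2')
    define q where "q = min 1 (c / (2 * m))"
    have q: "q > 0" "q \<le> 1" "q \<le> c / (2 * m)" using c_pos m_pos by (auto simp: q_def)
    have "q * (1 + y \<bullet> y) = q * (c * a\<^sup>2) + q * (1 + u \<bullet> u)"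
      by (simp add: split(5) algebra_simps)
    also have "\<dots> \<le> 1 * (c * a\<^sup>2) + c / (2 * m) * (1 + u \<bullet> u)"
      using q c_pos by (intro add_mono mult_right_mono) auto
    finally show "min 1 (c / (2 * m)) * (1 + y \<bullet> y) \<le> c * a\<^sup>2 + c / (2 * m) * (1 + u \<bullet> u)" by (simp add: q_def)
    show "0 < min 1 (c / (2 * m)) * (1 + y \<bullet> y)"
      using q by (auto simp: q_def[symmetric] intro!: mult_pos_pos add_pos_nonneg)
  qed (use m_pos in simp)
  also have "\<dots> = min 1 (c / (2 * m)) powr - m * (1 + y \<bullet> y) powr - m"
    by (rule powr_mult)
  finally show ?thesis .
qed

text \<open>By homogeneity \<open>z = sqrt \<beta> a (r + h / sqrt \<beta>)\<close> with
  \<open>h = u / a\<close> reduces \<open>energy\<close> to the expansion at \<open>r\<close>. Three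
  factors remain, each with its own limit: a fixed power, the limit of
  \<open>(1 + q / \<beta>) powr - k\<close>, and the Hessian factor.\<close>

lemma pre_shape_tendsto:
  fixes y :: "real ^ 'n::{finite,linorder}"
  shows "((\<lambda>\<beta>. pre_shape \<nu> \<beta> y) \<longlongrightarrow> c powr - m * limit_shape \<nu> y) at_top"
proof (cases "y \<bullet> r > 0")
  case False
  have "eventually (\<lambda>\<beta>. pre_shape \<nu> \<beta> y = 0) at_top"
    using eventually_gt_at_top[of 0] by eventually_elim (rule pre_shape_eq_0, use False in auto)
  moreover have "limit_shape \<nu> y = 0"
    using False c_pos by (simp add: limit_shape_def Let_def r_def c_def zero_less_divide_iff)
  ultimately show ?thesis by (simp add: tendsto_eventually)
next
  case True
  define a where "a = y \<bullet> r / c"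
  define u where "u = proj_perp r y"
  have a: "a > 0" using True c_pos by (simp add: a_def)
  have ur: "u \<bullet> r = 0" unfolding u_def by (rule unscale_split(2)[of 1]) simp
  define h where "h = (1 / a) *\<^sub>R u"
  have hr: "h \<bullet> r_vec \<nu> = 0" using ur by (simp add: h_def r_def)
  define q where "q = (1 + u \<bullet> u) / (c * a\<^sup>2)"
  have q: "q > 0" using a c_pos by (auto simp: q_def intro!: divide_pos_pos add_pos_nonneg)
  define e where "e = (h \<bullet> (Sigma_inv \<nu> *v h) - h \<bullet> h) / 2"
  have ev: "eventually (\<lambda>\<beta>. \<forall>k. (r + (1 / sqrt \<beta>) *\<^sub>R h) \<bullet> root_B k > 0) at_top"
    unfolding r_def by (rule energy_powr_tendsto(1)[OF \<nu> hr])
  have l1: "((\<lambda>\<beta>. (energy \<nu> (r + (1 / sqrt \<beta>) *\<^sub>R h) / energy \<nu> r) powr \<beta>) \<longlongrightarrow> exp (- e)) at_top"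
    unfolding r_def e_def by (rule energy_powr_tendsto(2)[OF \<nu> hr])
  have l2: "((\<lambda>\<beta>. (c * a\<^sup>2 + (1 + u \<bullet> u) / \<beta>) powr - m) \<longlongrightarrow> (c * a\<^sup>2 + 0) powr - m) at_top"
  proof (intro tendsto_intros)
    show "((\<lambda>\<beta>. (1 + u \<bullet> u) / \<beta>) \<longlongrightarrow> 0) at_top" by real_asymp
  qed (use a c_pos in auto)
  have "((\<lambda>\<beta>. \<beta> * c / 2 * ln (1 + q / \<beta>)) \<longlongrightarrow> c * q / 2) at_top"
    using q c_pos by real_asymp
  then have l3: "((\<lambda>\<beta>. exp (- (\<beta> * c / 2 * ln (1 + q / \<beta>)))) \<longlongrightarrow> exp (- (c * q / 2))) at_top"
    by (intro tendsto_intros)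
  have "((\<lambda>\<beta>. (c * a\<^sup>2 + (1 + u \<bullet> u) / \<beta>) powr - m * exp (- (\<beta> * c / 2 * ln (1 + q / \<beta>))) *
      (energy \<nu> (r + (1 / sqrt \<beta>) *\<^sub>R h) / energy \<nu> r) powr \<beta>) \<longlongrightarrow> (c * a\<^sup>2 + 0) powr - m * exp (- (c * q / 2)) * exp (- e)) at_top"
    by (intro tendsto_mult l1 l2 l3)
  also have "(c * a\<^sup>2 + 0) powr - m * exp (- (c * q / 2)) * exp (- e) = c powr - m * limit_shape \<nu> y"
  proof -
    have "(c * a\<^sup>2 + 0) powr - m = c powr - m * (a\<^sup>2) powr - m" by (simp add: powr_mult)
    moreover have "(a\<^sup>2) powr - m = 1 / a ^ (CARD('n) + 1)"
    proof -
      have "(a\<^sup>2) powr - m = a powr - real (CARD('n) + 1)"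
      proof -
        have "(a\<^sup>2) powr - m = a powr (2 * - m)"
          using a by (simp add: powr_powr flip: powr_numeral)
        also have "2 * - m = - real (CARD('n) + 1)" by (simp add: m_def field_simps)
        finally show ?thesis .
      qed
      then show ?thesis using a by (simp only: powr_minus powr_realpow) (simp add: inverse_eq_divide)
    qed
    \<comment> \<open>The term \<open>u \<bullet> u\<close> from \<open>1 + z \<bullet> z\<close>
      cancels the \<open>h \<bullet> h\<close> by which the Hessian form differs from
      \<open>Sigma_inv\<close>.\<close>
    moreover have "- (c * q / 2) + - e = - (1 + u \<bullet> (Sigma_inv \<nu> *v u)) / (2 * a\<^sup>2)"
    proof -
      have "h \<bullet> (Sigma_inv \<nu> *v h) = (u \<bullet> (Sigma_inv \<nu> *v u)) / a\<^sup>2" "h \<bullet> h = (u \<bullet> u) / a\<^sup>2"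
        by (simp_all add: h_def matrix_vector_mult_scaleR power2_eq_square)
      moreover have "c * q = (1 + u \<bullet> u) / a\<^sup>2" using c_pos by (simp add: q_def)
      ultimately show ?thesis by (simp add: e_def add_divide_distrib diff_divide_distrib)
    qed
    moreover have "limit_shape \<nu> y = exp (- (1 + u \<bullet> (Sigma_inv \<nu> *v u)) / (2 * a\<^sup>2)) / a ^ (CARD('n) + 1)"
      using a by (simp add: limit_shape_def Let_def a_def u_def r_def c_def)
    ultimately show ?thesis by (simp add: mult.assoc exp_add[symmetric])
  qed
  finally show ?thesis
  proof (rule Lim_transform_eventually)
    show "eventually (\<lambda>\<beta>. (c * a\<^sup>2 + (1 + u \<bullet> u) / \<beta>) powr - m * exp (- (\<beta> * c / 2 * ln (1 + q / \<beta>))) *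
      (energy \<nu> (r + (1 / sqrt \<beta>) *\<^sub>R h) / energy \<nu> r) powr \<beta> = pre_shape \<nu> \<beta> y) at_top"
      using ev eventually_gt_at_top[of 0]
    proof eventually_elim
      case (elim \<beta>)
      note split = unscale_split[OF elim(2), of y, folded a_def u_def]
      define z where "z = unscale \<nu> \<beta> y"
      define x where "x = r + (1 / sqrt \<beta>) *\<^sub>R h"
      define t where "t = sqrt \<beta> * a"
      have t: "t > 0" using elim a by (simp add: t_def)
      have z: "z = t *\<^sub>R x"
        using elim a by (simp add: z_def split(1) x_def t_def h_def scaleR_add_right)
      have zc: "z \<in> weyl_chamber_B"
        unfolding z weyl_chamber_B_iff using elim(1) t by (auto simp: x_def intro!: mult_nonneg_nonneg less_imp_le)
      have Ez: "energy \<nu> z / energy \<nu> r = t powr c * (energy \<nu> x / energy \<nu> r)"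
        unfolding z energy_scale[OF t] by (simp add: c_def)
      define k where "k = \<beta> * c / 2"
      have "(t powr c) powr \<beta> = (t powr 2) powr k" by (simp add: powr_powr k_def mult_ac)
      also have "t powr 2 = \<beta> * a\<^sup>2" using t elim by (simp add: t_def power_mult_distrib)
      finally have tk: "(t powr c) powr \<beta> = (\<beta> * a\<^sup>2) powr k" .
      define P where "P = c * \<beta> * a\<^sup>2"
      define S where "S = 1 + P + u \<bullet> u"
      have P: "P > 0" using a elim c_pos by (simp add: P_def)
      have S: "S > 0" using P by (auto simp: S_def intro!: add_pos_nonneg)
      have "pre_shape \<nu> \<beta> y = \<beta> powr m * c powr k * S powr - (k + m) * (energy \<nu> z / energy \<nu> r) powr \<beta>"
        using zc by (simp add: pre_shape_def Let_def c_def[symmetric] m_def[symmetric] r_def[symmetric] k_def[symmetric] split(4) S_def P_def add.assoc z_def)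
      also have "\<dots> = \<beta> powr m * c powr k * S powr - (k + m) * ((\<beta> * a\<^sup>2) powr k * (energy \<nu> x / energy \<nu> r) powr \<beta>)"
        unfolding Ez powr_mult tk ..
      also have "\<dots> = (S / \<beta>) powr - m * (S / P) powr - k * (energy \<nu> x / energy \<nu> r) powr \<beta>"
      proof -
        have "P powr k = c powr k * (\<beta> * a\<^sup>2) powr k"
          using elim c_pos by (simp add: P_def powr_mult mult.assoc)
        moreover have "S powr - (k + m) = S powr - k * S powr - m" using S by (simp add: powr_add[symmetric])
        moreover have "(S / P) powr - k = S powr - k * P powr k" "(S / \<beta>) powr - m = S powr - m * \<beta> powr m"
          using S P elim by (simp_all add: powr_divide powr_minus field_simps)
        ultimately show ?thesis by (simp only: mult_ac)
      qed
      also have "S / \<beta> = c * a\<^sup>2 + (1 + u \<bullet> u) / \<beta>" using elim by (simp add: S_def P_def field_simps)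
      also have "S / P = 1 + q / \<beta>" using elim P a c_pos by (simp add: S_def P_def q_def field_simps)
      also have "(1 + q / \<beta>) powr - k = exp (- (\<beta> * c / 2 * ln (1 + q / \<beta>)))"
      proof -
        have "1 + q / \<beta> > 0" using q elim by (auto intro: add_pos_pos)
        then show ?thesis by (simp add: powr_def k_def)
      qed
      finally show ?case by (simp add: x_def)
    qed
  qed
qed

end

section \<open>Asymptotics of the normalising constant\<close>

lemma C_B_nonneg: "\<nu> > 0 \<Longrightarrow> \<beta> > 0 \<Longrightarrow> n > 0 \<Longrightarrow> C_B \<nu> \<beta> n \<ge> 0"
  unfolding C_B_def tau_exponent_eq
  by (intro mult_nonneg_nonneg divide_nonneg_nonneg prod_nonneg less_imp_le[OF Gamma_real_pos] ballI)
     (auto intro!: add_pos_pos add_nonneg_pos mult_nonneg_nonneg divide_nonneg_nonneg less_imp_le[OF limit_const_pos])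

text \<open>\<open>D_const\<close> without its factor \<open>exp (limit_const n \<nu>)\<close>: that
  factor only offsets the contribution of the component along \<open>r\<close> to the quadratic
  form.\<close>

definition limit_norm :: "nat \<Rightarrow> real \<Rightarrow> real" where
  "limit_norm n \<nu> = sqrt 2 * sqrt (fact n) * limit_const n \<nu> powr (real n / 2) / pi powr (real n / 2)"

text \<open>Each Gamma value is its Stirling main term \<open>exp l\<close> times a ratio
  \<open>\<rho>\<close> tending to \<open>sqrt (2 * pi)\<close>. In the sum of the exponents the
  terms in \<open>\<beta> ln \<beta>\<close> and in \<open>ln \<beta>\<close> cancel; what is left
  is a constant \<open>s\<close> and a linear term, whose coefficient \<open>b\<close> contains the
  logarithm of \<open>energy\<close> at \<open>r\<close>.\<close>

lemma norm_const_asymp: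
  assumes \<nu>: "\<nu> > 0"
  obtains b where "((\<lambda>\<beta>. norm_const TYPE('n::{finite,linorder}) \<nu> \<beta> * exp (- (b * \<beta>))) \<longlongrightarrow> limit_norm CARD('n) \<nu>) at_top"
proof -
  define n where "n = CARD('n)"
  have n: "n > 0" by (simp add: n_def)
  define c where "c = limit_const n \<nu>"
  have c: "c > 0" using limit_const_pos[OF \<nu> n] by (simp add: c_def)
  define M where "M = c / 2"
  have M: "M > 0" using c by (simp add: M_def)
  define e where "e = energy \<nu> (r_vec \<nu> :: (real, 'n) vec)"
  have e: "e > 0" unfolding e_def by (rule energy_r_pos[OF \<nu>])
  define B where "B j = real j + \<nu> - 1" for j
  have B: "B j > 0" if "j \<in> {1..n}" for j using that \<nu> by (auto simp: B_def)
  define l where "l a b \<beta> = (b * \<beta> + a - 1 / 2) * (ln b + ln \<beta>) - b * \<beta>" for a b \<beta> :: real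
  define \<rho> where "\<rho> a b \<beta> = Gamma (a + b * \<beta>) / ((b * \<beta>) powr (b * \<beta> + a - 1 / 2) * exp (- (b * \<beta>)))" for a b \<beta> :: real
  have \<rho>: "((\<lambda>\<beta>. \<rho> a b \<beta>) \<longlongrightarrow> sqrt (2 * pi)) at_top" if "b > 0" for a b
    unfolding \<rho>_def by (rule Gamma_Stirling_linear[OF that])
  have Gam: "Gamma (a + b * \<beta>) = \<rho> a b \<beta> * exp (l a b \<beta>)" if "b > 0" "\<beta> > 0" for a b \<beta>
  proof -
    have "(b * \<beta>) powr (b * \<beta> + a - 1 / 2) * exp (- (b * \<beta>)) = exp (l a b \<beta>)"
    proof -
      have "ln (b * \<beta>) = ln b + ln \<beta>" using that by (simp add: ln_mult)
      moreover have "(b * \<beta>) powr q = exp (q * ln (b * \<beta>))" for q using that by (simp add: powr_def)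
      ultimately show ?thesis by (simp only: l_def exp_diff exp_minus divide_inverse)
    qed
    then show ?thesis by (simp add: \<rho>_def)
  qed
  define T where "T j = - 1 - real j * ln (real j) + real j - B j * ln (B j) + B j" for j
  define b where "b = M * ln M - M + (\<Sum>j=1..n. T j) - M * ln c + ln e"
  define s where "s = real n / 2 * ln M - (\<Sum>j=1..n. ln (real j)) / 2"
  \<comment> \<open>The coefficient of \<open>\<beta> ln \<beta>\<close> from the product; it
    offsets the one from the single Gamma value in the numerator of \<open>C_B\<close>.\<close>
  have sumB: "(\<Sum>j=1..n. 1 - real j - B j) = - M"
  proof -
    have "(\<Sum>j=1..k. 1 - real j - B j) = - (real k * (real k + \<nu> - 1))" for k
      by (induction k) (simp_all add: B_def algebra_simps)
    then show ?thesis by (simp add: M_def c_def limit_const_def)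
  qed
  define pre where "pre \<beta> = fact n * 2 ^ n / sqrt pi * \<rho> ((real n + 1) / 2) M \<beta> *
    (\<Prod>j=1..n. \<rho> 1 1 \<beta> / (\<rho> 1 (real j) \<beta> * \<rho> (1 / 2) (B j) \<beta>))" for \<beta>
  have eq: "norm_const TYPE('n) \<nu> \<beta> = pre \<beta> * exp s * exp (b * \<beta>)" if \<beta>: "\<beta> > 0" for \<beta>
  proof -
    have "C_B \<nu> \<beta> n = fact n * 2 ^ n * Gamma ((real n + 1) / 2 + M * \<beta>) / sqrt pi *
       (\<Prod>j = 1..n. Gamma (1 + 1 * \<beta>) / (Gamma (1 + real j * \<beta>) * Gamma (1 / 2 + B j * \<beta>)))"
    proof -
      have "tau_exponent n \<nu> \<beta> = (real n + 1) / 2 + M * \<beta>" by (simp add: tau_exponent_eq M_def c_def)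
      then show ?thesis by (simp add: C_B_def B_def mult.commute)
    qed
    also have "Gamma ((real n + 1) / 2 + M * \<beta>) = \<rho> ((real n + 1) / 2) M \<beta> * exp (l ((real n + 1) / 2) M \<beta>)"
      by (rule Gam[OF M \<beta>])
    also have "(\<Prod>j = 1..n. Gamma (1 + 1 * \<beta>) / (Gamma (1 + real j * \<beta>) * Gamma (1 / 2 + B j * \<beta>)))
      = (\<Prod>j = 1..n. \<rho> 1 1 \<beta> / (\<rho> 1 (real j) \<beta> * \<rho> (1 / 2) (B j) \<beta>) * exp (l 1 1 \<beta> - l 1 (real j) \<beta> - l (1 / 2) (B j) \<beta>))"
    proof (rule prod.cong[OF refl])
      fix j assume j: "j \<in> {1..n}"
      then have "real j > 0" by simp
      then show "Gamma (1 + 1 * \<beta>) / (Gamma (1 + real j * \<beta>) * Gamma (1 / 2 + B j * \<beta>))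
        = \<rho> 1 1 \<beta> / (\<rho> 1 (real j) \<beta> * \<rho> (1 / 2) (B j) \<beta>) * exp (l 1 1 \<beta> - l 1 (real j) \<beta> - l (1 / 2) (B j) \<beta>)"
        unfolding Gam[OF zero_less_one \<beta>] Gam[OF \<open>real j > 0\<close> \<beta>] Gam[OF B[OF j] \<beta>]
        by (simp add: exp_diff)
    qed
    also have "\<dots> = (\<Prod>j = 1..n. \<rho> 1 1 \<beta> / (\<rho> 1 (real j) \<beta> * \<rho> (1 / 2) (B j) \<beta>)) * exp (\<Sum>j=1..n. l 1 1 \<beta> - l 1 (real j) \<beta> - l (1 / 2) (B j) \<beta>)"
      by (simp only: prod.distrib exp_sum[OF finite_atLeastAtMost])
    finally have C: "C_B \<nu> \<beta> n = pre \<beta> * (exp (l ((real n + 1) / 2) M \<beta>) * exp (\<Sum>j=1..n. l 1 1 \<beta> - l 1 (real j) \<beta> - l (1 / 2) (B j) \<beta>))"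
      by (simp add: pre_def)
    have "norm_const TYPE('n) \<nu> \<beta> = C_B \<nu> \<beta> n * exp (- (real n / 2) * ln \<beta>) * exp (- (M * \<beta>) * ln c) * exp (\<beta> * ln e)"
      using \<beta> c e by (simp add: norm_const_def n_def[symmetric] c_def[symmetric] e_def[symmetric] powr_def M_def mult.commute)
    also have "\<dots> = pre \<beta> * exp (l ((real n + 1) / 2) M \<beta> + (\<Sum>j=1..n. l 1 1 \<beta> - l 1 (real j) \<beta> - l (1 / 2) (B j) \<beta>)
       + - (real n / 2) * ln \<beta> + - (M * \<beta>) * ln c + \<beta> * ln e)"
      unfolding C by (simp only: exp_add mult.assoc)
    also have "l ((real n + 1) / 2) M \<beta> + (\<Sum>j=1..n. l 1 1 \<beta> - l 1 (real j) \<beta> - l (1 / 2) (B j) \<beta>)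
       + - (real n / 2) * ln \<beta> + - (M * \<beta>) * ln c + \<beta> * ln e = s + b * \<beta>"
    proof -
      define x where "x = ln \<beta>"
      define y where "y = ln M"
      have "(\<Sum>j=1..n. l 1 1 \<beta> - l 1 (real j) \<beta> - l (1 / 2) (B j) \<beta>)
        = (\<Sum>j=1..n. (1 - real j - B j) * (\<beta> * x) + T j * \<beta> - ln (real j) / 2)"
        by (intro sum.cong refl) (simp add: l_def T_def x_def field_simps)
      also have "\<dots> = - M * (\<beta> * x) + (\<Sum>j=1..n. T j) * \<beta> - (\<Sum>j=1..n. ln (real j)) / 2"
      proof -
        have "(\<Sum>j=1..n. f j * u + g j * v - h j / 2) = (\<Sum>j=1..n. f j) * u + (\<Sum>j=1..n. g j) * v - (\<Sum>j=1..n. h j) / 2"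
          for f g h :: "nat \<Rightarrow> real" and u v
          by (simp add: sum.distrib sum_subtractf sum_distrib_right sum_divide_distrib)
        then show ?thesis by (simp only: sumB)
      qed
      finally have 1: "(\<Sum>j=1..n. l 1 1 \<beta> - l 1 (real j) \<beta> - l (1 / 2) (B j) \<beta>)
        = - M * (\<beta> * x) + (\<Sum>j=1..n. T j) * \<beta> - (\<Sum>j=1..n. ln (real j)) / 2" .
      have 2: "l ((real n + 1) / 2) M \<beta> = (M * \<beta> + real n / 2) * (y + x) - M * \<beta>"
        by (simp add: l_def x_def y_def field_simps)
      show ?thesis
        unfolding 1 2 s_def b_def x_def[symmetric] y_def[symmetric]
        by (simp add: algebra_simps)
    qed
    finally show ?thesis by (simp add: exp_add)
  qed
  have "((\<lambda>\<beta>. pre \<beta> * exp s) \<longlongrightarrow> fact n * 2 ^ n / sqrt pi * sqrt (2 * pi) *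
      (\<Prod>j=1..n. sqrt (2 * pi) / (sqrt (2 * pi) * sqrt (2 * pi))) * exp s) at_top"
    unfolding pre_def
  proof (intro tendsto_mult tendsto_const tendsto_prod tendsto_divide \<rho> M)
    fix j assume "j \<in> {1..n}"
    then show "0 < real j" "0 < B j" by (auto simp: B)
  qed auto
  also have "fact n * 2 ^ n / sqrt pi * sqrt (2 * pi) *
      (\<Prod>j=1..n. sqrt (2 * pi) / (sqrt (2 * pi) * sqrt (2 * pi))) * exp s = limit_norm n \<nu>"
  proof -
    have "(\<Sum>j=1..n. ln (real j)) = ln (fact n)"
      unfolding fact_prod of_nat_prod by (subst ln_prod) auto
    then have "exp s = exp (real n / 2 * ln M) / exp (ln (fact n) / 2)" by (simp add: s_def exp_diff)
    moreover have "exp (real n / 2 * ln M) = M powr (real n / 2)" using M by (simp add: powr_def)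
    moreover have "exp (ln (fact n) / 2) = sqrt (fact n :: real)"
      by (simp add: powr_half_sqrt[symmetric] powr_def)
    ultimately have s: "exp s = M powr (real n / 2) / sqrt (fact n)" by simp
    have "(\<Prod>j=1..n. sqrt (2 * pi) / (sqrt (2 * pi) * sqrt (2 * pi))) = 1 / sqrt (2 * pi) ^ n"
    proof -
      have "sqrt (2 * pi) / (sqrt (2 * pi) * sqrt (2 * pi)) = 1 / sqrt (2 * pi)"
        by (rule nonzero_divide_mult_cancel_left) simp
      then show ?thesis by (simp only: prod_constant card_atLeastAtMost) (simp add: power_one_over)
    qed
    also have "sqrt (2 * pi) ^ n = (2 * pi) powr (real n / 2)"
      by (simp add: powr_half_sqrt[symmetric] powr_power)
    also have "\<dots> = 2 powr (real n / 2) * pi powr (real n / 2)" by (rule powr_mult)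
    finally have p: "(\<Prod>j=1..n. sqrt (2 * pi) / (sqrt (2 * pi) * sqrt (2 * pi))) = 1 / (2 powr (real n / 2) * pi powr (real n / 2))" .
    have M2: "M powr (real n / 2) = c powr (real n / 2) / 2 powr (real n / 2)"
      unfolding M_def by (rule powr_divide)
    have t: "(2::real) ^ n = 2 powr (real n / 2) * 2 powr (real n / 2)"
      by (simp add: powr_add[symmetric] powr_realpow)
    define F where "F = sqrt (fact n :: real)"
    have F: "F > 0" "(fact n :: real) = F * F" by (simp_all add: F_def)
    have "fact n * 2 ^ n / sqrt pi * sqrt (2 * pi) * (1 / (2 powr (real n / 2) * pi powr (real n / 2))) * (c powr (real n / 2) / 2 powr (real n / 2) / sqrt (fact n))
       = limit_norm n \<nu>"
      unfolding t limit_norm_def c_def[symmetric] F_def[symmetric] F(2)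
      using F(1) by (simp add: real_sqrt_mult)
    then show ?thesis unfolding p s M2 .
  qed
  finally have "((\<lambda>\<beta>. pre \<beta> * exp s) \<longlongrightarrow> limit_norm n \<nu>) at_top" .
  then have "((\<lambda>\<beta>. norm_const TYPE('n) \<nu> \<beta> * exp (- (b * \<beta>))) \<longlongrightarrow> limit_norm n \<nu>) at_top"
  proof (rule Lim_transform_eventually)
    show "eventually (\<lambda>\<beta>. pre \<beta> * exp s = norm_const TYPE('n) \<nu> \<beta> * exp (- (b * \<beta>))) at_top"
      using eventually_gt_at_top[of 0] by eventually_elim (simp add: eq exp_minus)
  qed
  then show thesis by (intro that) (simp add: n_def)
qed

section \<open>The law of the rescaled variable and the limit of its total mass\<close>

lemma measurable_tau_density [measurable]: "(tau_density \<nu> \<beta> :: real ^ 'n::{finite,linorder} \<Rightarrow> real) \<in> borel_measurable borel"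
  unfolding tau_density_def case_prod_beta by measurable

lemma weyl_chamber_B_borel [measurable]: "(weyl_chamber_B :: (real, 'n::{finite,linorder}) vec set) \<in> sets borel"
  by (intro borel_closed closed_weyl_chamber_B)

lemma measurable_rescale [measurable]: "(rescale \<nu> \<beta> :: real ^ 'n::{finite,linorder} \<Rightarrow> _) \<in> borel_measurable borel"
  unfolding rescale_def proj_perp_def proj_line_def by measurable

lemma measurable_unscale [measurable]: "(unscale \<nu> \<beta> :: real ^ 'n::{finite,linorder} \<Rightarrow> _) \<in> borel_measurable borel"
  unfolding unscale_def by measurable

lemma measurable_energy [measurable]: "(energy \<nu> :: real ^ 'n::{finite,linorder} \<Rightarrow> _) \<in> borel_measurable borel"
  unfolding energy_def by measurable

lemma measurable_pre_shape [measurable]: "(pre_shape \<nu> \<beta> :: real ^ 'n::{finite,linorder} \<Rightarrow> _) \<in> borel_measurable borel"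
  unfolding pre_shape_def Let_def by measurable

lemma distr_tau_rescale:
  assumes \<nu>: "\<nu> > 0" and \<beta>: "\<beta> > 0"
  shows "distr (tau \<nu> \<beta>) borel (rescale \<nu> \<beta>) =
    density lborel (\<lambda>y :: real ^ 'n::{finite,linorder}. ennreal (norm_const TYPE('n) \<nu> \<beta> * pre_shape \<nu> \<beta> y))"
proof (rule measure_eqI)
  fix E assume "E \<in> sets (distr (tau \<nu> \<beta> :: (real, 'n) vec measure) borel (rescale \<nu> \<beta>))"
  then have [measurable]: "E \<in> sets borel" by simp
  define r where "r = (r_vec \<nu> :: (real, 'n) vec)"
  define c where "c = limit_const CARD('n) \<nu>"
  define m where "m = (real CARD('n) + 1) / 2"
  have c: "c > 0" using limit_const_pos[OF \<nu>, of "CARD('n)"] by (simp add: c_def)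
  have er: "energy \<nu> r > 0" using energy_r_pos[OF \<nu>] by (simp add: r_def)
  have r0: "r \<noteq> 0" using r_vec_nonzero[OF \<nu>] by (simp add: r_def)
  have [measurable]: "rescale \<nu> \<beta> -` E \<in> sets borel"
    by (rule measurable_sets_borel[of _ borel]) measurable
  define F where "F x = ennreal (tau_density \<nu> \<beta> x * indicator weyl_chamber_B x) * indicator E (rescale \<nu> \<beta> x)" for x :: "(real, 'n) vec"
  have Fm: "F \<in> borel_measurable borel" unfolding F_def by measurable
  have "emeasure (distr (tau \<nu> \<beta>) borel (rescale \<nu> \<beta>)) E = emeasure (tau \<nu> \<beta>) (rescale \<nu> \<beta> -` E)"
    by (subst emeasure_distr) (auto simp: tau_def)
  also have "\<dots> = (\<integral>\<^sup>+x. F x \<partial>lborel)"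
    unfolding tau_def F_def by (subst emeasure_density) (auto intro!: nn_integral_cong simp: indicator_def)
  also have "\<dots> = ennreal (sqrt \<beta>) * (\<integral>\<^sup>+y. F (unscale \<nu> \<beta> y) \<partial>lborel)"
    unfolding unscale_def r_def[symmetric] using \<beta> by (intro nn_integral_scale_component[OF Fm r0]) simp
  also have "\<dots> = (\<integral>\<^sup>+y. ennreal (sqrt \<beta>) * F (unscale \<nu> \<beta> y) \<partial>lborel)"
    using Fm by (intro nn_integral_cmult[symmetric]) simp
  also have "\<dots> = (\<integral>\<^sup>+y. ennreal (norm_const TYPE('n) \<nu> \<beta> * pre_shape \<nu> \<beta> y) * indicator E y \<partial>lborel)"
  proof (rule nn_integral_cong)
    fix y :: "(real, 'n) vec"
    define z where "z = unscale \<nu> \<beta> y"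
    define k where "k = \<beta> * c / 2"
    have "sqrt \<beta> * (tau_density \<nu> \<beta> z * indicator weyl_chamber_B z) = norm_const TYPE('n) \<nu> \<beta> * pre_shape \<nu> \<beta> y"
    proof (cases "z \<in> weyl_chamber_B")
      case True
      \<comment> \<open>The Jacobian exponent is \<open>1 / 2 = m - N / 2\<close>; the two parts
        belong to \<open>pre_shape\<close> and \<open>norm_const\<close>.\<close>
      have 1: "sqrt \<beta> = \<beta> powr (- (real CARD('n) / 2)) * \<beta> powr m"
        using \<beta> by (simp add: powr_add[symmetric] m_def add_divide_distrib powr_half_sqrt)
      have 2: "c powr (- k) * c powr k = 1" using c by (simp add: powr_add[symmetric])
      have 3: "energy \<nu> z powr \<beta> = energy \<nu> r powr \<beta> * (energy \<nu> z / energy \<nu> r) powr \<beta>"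
        using er by (simp add: powr_mult[symmetric])
      have 4: "1 / (1 + (norm z)\<^sup>2) powr (k + m) = (1 + z \<bullet> z) powr - (k + m)"
        by (simp only: powr_minus_divide dot_square_norm)
      have "sqrt \<beta> * tau_density \<nu> \<beta> z = C_B \<nu> \<beta> CARD('n) * (\<beta> powr (- (real CARD('n) / 2)) * \<beta> powr m) * (c powr (- k) * c powr k) *
         (1 + z \<bullet> z) powr - (k + m) * (energy \<nu> r powr \<beta> * (energy \<nu> z / energy \<nu> r) powr \<beta>)"
        unfolding tau_density_eq[OF True] 2 1[symmetric] 3[symmetric] 4[symmetric]
        by (simp add: c_def k_def m_def)
      also have "\<dots> = norm_const TYPE('n) \<nu> \<beta> * pre_shape \<nu> \<beta> y"
        using True unfolding norm_const_def pre_shape_def Let_def z_def[symmetric] c_def[symmetric] r_def[symmetric] m_def[symmetric] k_def[symmetric]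
        by simp
      finally show ?thesis using True by simp
    qed (simp add: pre_shape_def Let_def z_def)
    moreover have "rescale \<nu> \<beta> z = y" by (simp add: z_def rescale_unscale[OF \<nu> \<beta>])
    ultimately show "ennreal (sqrt \<beta>) * F (unscale \<nu> \<beta> y) = ennreal (norm_const TYPE('n) \<nu> \<beta> * pre_shape \<nu> \<beta> y) * indicator E y"
      using \<beta> by (simp add: F_def z_def[symmetric] ennreal_mult'[symmetric] mult.assoc[symmetric])
  qed
  also have "\<dots> = emeasure (density lborel (\<lambda>y. ennreal (norm_const TYPE('n) \<nu> \<beta> * pre_shape \<nu> \<beta> y))) E"
    by (subst emeasure_density) auto
  finally show "emeasure (distr (tau \<nu> \<beta>) borel (rescale \<nu> \<beta>)) E = emeasure (density lborel (\<lambda>y. ennreal (norm_const TYPE('n) \<nu> \<beta> * pre_shape \<nu> \<beta> y))) E" .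
qed simp

lemma limit_density_eq:
  fixes y :: "real ^ 'n::{finite,linorder}"
  assumes \<nu>: "\<nu> > 0"
  shows "limit_density \<nu> y * indicator (interior (half_space_B \<nu>)) y =
    limit_norm CARD('n) \<nu> * limit_const CARD('n) \<nu> powr - ((real CARD('n) + 1) / 2) * limit_shape \<nu> y"
proof -
  define r where "r = (r_vec \<nu> :: (real, 'n) vec)"
  define c where "c = limit_const CARD('n) \<nu>"
  define n where "n = CARD('n)"
  have c: "c > 0" using limit_const_pos[OF \<nu>, of "CARD('n)"] by (simp add: c_def)
  have rr: "r \<bullet> r = c" using inner_r_vec[OF \<nu>, where ?'n = 'n] by (simp add: r_def c_def)
  have "r \<noteq> 0" using r_vec_nonzero[OF \<nu>] by (simp add: r_def)
  then have int: "interior (half_space_B \<nu>) = {y. y \<bullet> r > 0}"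
    using interior_halfspace_ge[of r 0] by (simp add: half_space_B_def r_def[symmetric] inner_commute)
  define a where "a = y \<bullet> r / c"
  show ?thesis
  proof (cases "y \<bullet> r > 0")
    case True
    then have a: "a > 0" using c by (simp add: a_def)
    define u where "u = proj_perp r y"
    define p where "p = norm (proj_line r y)"
    have "norm r = sqrt c" by (simp add: norm_eq_sqrt_inner rr)
    then have p: "p = a * sqrt c" using a by (simp add: p_def proj_line_def rr a_def[symmetric])
    have p2: "c / (2 * p\<^sup>2) = 1 / (2 * a\<^sup>2)" using a c by (simp add: p power_mult_distrib)
    have pn: "1 / p ^ (n + 1) = c powr - ((real n + 1) / 2) * (1 / a ^ (n + 1))"
    proof -
      have "sqrt c ^ (n + 1) = c powr ((real n + 1) / 2)"
        using c by (simp add: powr_half_sqrt[symmetric] powr_power del: power_Suc) (simp add: add.commute)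
      then show ?thesis using c by (simp add: p power_mult_distrib powr_minus_divide)
    qed
    have q: "y \<bullet> (Sigma_inv \<nu> *v y) = 2 * c * a\<^sup>2 + u \<bullet> (Sigma_inv \<nu> *v u)"
      using quadratic_split[OF \<nu>, of y] by (simp add: r_def c_def a_def u_def)
    \<comment> \<open>Since \<open>||p_r(y)||^2 = c a^2\<close>, the component along
      \<open>r\<close> contributes the constant \<open>exp (- c)\<close> to the Gaussian factor;
      this is where the exponential in \<open>D_const\<close> comes from.\<close>
    have e: "exp c * (exp (- (1 / (2 * a\<^sup>2)) * (2 * c * a\<^sup>2 + w)) * exp (- (1 / (2 * a\<^sup>2)))) = exp (- (1 + w) / (2 * a\<^sup>2))" for w
      using a by (simp add: exp_add[symmetric] field_simps)
    have "limit_density \<nu> y = limit_norm n \<nu> * (exp c * (exp (- (c / (2 * p\<^sup>2)) * (y \<bullet> (Sigma_inv \<nu> *v y))) * exp (- (c / (2 * p\<^sup>2))))) * (1 / p ^ (n + 1))"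
      by (simp add: limit_density_def Let_def D_const_def limit_norm_def r_def c_def p_def n_def)
    also have "\<dots> = limit_norm n \<nu> * exp (- (1 + u \<bullet> (Sigma_inv \<nu> *v u)) / (2 * a\<^sup>2)) * (c powr - ((real n + 1) / 2) * (1 / a ^ (n + 1)))"
      unfolding p2 q e pn ..
    also have "\<dots> = limit_norm n \<nu> * c powr - ((real n + 1) / 2) * limit_shape \<nu> y"
    proof -
      have "limit_shape \<nu> y = exp (- (1 + u \<bullet> (Sigma_inv \<nu> *v u)) / (2 * a\<^sup>2)) / a ^ (n + 1)"
        using a by (simp add: limit_shape_def Let_def r_def c_def a_def u_def n_def)
      then show ?thesis by simp
    qed
    finally show ?thesis using True by (simp add: int n_def c_def)
  next
    case False
    then have "\<not> a > 0" using c by (simp add: a_def zero_less_divide_iff)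
    then show ?thesis using False
      by (simp add: int limit_shape_def Let_def r_def[symmetric] c_def[symmetric] a_def[symmetric])
  qed
qed

lemma emeasure_lborel_open_pos:
  fixes U :: "'a::euclidean_space set"
  assumes "open U" "U \<noteq> {}"
  shows "emeasure lborel U > 0"
proof -
  have "\<not> negligible U" using assms by (rule open_not_negligible)
  then have "U \<notin> null_sets lborel"
    unfolding negligible_iff_null_sets using null_sets_completionI by blast
  then show ?thesis using assms by (auto simp: null_sets_def zero_less_iff_neq_zero)
qed

lemma limit_norm_pos: "\<nu> > 0 \<Longrightarrow> n > 0 \<Longrightarrow> limit_norm n \<nu> > 0"
  using limit_const_pos[of \<nu> n] by (simp add: limit_norm_def)

lemma limit_shape_nonneg: "0 \<le> limit_shape \<nu> y"
proof -
  have "0 \<le> (if a > 0 then exp x / a ^ k else 0)" for a x :: real and k by simp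
  then show ?thesis by (simp only: limit_shape_def Let_def)
qed

text \<open>Used with \<open>f = 1\<close> for the convergence of the total masses and with bounded
  continuous \<open>f\<close> for convergence in distribution.\<close>

lemma pre_shape_dominated:
  fixes f :: "real ^ 'n::{finite,linorder} \<Rightarrow> real"
  assumes \<nu>: "\<nu> > 0" and f[measurable]: "f \<in> borel_measurable borel" and fb: "\<And>x. \<bar>f x\<bar> \<le> B"
  defines "c \<equiv> limit_const CARD('n) \<nu>" and "m \<equiv> (real CARD('n) + 1) / 2"
  shows "((\<lambda>\<beta>. \<integral>y. pre_shape \<nu> \<beta> y * f y \<partial>lborel) \<longlongrightarrow> c powr - m * (\<integral>y. limit_shape \<nu> y * f y \<partial>lborel)) at_top"
    and "\<beta> > 0 \<Longrightarrow> \<beta> \<ge> 2 * m / c \<Longrightarrow> integrable lborel (\<lambda>y. pre_shape \<nu> \<beta> y * f y)"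
    and "integrable lborel (\<lambda>y. limit_shape \<nu> y * f y)"
proof -
  have c: "c > 0" using limit_const_pos[OF \<nu>, of "CARD('n)"] by (simp add: c_def)
  define w where "w y = min 1 (c / (2 * m)) powr - m * (1 + y \<bullet> y) powr - m * B" for y :: "(real, 'n) vec"
  have w: "integrable lborel w"
    unfolding w_def m_def by (intro integrable_mult_left integrable_mult_right integrable_multivariate_Cauchy)
  have bound: "\<bar>pre_shape \<nu> \<beta> y * f y\<bar> \<le> w y" if "\<beta> > 0" "\<beta> \<ge> 2 * m / c" for \<beta> y
  proof -
    have "pre_shape \<nu> \<beta> y \<le> min 1 (c / (2 * m)) powr - m * (1 + y \<bullet> y) powr - m"
      unfolding c_def m_def by (rule pre_shape_le[OF \<nu> that(1)]) (use that(2) in \<open>simp add: c_def m_def\<close>)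
    then have "pre_shape \<nu> \<beta> y * \<bar>f y\<bar> \<le> w y"
      unfolding w_def using fb[of y] pre_shape_nonneg[OF \<nu>, of \<beta> y] by (intro mult_mono) auto
    then show ?thesis using pre_shape_nonneg[OF \<nu>, of \<beta> y] by (simp add: abs_mult)
  qed
  have ev: "eventually (\<lambda>\<beta>. AE y in lborel. norm (pre_shape \<nu> \<beta> y * f y) \<le> w y) at_top"
    using eventually_gt_at_top[of 0] eventually_ge_at_top[of "2 * m / c"]
    by eventually_elim (auto simp: bound)
  have lim: "((\<lambda>\<beta>. pre_shape \<nu> \<beta> y * f y) \<longlongrightarrow> c powr - m * limit_shape \<nu> y * f y) at_top" for y
    unfolding c_def m_def by (intro tendsto_mult tendsto_const pre_shape_tendsto[OF \<nu>])
  have "((\<lambda>\<beta>. \<integral>y. pre_shape \<nu> \<beta> y * f y \<partial>lborel) \<longlongrightarrow> (\<integral>y. c powr - m * limit_shape \<nu> y * f y \<partial>lborel)) at_top"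
    by (rule integral_dominated_convergence_at_top[OF _ _ w _ ev]) (auto simp: lim)
  then show "((\<lambda>\<beta>. \<integral>y. pre_shape \<nu> \<beta> y * f y \<partial>lborel) \<longlongrightarrow> c powr - m * (\<integral>y. limit_shape \<nu> y * f y \<partial>lborel)) at_top"
    by (simp add: mult.assoc)
  have "integrable lborel (\<lambda>y. c powr - m * limit_shape \<nu> y * f y)"
    by (rule integrable_dominated_convergence_at_top[OF _ _ w _ ev]) (auto simp: lim)
  then have "integrable lborel (\<lambda>y. c powr m * (c powr - m * limit_shape \<nu> y * f y))"
    by (rule integrable_mult_right)
  moreover have "c powr m * (c powr - m * limit_shape \<nu> y * f y) = limit_shape \<nu> y * f y" for y
    using c by (simp add: mult.assoc[symmetric] powr_add[symmetric])
  ultimately show "integrable lborel (\<lambda>y. limit_shape \<nu> y * f y)" by simp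
  show "integrable lborel (\<lambda>y. pre_shape \<nu> \<beta> y * f y)" if "\<beta> > 0" "\<beta> \<ge> 2 * m / c"
  proof (rule Bochner_Integration.integrable_bound[OF w])
    show "AE y in lborel. norm (pre_shape \<nu> \<beta> y * f y) \<le> norm (w y)"
      using bound[OF that] by (intro AE_I2) (simp only: real_norm_def order_trans[OF _ abs_ge_self])
  qed simp
qed

text \<open>Eliminates the implicit rate \<open>b\<close>: dividing the two limits,
  \<open>exp (- (b * x))\<close> converges to a positive number, and comparing its values at
  \<open>x + 1\<close> and \<open>x\<close> gives \<open>exp (- b) = 1\<close>.\<close>

lemma exp_rate_unique:
  fixes K :: "real \<Rightarrow> real"
  assumes K: "(K \<longlongrightarrow> L) at_top" and L: "L > 0"
    and S: "((\<lambda>x. K x * exp (- (b * x))) \<longlongrightarrow> S) at_top" and "S > 0"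
  shows "L = S"
proof -
  have "((\<lambda>x. (K x * exp (- (b * x))) / K x) \<longlongrightarrow> S / L) at_top"
    using L by (intro tendsto_divide K S) auto
  moreover have "eventually (\<lambda>x. K x > 0) at_top" using order_tendstoD(1)[OF K L] .
  then have "eventually (\<lambda>x. (K x * exp (- (b * x))) / K x = exp (- (b * x))) at_top"
    by eventually_elim simp
  ultimately have e: "((\<lambda>x. exp (- (b * x))) \<longlongrightarrow> S / L) at_top"
    by (rule Lim_transform_eventually)
  have "filterlim (\<lambda>x::real. x + 1) at_top at_top" by real_asymp
  from filterlim_compose[OF e this] have "((\<lambda>x. exp (- (b * (x + 1)))) \<longlongrightarrow> S / L) at_top" .
  from tendsto_divide[OF this e] have "((\<lambda>x. exp (- (b * (x + 1))) / exp (- (b * x))) \<longlongrightarrow> 1) at_top"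
    using L \<open>S > 0\<close> by simp
  moreover have "exp (- (b * (x + 1))) / exp (- (b * x)) = exp (- b)" for x
    by (simp add: exp_diff[symmetric] distrib_left)
  ultimately have "((\<lambda>x::real. exp (- b)) \<longlongrightarrow> 1) at_top" by simp
  then have "exp (- b) = 1" by (simp add: tendsto_const_iff)
  then have "b = 0" by simp
  then have "(K \<longlongrightarrow> S) at_top" using S by simp
  then show ?thesis using K by (rule tendsto_unique[OF trivial_limit_at_top_linorder, rotated])
qed

text \<open>No closed form of the determinant of \<open>\<Sigma>\<close> or of the Laguerre discriminant is needed: \<open>tau\<close> is a
  probability measure, so its normalising constant converges, and Stirling's formula gives the limit.\<close>

lemma norm_const_limit:
  assumes \<nu>: "\<nu> > 0"
    and prob: "\<And>\<beta>. \<beta> > 0 \<Longrightarrow> prob_space (tau \<nu> \<beta> :: (real ^ 'n::{finite,linorder}) measure)"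
  defines "c \<equiv> limit_const CARD('n) \<nu>" and "m \<equiv> (real CARD('n) + 1) / 2"
  shows "((\<lambda>\<beta>. norm_const TYPE('n) \<nu> \<beta>) \<longlongrightarrow> limit_norm CARD('n) \<nu>) at_top"
    and "limit_norm CARD('n) \<nu> * c powr - m * (\<integral>y. limit_shape \<nu> (y :: real ^ 'n::{finite,linorder}) \<partial>lborel) = 1"
proof -
  define S where "S = limit_norm CARD('n) \<nu>"
  have S: "S > 0" unfolding S_def by (rule limit_norm_pos[OF \<nu>]) simp
  have c: "c > 0" using limit_const_pos[OF \<nu>, of "CARD('n)"] by (simp add: c_def)
  define I where "I = (\<integral>y. limit_shape \<nu> (y :: (real, 'n) vec) \<partial>lborel)"
  have one: "(\<lambda>_. 1 :: real) \<in> borel_measurable (borel :: (real, 'n) vec measure)" "\<bar>1 :: real\<bar> \<le> 1" by auto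
  note dom = pre_shape_dominated[OF \<nu> one, folded c_def m_def, unfolded mult_1_right]
  define J where "J \<beta> = (\<integral>y. pre_shape \<nu> \<beta> (y :: (real, 'n) vec) \<partial>lborel)" for \<beta>
  have J: "(J \<longlongrightarrow> c powr - m * I) at_top" unfolding J_def I_def by (rule dom(1))
  have KJ: "eventually (\<lambda>\<beta>. norm_const TYPE('n) \<nu> \<beta> * J \<beta> = 1) at_top"
    using eventually_gt_at_top[of 0] eventually_ge_at_top[of "2 * m / c"]
  proof eventually_elim
    case (elim \<beta>)
    define K where "K = norm_const TYPE('n) \<nu> \<beta>"
    have "K \<ge> 0" unfolding K_def norm_const_def using C_B_nonneg[OF \<nu> elim(1), of "CARD('n)"] by simp
    interpret prob_space "tau \<nu> \<beta> :: (real, 'n) vec measure" by (rule prob[OF elim(1)])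
    have "rescale \<nu> \<beta> \<in> measurable (tau \<nu> \<beta> :: (real, 'n) vec measure) borel"
      using measurable_rescale by (simp add: tau_def)
    from prob_space_distr[OF this]
    have "prob_space (density lborel (\<lambda>y :: (real, 'n) vec. ennreal (K * pre_shape \<nu> \<beta> y)))"
      unfolding distr_tau_rescale[OF \<nu> elim(1)] K_def .
    then have "emeasure (density lborel (\<lambda>y :: (real, 'n) vec. ennreal (K * pre_shape \<nu> \<beta> y))) UNIV = 1"
      using prob_space.emeasure_space_1 by fastforce
    then have "(\<integral>\<^sup>+y. ennreal (K * pre_shape \<nu> \<beta> (y :: (real, 'n) vec)) \<partial>lborel) = 1"
      by (simp add: emeasure_density)
    moreover have "(\<integral>\<^sup>+y. ennreal (K * pre_shape \<nu> \<beta> (y :: (real, 'n) vec)) \<partial>lborel) = ennreal (K * J \<beta>)"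
      unfolding J_def integral_mult_right_zero[symmetric]
      using \<open>K \<ge> 0\<close> pre_shape_nonneg[OF \<nu>]
      by (intro nn_integral_eq_integral integrable_mult_right dom(2) elim AE_I2 mult_nonneg_nonneg)
    ultimately show "norm_const TYPE('n) \<nu> \<beta> * J \<beta> = 1" by (simp add: K_def)
  qed
  obtain b where b: "((\<lambda>\<beta>. norm_const TYPE('n) \<nu> \<beta> * exp (- (b * \<beta>))) \<longlongrightarrow> S) at_top"
    unfolding S_def by (rule norm_const_asymp[OF \<nu>])
  \<comment> \<open>Needed to invert the limit of the masses \<open>J\<close>; the limit function is
    positive on a nonempty open half space.\<close>
  have I: "I > 0"
  proof -
    have "I \<ge> 0" unfolding I_def by (intro Bochner_Integration.integral_nonneg limit_shape_nonneg)
    moreover have "I \<noteq> 0"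
    proof
      assume "I = 0"
      then have "AE y in lborel. limit_shape \<nu> (y :: (real, 'n) vec) = 0"
        unfolding I_def using dom(3) limit_shape_nonneg by (subst (asm) integral_nonneg_eq_0_iff_AE) auto
      moreover have "limit_shape \<nu> y \<noteq> 0" if "y \<bullet> r_vec \<nu> > 0" for y :: "(real, 'n) vec"
        using that c by (simp add: limit_shape_def Let_def c_def[symmetric])
      ultimately have "AE y in lborel. \<not> (y :: (real, 'n) vec) \<bullet> r_vec \<nu> > 0"
        by (auto elim!: eventually_mono)
      then have "emeasure lborel {y :: (real, 'n) vec. y \<bullet> r_vec \<nu> > 0} = 0"
        by (subst (asm) AE_iff_measurable[OF _ refl]) auto
      moreover have "open {y :: (real, 'n) vec. y \<bullet> r_vec \<nu> > 0}"
        by (intro open_Collect_less continuous_intros)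
      moreover have "r_vec \<nu> \<in> {y :: (real, 'n) vec. y \<bullet> r_vec \<nu> > 0}"
        using r_vec_nonzero[OF \<nu>, where ?'n = 'n] by simp
      ultimately show False
        by (metis emeasure_lborel_open_pos empty_iff less_irrefl)
    qed
    ultimately show ?thesis by simp
  qed
  define L where "L = 1 / (c powr - m * I)"
  have L: "L > 0" using I c by (simp add: L_def)
  have K: "((\<lambda>\<beta>. norm_const TYPE('n) \<nu> \<beta>) \<longlongrightarrow> L) at_top"
  proof (rule Lim_transform_eventually)
    show "((\<lambda>\<beta>. 1 / J \<beta>) \<longlongrightarrow> L) at_top"
      unfolding L_def using I c by (intro tendsto_divide tendsto_const J) auto
    show "eventually (\<lambda>\<beta>. 1 / J \<beta> = norm_const TYPE('n) \<nu> \<beta>) at_top"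
      using KJ by eventually_elim (metis mult_zero_right nonzero_mult_div_cancel_right zero_neq_one)
  qed
  \<comment> \<open>\<open>L\<close> comes from mass one, \<open>S\<close> from Stirling's formula.
    Their equality is also the statement that the limit has mass one.\<close>
  have LS: "L = S" by (rule exp_rate_unique[OF K L b S])
  show "((\<lambda>\<beta>. norm_const TYPE('n) \<nu> \<beta>) \<longlongrightarrow> limit_norm CARD('n) \<nu>) at_top"
    using K unfolding LS S_def .
  show "limit_norm CARD('n) \<nu> * c powr - m * (\<integral>y. limit_shape \<nu> (y :: real ^ 'n::{finite,linorder}) \<partial>lborel) = 1"
    using I c unfolding S_def[symmetric] LS[symmetric] I_def[symmetric] by (simp add: L_def)
qed

theorem theorem4p4:
  fixes \<nu> :: real
    and M :: "real \<Rightarrow> 'a measure"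
    and X :: "real \<Rightarrow> 'a \<Rightarrow> real ^ 'n::{finite,linorder}"
  assumes "\<nu> > 0"
    and "\<And>\<beta>. \<beta> > 0 \<Longrightarrow> prob_space (M \<beta>)"
    and "\<And>\<beta>. \<beta> > 0 \<Longrightarrow> X \<beta> \<in> borel_measurable (M \<beta>)"
    and "\<And>\<beta> \<omega>. \<beta> > 0 \<Longrightarrow> \<omega> \<in> space (M \<beta>) \<Longrightarrow> X \<beta> \<omega> \<in> weyl_chamber_B"
    and "\<And>\<beta>. \<beta> > 0 \<Longrightarrow> distr (M \<beta>) borel (X \<beta>) = tau \<nu> \<beta>"
  shows "\<exists>\<mu> :: (real ^ 'n::{finite,linorder}) measure.
    prob_space \<mu> \<and> sets \<mu> = sets borel \<and>
    converges_in_distribution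
      (\<lambda>\<beta>. distr (M \<beta>) borel (\<lambda>\<omega>. rescale \<nu> \<beta> (X \<beta> \<omega>))) \<mu> at_top \<and>
    support_measure \<mu> = half_space_B \<nu> \<and>
    (\<forall>E\<in>sets borel. emeasure \<mu> E =
      ennreal (1 / sqrt (2 * pi)) *
      (\<integral>\<^sup>+ s\<in>{0<..}.
         (emeasure (normal_distribution (sqrt s *\<^sub>R r_vec \<nu>)
            (s *\<^sub>R (A_mat \<nu> ** Sigma_cov \<nu> ** A_mat \<nu>))) E *
          ennreal (s powr (- 3 / 2) * exp (- 1 / (2 * s)))) \<partial>lborel)) \<and>
    \<mu> = density lborel
      (\<lambda>y. ennreal (limit_density \<nu> y * indicator (interior (half_space_B \<nu>)) y))"
proof -
  define r where "r = (r_vec \<nu> :: (real, 'n) vec)"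
  define c where "c = limit_const CARD('n) \<nu>"
  define m where "m = (real CARD('n) + 1) / 2"
  define S where "S = limit_norm CARD('n) \<nu>"
  define \<kappa> where "\<kappa> = S * c powr - m"
  \<comment> \<open>The measure is introduced through its density in the form of
    \<open>limit_shape\<close>; the printed density, the support and the mixture are then derived
    for it.\<close>
  define \<mu> :: "(real, 'n) vec measure" where "\<mu> = density lborel (\<lambda>y. ennreal (\<kappa> * limit_shape \<nu> y))"
  note \<nu> = assms(1)
  have c: "c > 0" using limit_const_pos[OF \<nu>, of "CARD('n)"] by (simp add: c_def)
  have S: "S > 0" unfolding S_def by (rule limit_norm_pos[OF \<nu>]) simp
  have \<kappa>: "\<kappa> > 0" using S c by (simp add: \<kappa>_def)
  \<comment> \<open>Mass one of \<open>tau\<close> is obtained from the variables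
    \<open>X \<beta>\<close>, whose law it is.\<close>
  have prob: "prob_space (tau \<nu> \<beta> :: (real, 'n) vec measure)" if "\<beta> > 0" for \<beta>
    unfolding assms(5)[OF that, symmetric] by (rule prob_space.prob_space_distr[OF assms(2,3)[OF that]])
  have one: "(\<lambda>_. 1 :: real) \<in> borel_measurable (borel :: (real, 'n) vec measure)" "\<bar>1 :: real\<bar> \<le> 1" by auto
  have int: "integrable lborel (\<lambda>y :: (real, 'n) vec. limit_shape \<nu> y)"
    using pre_shape_dominated(3)[OF \<nu> one] by simp
  have total: "ennreal \<kappa> * (\<integral>\<^sup>+y. ennreal (limit_shape \<nu> (y :: (real, 'n) vec)) \<partial>lborel) = 1"
  proof -
    have "(\<integral>\<^sup>+y. ennreal (limit_shape \<nu> (y :: (real, 'n) vec)) \<partial>lborel) = ennreal (\<integral>y. limit_shape \<nu> (y :: (real, 'n) vec) \<partial>lborel)"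
      by (rule nn_integral_eq_integral[OF int]) (simp add: limit_shape_nonneg)
    then show ?thesis
      using norm_const_limit(2)[OF \<nu> prob] \<kappa>
      by (simp add: ennreal_mult'[symmetric] \<kappa>_def S_def c_def m_def)
  qed
  have \<mu>_eq: "emeasure \<mu> E = ennreal \<kappa> * (\<integral>\<^sup>+y. ennreal (limit_shape \<nu> y) * indicator E y \<partial>lborel)"
    if [measurable]: "E \<in> sets borel" for E
    unfolding \<mu>_def using \<kappa>
    by (subst emeasure_density) (auto simp: ennreal_mult limit_shape_nonneg mult.assoc nn_integral_cmult)
  have \<mu>_prob: "prob_space \<mu>"
    by (rule prob_spaceI) (use \<mu>_eq[of UNIV] total in \<open>simp add: \<mu>_def\<close>)
  have \<mu>_density: "\<mu> = density lborel (\<lambda>y. ennreal (limit_density \<nu> y * indicator (interior (half_space_B \<nu>)) y))"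
    unfolding \<mu>_def limit_density_eq[OF \<nu>] by (simp add: \<kappa>_def S_def c_def m_def)
  have conv: "converges_in_distribution (\<lambda>\<beta>. distr (M \<beta>) borel (\<lambda>\<omega>. rescale \<nu> \<beta> (X \<beta> \<omega>))) \<mu> at_top"
    unfolding converges_in_distribution_def
  proof (intro allI impI)
    fix f :: "(real, 'n) vec \<Rightarrow> real"
    assume f: "continuous_on UNIV f" and fb: "bounded (range f)"
    have [measurable]: "f \<in> borel_measurable borel" using f by (rule borel_measurable_continuous_onI)
    obtain B where B: "\<And>x. \<bar>f x\<bar> \<le> B" using fb by (auto simp: bounded_iff)
    have "((\<lambda>\<beta>. norm_const TYPE('n) \<nu> \<beta> * (\<integral>y. pre_shape \<nu> \<beta> y * f y \<partial>lborel)) \<longlongrightarrow>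
        S * (c powr - m * (\<integral>y. limit_shape \<nu> y * f y \<partial>lborel))) at_top"
      unfolding S_def c_def m_def
      by (intro tendsto_mult norm_const_limit(1)[OF \<nu> prob] pre_shape_dominated(1)[OF \<nu> _ B]) auto
    also have "S * (c powr - m * (\<integral>y. limit_shape \<nu> y * f y \<partial>lborel)) = (\<integral>y. f y \<partial>\<mu>)"
    proof -
      have "(\<integral>y. f y \<partial>\<mu>) = (\<integral>y. (\<kappa> * limit_shape \<nu> y) *\<^sub>R f y \<partial>lborel)"
        unfolding \<mu>_def using \<kappa> by (intro integral_density AE_I2 mult_nonneg_nonneg limit_shape_nonneg) auto
      then show ?thesis by (simp add: \<kappa>_def mult.assoc)
    qed
    finally show "((\<lambda>\<beta>. \<integral>y. f y \<partial>distr (M \<beta>) borel (\<lambda>\<omega>. rescale \<nu> \<beta> (X \<beta> \<omega>))) \<longlongrightarrow> (\<integral>y. f y \<partial>\<mu>)) at_top"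
    proof (rule Lim_transform_eventually)
      show "eventually (\<lambda>\<beta>. norm_const TYPE('n) \<nu> \<beta> * (\<integral>y. pre_shape \<nu> \<beta> y * f y \<partial>lborel) =
        (\<integral>y. f y \<partial>distr (M \<beta>) borel (\<lambda>\<omega>. rescale \<nu> \<beta> (X \<beta> \<omega>)))) at_top"
        using eventually_gt_at_top[of 0]
      proof eventually_elim
        case (elim \<beta>)
        have [measurable]: "X \<beta> \<in> borel_measurable (M \<beta>)" by (rule assms(3)[OF elim])
        have K: "norm_const TYPE('n) \<nu> \<beta> \<ge> 0"
          unfolding norm_const_def using C_B_nonneg[OF \<nu> elim, of "CARD('n)"] by simp
        have "distr (M \<beta>) borel (\<lambda>\<omega>. rescale \<nu> \<beta> (X \<beta> \<omega>)) = distr (distr (M \<beta>) borel (X \<beta>)) borel (rescale \<nu> \<beta>)"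
          by (subst distr_distr) (auto simp: comp_def)
        also have "\<dots> = density lborel (\<lambda>y. ennreal (norm_const TYPE('n) \<nu> \<beta> * pre_shape \<nu> \<beta> y))"
          unfolding assms(5)[OF elim] by (rule distr_tau_rescale[OF \<nu> elim])
        finally have eq: "distr (M \<beta>) borel (\<lambda>\<omega>. rescale \<nu> \<beta> (X \<beta> \<omega>)) =
          density lborel (\<lambda>y. ennreal (norm_const TYPE('n) \<nu> \<beta> * pre_shape \<nu> \<beta> y))" .
        have "(\<integral>y. f y \<partial>distr (M \<beta>) borel (\<lambda>\<omega>. rescale \<nu> \<beta> (X \<beta> \<omega>)))
          = (\<integral>y. (norm_const TYPE('n) \<nu> \<beta> * pre_shape \<nu> \<beta> y) *\<^sub>R f y \<partial>lborel)"
          unfolding eq by (intro integral_density AE_I2 mult_nonneg_nonneg K pre_shape_nonneg[OF \<nu>]) auto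
        then show ?case by (simp add: mult.assoc)
      qed
    qed
  qed
  have int_half: "limit_shape \<nu> y > 0 \<longleftrightarrow> y \<bullet> r > 0" for y :: "(real, 'n) vec"
    using c by (auto simp: limit_shape_def Let_def r_def c_def zero_less_divide_iff)
  have supp: "support_measure \<mu> = half_space_B \<nu>"
  proof (intro set_eqI iffI)
    fix x assume x: "x \<in> support_measure \<mu>"
    show "x \<in> half_space_B \<nu>"
    proof (rule ccontr)
      assume "x \<notin> half_space_B \<nu>"
      then have xr: "x \<in> {y. y \<bullet> r < 0}" by (simp add: half_space_B_def r_def)
      have op: "open {y. y \<bullet> r < 0}" by (intro open_Collect_less continuous_intros)
      have "ennreal (limit_shape \<nu> y) * indicator {y. y \<bullet> r < 0} y = 0" for y
        using int_half[of y] limit_shape_nonneg[of \<nu> y] by (auto simp: indicator_def)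
      then have "(\<integral>\<^sup>+y. ennreal (limit_shape \<nu> y) * indicator {y. y \<bullet> r < 0} y \<partial>lborel) = 0"
        by (simp only: nn_integral_const mult_zero_left)
      then have "emeasure \<mu> {y. y \<bullet> r < 0} = 0"
        using op by (subst \<mu>_eq) simp_all
      then show False using x op xr unfolding support_measure_def by force
    qed
  next
    fix x :: "(real, 'n) vec" assume x: "x \<in> half_space_B \<nu>"
    show "x \<in> support_measure \<mu>"
      unfolding support_measure_def mem_Collect_eq
    proof (intro allI impI)
      fix U :: "(real, 'n) vec set" assume U: "open U" "x \<in> U"
      \<comment> \<open>The density is zero at boundary points of the half space, so
        \<open>U\<close> is replaced by its part in the open half space; moving \<open>x\<close>
        slightly in the direction \<open>r\<close> shows that this part is nonempty.\<close>
      define V where "V = U \<inter> {y. y \<bullet> r > 0}"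
      have V: "open V" unfolding V_def by (intro open_Int U open_Collect_less continuous_intros)
      have "V \<noteq> {}"
      proof -
        obtain e where e: "e > 0" "ball x e \<subseteq> U" using U by (auto simp: open_contains_ball)
        have r0: "r \<noteq> 0" using r_vec_nonzero[OF \<nu>] by (simp add: r_def)
        define y where "y = x + (e / (2 * norm r)) *\<^sub>R r"
        have "y \<in> ball x e" using e r0 by (simp add: y_def dist_norm)
        moreover have "y \<bullet> r > 0"
          using x e r0 by (simp add: y_def inner_add_left half_space_B_def r_def[symmetric] add_nonneg_pos)
        ultimately show ?thesis using e by (auto simp: V_def)
      qed
      then have "emeasure lborel V > 0"
        by (rule emeasure_lborel_open_pos[OF V])
      have "emeasure \<mu> V \<noteq> 0"
      proof
        assume "emeasure \<mu> V = 0"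
        then have "(\<integral>\<^sup>+y. ennreal (limit_shape \<nu> y) * indicator V y \<partial>lborel) = 0"
          using V \<kappa> by (simp add: \<mu>_eq)
        then have "AE y in lborel. ennreal (limit_shape \<nu> y) * indicator V y = 0"
          using V by (subst (asm) nn_integral_0_iff_AE) auto
        then have "AE y in lborel. y \<notin> V"
        proof eventually_elim
          case (elim y)
          then show ?case using int_half[of y] by (auto simp: V_def indicator_def ennreal_eq_0_iff split: if_splits)
        qed
        then have "emeasure lborel V = 0"
          using V by (subst (asm) AE_iff_measurable[of V]) auto
        then show False using \<open>emeasure lborel V > 0\<close> by simp
      qed
      then have "0 < emeasure \<mu> V" by (simp add: zero_less_iff_neq_zero)
      also have "emeasure \<mu> V \<le> emeasure \<mu> U"
        using U by (intro emeasure_mono) (auto simp: V_def \<mu>_def)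
      finally show "0 < emeasure \<mu> U" .
    qed
  qed
  have mix: "emeasure \<mu> E = ennreal (1 / sqrt (2 * pi)) *
      (\<integral>\<^sup>+ s\<in>{0<..}. (emeasure (normal_distribution (sqrt s *\<^sub>R r_vec \<nu>)
            (s *\<^sub>R (A_mat \<nu> ** Sigma_cov \<nu> ** A_mat \<nu>))) E *
          ennreal (s powr (- 3 / 2) * exp (- 1 / (2 * s)))) \<partial>lborel)" if E: "E \<in> sets borel" for E
  proof -
    obtain K where K: "\<And>E :: (real, 'n) vec set. E \<in> sets borel \<Longrightarrow>
      (\<integral>\<^sup>+s\<in>{0<..}. (emeasure (normal_distribution (sqrt s *\<^sub>R r_vec \<nu>) (s *\<^sub>R (A_mat \<nu> ** Sigma_cov \<nu> ** A_mat \<nu>))) E *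
          ennreal (s powr (- 3 / 2) * exp (- 1 / (2 * s)))) \<partial>lborel) =
      K * (\<integral>\<^sup>+x. ennreal (limit_shape \<nu> x) * indicator E x \<partial>lborel)"
      by (rule mixture_eq_limit_shape[OF \<nu>]) blast
    define I where "I = (\<integral>\<^sup>+y. ennreal (limit_shape \<nu> (y :: (real, 'n) vec)) \<partial>lborel)"
    have mass: "emeasure (normal_distribution (sqrt s *\<^sub>R r_vec \<nu>) (s *\<^sub>R (A_mat \<nu> ** Sigma_cov \<nu> ** A_mat \<nu>))) (UNIV :: (real, 'n) vec set) = 1"
      if s: "s > 0" for s
    proof -
      have "emeasure (normal_distribution (t *\<^sub>R r_vec \<nu>) (t\<^sup>2 *\<^sub>R (A_mat \<nu> ** Sigma_cov \<nu> ** A_mat \<nu>))) (UNIV :: (real, 'n) vec set) = 1"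
        if "t > 0" for t
        by (rule normal_distribution_perp_uniform[OF \<nu>, where ?'n = 'n]) (use that in blast)
      from this[of "sqrt s"] show ?thesis using s by simp
    qed
    have "K * I = (\<integral>\<^sup>+s. ennreal (s powr (- 3 / 2) * exp (- 1 / (2 * s))) * indicator {0<..} s \<partial>lborel)"
    proof -
      have "K * I = (\<integral>\<^sup>+s\<in>{0<..}. (emeasure (normal_distribution (sqrt s *\<^sub>R r_vec \<nu>) (s *\<^sub>R (A_mat \<nu> ** Sigma_cov \<nu> ** A_mat \<nu>))) (UNIV :: (real, 'n) vec set) *
          ennreal (s powr (- 3 / 2) * exp (- 1 / (2 * s)))) \<partial>lborel)"
        unfolding I_def by (subst K) simp_all
      also have "\<dots> = (\<integral>\<^sup>+s. ennreal (s powr (- 3 / 2) * exp (- 1 / (2 * s))) * indicator {0<..} s \<partial>lborel)"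
        by (intro nn_integral_cong) (simp add: mass indicator_def)
      finally show ?thesis .
    qed
    also have "\<dots> = ennreal (sqrt (2 * pi))" by (rule nn_integral_mixture_weight)
    finally have KI: "ennreal (1 / sqrt (2 * pi)) * K * I = 1"
      by (simp add: mult.assoc ennreal_mult[symmetric])
    \<comment> \<open>Equal masses identify the two constants; \<open>I\<close> is cancelled in
      \<open>ennreal\<close> by inserting a product equal to one.\<close>
    have "ennreal \<kappa> = ennreal \<kappa> * (ennreal (1 / sqrt (2 * pi)) * K * I)" by (simp add: KI)
    also have "\<dots> = ennreal (1 / sqrt (2 * pi)) * K * (ennreal \<kappa> * I)" by (simp only: mult_ac)
    also have "\<dots> = ennreal (1 / sqrt (2 * pi)) * K" unfolding total[folded I_def] by simp
    finally show ?thesis unfolding K[OF E] \<mu>_eq[OF E] by (simp only: mult.assoc)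
  qed
  show ?thesis
    by (intro exI[of _ \<mu>] conjI \<mu>_prob conv supp \<mu>_density ballI mix) (simp add: \<mu>_def)
qed

end
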